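(* Let $M$ be an $m$-dimensional differentiable ($C^\infty$) manifold, let $C^\infty(M)$ be the $\mathbb{R}$-algebra of smooth real-valued functions on $M$, and let $r\ge1$. If $D$ is a derivation of order $\le r$ on $C^\infty(M)$, then $D\in SDer^r(C^\infty(M))$.
   Context: Let $A$ be a commutative associative algebra with unit $e$ over a field $\mathbb{K}$ (here $A=C^\infty(M)$, $\mathbb{K}=\mathbb{R}$), product written by juxtaposition. $Der(A)$ is the space of $\mathbb{K}$-linear maps $X:A\to A$ with $X(ab)=X(a)b+aX(b)$. $SDer^r(A)$ is the set of all $\mathbb{K}$-linear maps $A\to A$ that are (finite) linear combinations of composites $X_1\circ\cdots\circ X_s$ with $X_1,\dots,X_s\in Der(A)$ and $1\le s\le r$. Differential operators are defined recursively: a map $D:A\to A$ is a differential operator of order $0$ iff there is $a\in A$ with $D(b)=ab$ for all $b\in A$; for $r\ge1$, a $\mathbb{K}$-linear map $D:A\to A$ is a differential operator of order $\le r$ iff for every $a\in A$ the map $b\mapsto D(ab)-aD(b)$ is a differential operator of order $\le r-1$ (where "order $\le 0$" means order $0$). A derivation of order $\le r$ on $A$ is a differential operator $D$ of order $\le r$ such that $D(\alpha e)=0$ for all $\alpha\in\mathbb{K}$. *)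

theory Defs
  imports
    "HOL-Analysis.Analysis"
    "HOL-Algebra.Algebraic_Closure_Type"
begin

section \<open>Derivations and differential operators on a \<open>K\<close>-algebra\<close>

text \<open>
  In this section \<open>K\<close> is the ground field and \<open>A\<close> a commutative unital algebra over it
  (\<^locale>\<open>algebra\<close> of HOL-Algebra). A map \<open>A \<rightarrow> A\<close> is represented by a HOL function of which
  only the values on \<^term>\<open>carrier A\<close> matter; accordingly every set of maps defined below is
  closed under changing values outside \<^term>\<open>carrier A\<close>.
\<close>

definition linear_maps :: "('k, 'x) ring_scheme \<Rightarrow> ('k, 'a, 'y) module_scheme \<Rightarrow> ('a \<Rightarrow> 'a) set"
  where "linear_maps K A =
    {L \<in> carrier A \<rightarrow> carrier A.
       (\<forall>a\<in>carrier A. \<forall>b\<in>carrier A. L (a \<oplus>\<^bsub>A\<^esub> b) = L a \<oplus>\<^bsub>A\<^esub> L b) \<and>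
       (\<forall>k\<in>carrier K. \<forall>a\<in>carrier A. L (k \<odot>\<^bsub>A\<^esub> a) = k \<odot>\<^bsub>A\<^esub> L a)}"

definition Der :: "('k, 'x) ring_scheme \<Rightarrow> ('k, 'a, 'y) module_scheme \<Rightarrow> ('a \<Rightarrow> 'a) set"
  where "Der K A =
    {\<delta> \<in> linear_maps K A.
       \<forall>a\<in>carrier A. \<forall>b\<in>carrier A. \<delta> (a \<otimes>\<^bsub>A\<^esub> b) = \<delta> a \<otimes>\<^bsub>A\<^esub> b \<oplus>\<^bsub>A\<^esub> a \<otimes>\<^bsub>A\<^esub> \<delta> b}"

text \<open>
  The word \<open>[X\<^sub>1, \<dots>, X\<^sub>s]\<close> encodes the composite \<open>X\<^sub>1 \<circ> \<dots> \<circ> X\<^sub>s\<close>; the linear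
  combinations have coefficients in the ground field \<open>K\<close>.
\<close>

definition SDer :: "('k, 'x) ring_scheme \<Rightarrow> ('k, 'a, 'y) module_scheme \<Rightarrow> nat \<Rightarrow> ('a \<Rightarrow> 'a) set"
  where "SDer K A r =
    {D \<in> linear_maps K A.
       \<exists>(n::nat) (c :: nat \<Rightarrow> 'k) (w :: nat \<Rightarrow> ('a \<Rightarrow> 'a) list).
         (\<forall>j<n. c j \<in> carrier K \<and> set (w j) \<subseteq> Der K A \<and> 1 \<le> length (w j) \<and> length (w j) \<le> r) \<and>
         (\<forall>a\<in>carrier A. D a = (\<Oplus>\<^bsub>A\<^esub> j\<in>{..<n}. c j \<odot>\<^bsub>A\<^esub> foldr (\<circ>) (w j) id a))}"

primrec diff_ops :: "('k, 'x) ring_scheme \<Rightarrow> ('k, 'a, 'y) module_scheme \<Rightarrow> nat \<Rightarrow> ('a \<Rightarrow> 'a) set"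
  where
    "diff_ops K A 0 =
       {D \<in> carrier A \<rightarrow> carrier A. \<exists>a\<in>carrier A. \<forall>b\<in>carrier A. D b = a \<otimes>\<^bsub>A\<^esub> b}"
  | "diff_ops K A (Suc r) =
       {D \<in> linear_maps K A.
          \<forall>a\<in>carrier A. (\<lambda>b. D (a \<otimes>\<^bsub>A\<^esub> b) \<ominus>\<^bsub>A\<^esub> a \<otimes>\<^bsub>A\<^esub> D b) \<in> diff_ops K A r}"

definition derivations_of_order ::
    "('k, 'x) ring_scheme \<Rightarrow> ('k, 'a, 'y) module_scheme \<Rightarrow> nat \<Rightarrow> ('a \<Rightarrow> 'a) set"
  where "derivations_of_order K A r =
    {D \<in> diff_ops K A r. \<forall>k\<in>carrier K. D (k \<odot>\<^bsub>A\<^esub> \<one>\<^bsub>A\<^esub>) = \<zero>\<^bsub>A\<^esub>}"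


section \<open>Smooth manifolds and their algebras of smooth functions\<close>

text \<open>
  Points of \<open>\<real>\<^sup>m\<close> are the elements of \<^term>\<open>topspace (Euclidean_space m)\<close>, that is, sequences
  vanishing from index \<open>m\<close> on. For \<open>U\<close> open in \<open>\<real>\<^sup>m\<close>, \<open>C_k_on m k U f\<close> says that all iterated
  partial derivatives of \<open>f\<close> of order at most \<open>k\<close> exist and are continuous on \<open>U\<close>; here \<open>f'\<close>
  is the partial derivative in the \<open>i\<close>-th coordinate, which is determined on \<open>U\<close>.
\<close>

primrec C_k_on :: "nat \<Rightarrow> nat \<Rightarrow> (nat \<Rightarrow> real) set \<Rightarrow> ((nat \<Rightarrow> real) \<Rightarrow> real) \<Rightarrow> bool"
  where
    "C_k_on m 0 U f \<longleftrightarrow> continuous_map (subtopology (Euclidean_space m) U) euclideanreal f"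
  | "C_k_on m (Suc k) U f \<longleftrightarrow>
       continuous_map (subtopology (Euclidean_space m) U) euclideanreal f \<and>
       (\<forall>i<m. \<exists>f'. (\<forall>x\<in>U. ((\<lambda>t. f (x(i := t))) has_real_derivative f' x) (at (x i))) \<and>
                   C_k_on m k U f')"

definition smooth_on :: "nat \<Rightarrow> (nat \<Rightarrow> real) set \<Rightarrow> ((nat \<Rightarrow> real) \<Rightarrow> real) \<Rightarrow> bool"
  where "smooth_on m U f \<longleftrightarrow> (\<forall>k. C_k_on m k U f)"

text \<open>
  A manifold is Hausdorff and second countable. The atlas need not be maximal: an atlas and
  the maximal atlas it generates have the same smooth functions. Of a chart \<open>(U, \<phi>)\<close>
  only the restriction of \<open>\<phi>\<close> to \<open>U\<close> matters.
\<close>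

locale smooth_manifold =
  fixes m :: nat
    and M :: "'p topology"
    and \<A> :: "('p set \<times> ('p \<Rightarrow> nat \<Rightarrow> real)) set"
  assumes Hausdorff: "Hausdorff_space M"
    and second_countable: "second_countable M"
    and chart: "\<And>U \<phi>. (U, \<phi>) \<in> \<A> \<Longrightarrow>
      openin M U \<and> openin (Euclidean_space m) (\<phi> ` U) \<and>
      homeomorphic_map (subtopology M U) (subtopology (Euclidean_space m) (\<phi> ` U)) \<phi>"
    and covers: "(\<Union>(U, \<phi>)\<in>\<A>. U) = topspace M"
    and compatible: "\<And>U \<phi> V \<psi> i. (U, \<phi>) \<in> \<A> \<Longrightarrow> (V, \<psi>) \<in> \<A> \<Longrightarrow> i < m \<Longrightarrow>
      smooth_on m (\<phi> ` (U \<inter> V)) (\<lambda>x. \<psi> (inv_into U \<phi> x) i)"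

text \<open>
  Functions on \<open>M\<close> are represented by their extension by \<open>0\<close> outside \<^term>\<open>topspace M\<close>, so that
  the algebra operations are literally the pointwise ones.
\<close>

definition smooth_functions ::
    "nat \<Rightarrow> 'p topology \<Rightarrow> ('p set \<times> ('p \<Rightarrow> nat \<Rightarrow> real)) set \<Rightarrow> ('p \<Rightarrow> real) set"
  where "smooth_functions m M \<A> =
    {f. (\<forall>p. p \<notin> topspace M \<longrightarrow> f p = 0) \<and>
        (\<forall>(U, \<phi>)\<in>\<A>. smooth_on m (\<phi> ` U) (\<lambda>x. f (inv_into U \<phi> x)))}"

definition smooth_algebra ::
    "nat \<Rightarrow> 'p topology \<Rightarrow> ('p set \<times> ('p \<Rightarrow> nat \<Rightarrow> real)) set \<Rightarrow> (real, 'p \<Rightarrow> real) module"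
  where "smooth_algebra m M \<A> =
    \<lparr>carrier = smooth_functions m M \<A>,
     mult = (\<lambda>f g p. f p * g p),
     one = indicator (topspace M),
     zero = (\<lambda>p. 0),
     add = (\<lambda>f g p. f p + g p),
     smult = (\<lambda>c f p. c * f p)\<rparr>"

abbreviation real_scalars :: "real ring"
  where "real_scalars \<equiv> ring_of_type_algebra"


subsection \<open>The smooth functions form an algebra over the reals\<close>

lemma C_k_on_continuous:
  "C_k_on m k U f \<Longrightarrow> continuous_map (subtopology (Euclidean_space m) U) euclideanreal f"
  by (cases k) auto

lemma C_k_on_partialE:
  assumes "C_k_on m (Suc k) U f" "i < m"
  obtains f' where
    "\<forall>x\<in>U. ((\<lambda>t. f (x(i := t))) has_real_derivative f' x) (at (x i))" "C_k_on m k U f'"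
  using assms by auto

lemma C_k_on_SucD: "C_k_on m (Suc k) U f \<Longrightarrow> C_k_on m k U f"
proof (induction k arbitrary: f)
  case (Suc k)
  then show ?case by (metis C_k_on.simps(2))
qed auto

lemma C_k_on_const: "C_k_on m k U (\<lambda>x. c)"
proof (induction k arbitrary: c)
  case (Suc k)
  then show ?case by (auto intro!: exI[of _ "\<lambda>x. 0"])
qed auto

lemma C_k_on_add: "C_k_on m k U f \<Longrightarrow> C_k_on m k U g \<Longrightarrow> C_k_on m k U (\<lambda>x. f x + g x)"
proof (induction k arbitrary: f g)
  case (Suc k)
  have "\<exists>h. (\<forall>x\<in>U. ((\<lambda>t. f (x(i := t)) + g (x(i := t))) has_real_derivative h x) (at (x i))) \<and>
            C_k_on m k U h" if i: "i < m" for i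
  proof -
    obtain f' g' where
      "\<forall>x\<in>U. ((\<lambda>t. f (x(i := t))) has_real_derivative f' x) (at (x i))" "C_k_on m k U f'"
      "\<forall>x\<in>U. ((\<lambda>t. g (x(i := t))) has_real_derivative g' x) (at (x i))" "C_k_on m k U g'"
      using C_k_on_partialE[OF Suc.prems(1) i] C_k_on_partialE[OF Suc.prems(2) i] by metis
    then show ?thesis
      by (intro exI[of _ "\<lambda>x. f' x + g' x"]) (auto intro!: derivative_intros Suc.IH)
  qed
  then show ?case
    using Suc.prems by (auto intro!: continuous_map_add)
qed (auto intro: continuous_map_add)

lemma C_k_on_mult: "C_k_on m k U f \<Longrightarrow> C_k_on m k U g \<Longrightarrow> C_k_on m k U (\<lambda>x. f x * g x)"
proof (induction k arbitrary: f g)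
  case (Suc k)
  have "\<exists>h. (\<forall>x\<in>U. ((\<lambda>t. f (x(i := t)) * g (x(i := t))) has_real_derivative h x) (at (x i))) \<and>
            C_k_on m k U h" if i: "i < m" for i
  proof -
    obtain f' g' where *:
      "\<forall>x\<in>U. ((\<lambda>t. f (x(i := t))) has_real_derivative f' x) (at (x i))" "C_k_on m k U f'"
      "\<forall>x\<in>U. ((\<lambda>t. g (x(i := t))) has_real_derivative g' x) (at (x i))" "C_k_on m k U g'"
      using C_k_on_partialE[OF Suc.prems(1) i] C_k_on_partialE[OF Suc.prems(2) i] by metis
    have "C_k_on m k U (\<lambda>x. f' x * g x + g' x * f x)"
      by (rule C_k_on_add; rule Suc.IH)
        (fact *(2) *(4) Suc.prems[THEN C_k_on_SucD])+
    moreover have "((\<lambda>t. f (x(i := t)) * g (x(i := t))) has_real_derivative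
                      (f' x * g x + g' x * f x)) (at (x i))" if "x \<in> U" for x
      using DERIV_mult[OF *(1)[rule_format, OF that] *(3)[rule_format, OF that]] by simp
    ultimately show ?thesis
      by (intro exI[of _ "\<lambda>x. f' x * g x + g' x * f x"] conjI ballI)
  qed
  then show ?case
    using Suc.prems by (auto intro!: continuous_map_real_mult)
qed (auto intro: continuous_map_real_mult)

lemma C_k_on_cong:
  assumes U: "openin (Euclidean_space m) U"
  shows "(\<And>x. x \<in> U \<Longrightarrow> f x = g x) \<Longrightarrow> C_k_on m k U f \<Longrightarrow> C_k_on m k U g"
proof (induction k arbitrary: f g)
  case 0
  then show ?case
    by (auto elim!: continuous_map_eq)
next
  case (Suc k)
  have cont: "continuous_map (subtopology (Euclidean_space m) U) euclideanreal g"
    using Suc.prems by (auto elim!: continuous_map_eq)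
  have "\<exists>h. (\<forall>x\<in>U. ((\<lambda>t. g (x(i := t))) has_real_derivative h x) (at (x i))) \<and> C_k_on m k U h"
    if i: "i < m" for i
  proof -
    obtain f' where f': "\<forall>x\<in>U. ((\<lambda>t. f (x(i := t))) has_real_derivative f' x) (at (x i))"
      "C_k_on m k U f'"
      using C_k_on_partialE[OF Suc.prems(2) i] .
    have "((\<lambda>t. g (x(i := t))) has_real_derivative f' x) (at (x i))" if x: "x \<in> U" for x
    proof -
      obtain W where W: "open W" "U = W \<inter> {x. \<forall>i\<ge>m. x i = 0}"
        using U by (auto simp: Euclidean_space_def openin_subtopology euclidean_product_topology)
      have "continuous_on UNIV (\<lambda>t. x(i := t))"
      proof (rule continuous_on_coordinatewise_then_product)
        show "continuous_on UNIV (\<lambda>t. (x(i := t)) j)" for j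
          by (cases "j = i") auto
      qed
      then have "open ((\<lambda>t. x(i := t)) -` W)"
        using W(1) open_vimage by blast
      moreover have "x i \<in> (\<lambda>t. x(i := t)) -` W"
        using x W by auto
      moreover have "f (x(i := t)) = g (x(i := t))" if "t \<in> (\<lambda>t. x(i := t)) -` W" for t
      proof -
        have "x(i := t) \<in> U" using that x W i by auto
        then show ?thesis by (rule Suc.prems(1))
      qed
      ultimately show ?thesis
        by (rule has_field_derivative_transform_within_open[OF f'(1)[rule_format, OF x]])
    qed
    then show ?thesis using f'(2) by (intro exI[of _ f'] conjI ballI)
  qed
  then show ?case using cont by simp
qed

lemma (in smooth_manifold) one_smooth: "indicator (topspace M) \<in> smooth_functions m M \<A>"
proof -
  have "C_k_on m k (\<phi> ` U) (\<lambda>x. indicator (topspace M) (inv_into U \<phi> x))"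
    if "(U, \<phi>) \<in> \<A>" for U \<phi> k
  proof (rule C_k_on_cong[OF _ _ C_k_on_const[where c = 1]])
    show "openin (Euclidean_space m) (\<phi> ` U)" using chart[OF that] by blast
    show "1 = indicator (topspace M) (inv_into U \<phi> x)" if "x \<in> \<phi> ` U" for x
      using inv_into_into[OF that] chart[OF \<open>(U, \<phi>) \<in> \<A>\<close>] openin_subset by fastforce
  qed
  then show ?thesis by (auto simp: smooth_functions_def smooth_on_def)
qed

lemma (in smooth_manifold) algebra_smooth_algebra: "algebra real_scalars (smooth_algebra m M \<A>)"
proof -
  have chartwise: "f \<in> smooth_functions m M \<A> \<longleftrightarrow>
      (\<forall>p. p \<notin> topspace M \<longrightarrow> f p = 0) \<and>
      (\<forall>U \<phi> k. (U, \<phi>) \<in> \<A> \<longrightarrow> C_k_on m k (\<phi> ` U) (\<lambda>x. f (inv_into U \<phi> x)))" for f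
    by (auto simp: smooth_functions_def smooth_on_def)
  have add: "(\<lambda>p. f p + g p) \<in> smooth_functions m M \<A>"
    and mult: "(\<lambda>p. f p * g p) \<in> smooth_functions m M \<A>"
    and scale: "(\<lambda>p. c * f p) \<in> smooth_functions m M \<A>"
    if "f \<in> smooth_functions m M \<A>" "g \<in> smooth_functions m M \<A>" for f g c
    using that
    by (simp_all add: chartwise C_k_on_add C_k_on_mult C_k_on_const)
  have zero: "(\<lambda>p. 0) \<in> smooth_functions m M \<A>"
    by (simp add: chartwise C_k_on_const)
  have unit: "(\<lambda>p. f p * indicator (topspace M) p) = f" if "f \<in> smooth_functions m M \<A>" for f
    using that by (intro ext) (auto simp: smooth_functions_def indicator_def)
  have inverse: "\<exists>g\<in>smooth_functions m M \<A>. (\<lambda>p. f p + g p) = (\<lambda>p. 0)"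
    if "f \<in> smooth_functions m M \<A>" for f
    using scale[OF that that, of "-1"] by (intro bexI[of _ "\<lambda>p. -1 * f p"]) auto
  have "abelian_group (smooth_algebra m M \<A>)"
    by (rule abelian_groupI)
      (simp_all add: smooth_algebra_def add zero inverse add_ac)
  moreover have "comm_monoid (smooth_algebra m M \<A>)"
    by (rule comm_monoidI)
      (simp_all add: smooth_algebra_def mult one_smooth unit mult_ac)
  ultimately have cring: "cring (smooth_algebra m M \<A>)"
    by (rule cringI) (simp add: smooth_algebra_def distrib_right)
  show ?thesis
    by (rule algebraI[OF cring_from_type_algebra cring])
      (simp_all add: smooth_algebra_def scale ring_of_type_algebra_def
        distrib_left distrib_right mult.assoc)
qed

end

theory Submission
  imports Defs "HOL-Library.Function_Algebras" "HOL-Probability.Probability"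
begin

text \<open>
  Everything rests on a finite dual basis: finitely many smooth functions \<open>f\<^sub>j\<close> and vector fields
  \<open>\<xi>\<^sub>j\<close> with \<open>Y = \<Sum>\<^sub>j Y(f\<^sub>j) \<xi>\<^sub>j\<close> for every derivation \<open>Y\<close>. Given one, an operator \<open>D\<close> of
  order at most \<open>k\<close> satisfies the Euler identity \<open>k D = \<Sum>\<^sub>j [D, f\<^sub>j] \<circ> \<xi>\<^sub>j\<close> up to an operator of
  lower order, and induction on the order finishes the proof.

  As \<open>M\<close> need not be compact, the dual basis requires \<open>M\<close> to be covered by \<open>m + 1\<close> open sets, each
  a disjoint union of open subsets of charts. Take a countable, locally finite family of bump functions
  \<open>h\<^sub>k\<close> supported in charts and put \<open>p\<close> into the \<open>k\<close>-th piece of colour \<open>s\<close> if \<open>k\<close> is the first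
  index with \<open>h\<^sub>k(p) > t\<^bsub>s,k\<^esub>\<close>. This misses only points with \<open>h\<^sub>k(p) = t\<^bsub>s,k\<^esub>\<close> for some \<open>k\<close>, and
  since \<open>m + 1\<close> smooth functions on \<open>M\<close> have a null set of joint values, no point is missed by all
  \<open>m + 1\<close> colours when the levels are generic.
\<close>

section \<open>Differential operators on an algebra whose derivations have a finite dual basis\<close>

text \<open>\<open>SDer\<close> admits only finitely many words with real coefficients, so on a
  manifold with infinitely many charts a partition of unity is not enough: it yields a group of
  words for every chart. Finiteness comes from the colours. As the pieces of one colour are
  disjoint, the cut-off coordinates of all its charts glue to \<open>m\<close> global functions;
  with the cutoff itself this makes (m+1)^2 pairs, indexed by a colour and a coordinate or the
  cutoff. Function coefficients cost nothing, since a function times a derivation is again a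
  derivation. The condition D(e) = 0 excludes the term of order 0 and has to survive the induction:
  the brackets [D, f] with the dual functions violate it, and their values at e are split off and
  multiplied into the fields \<xi>. Solving the Euler identity for D divides by k, hence the
  inverses of positive integers among the scalars. The number m+1 is the least dimension in which
  pieces of an m-dimensional manifold must have null images.\<close>

text \<open>The unit \<open>e\<close> of \<open>S\<close> need not be \<open>1\<close>: for functions extended by 0 outside \<open>M\<close> it is the
  indicator function of \<open>M\<close>. The set \<open>C\<close> consists of the scalars.\<close>

locale subset_algebra =
  fixes S C :: "'b::comm_ring_1 set" and e :: 'b
  assumes add_S: "a \<in> S \<Longrightarrow> b \<in> S \<Longrightarrow> a + b \<in> S"
    and mult_S: "a \<in> S \<Longrightarrow> b \<in> S \<Longrightarrow> a * b \<in> S"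
    and scale_S: "c \<in> C \<Longrightarrow> a \<in> S \<Longrightarrow> c * a \<in> S"
    and unit_S: "e \<in> S"
    and unit_mult: "a \<in> S \<Longrightarrow> e * a = a"
    and minus_one_C: "- 1 \<in> C"
    and inverse_C: "n > 0 \<Longrightarrow> \<exists>c\<in>C. c * of_nat n = 1"
begin

definition linear :: "('b \<Rightarrow> 'b) \<Rightarrow> bool" where
  "linear D \<longleftrightarrow> (\<forall>a\<in>S. D a \<in> S) \<and> (\<forall>a\<in>S. \<forall>b\<in>S. D (a + b) = D a + D b) \<and>
     (\<forall>c\<in>C. \<forall>a\<in>S. D (c * a) = c * D a)"

definition derivation :: "('b \<Rightarrow> 'b) \<Rightarrow> bool" where
  "derivation D \<longleftrightarrow> linear D \<and> (\<forall>a\<in>S. \<forall>b\<in>S. D (a * b) = D a * b + a * D b)"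

definition commutator :: "('b \<Rightarrow> 'b) \<Rightarrow> 'b \<Rightarrow> 'b \<Rightarrow> 'b" where
  "commutator D a b = D (a * b) - a * D b"

text \<open>The index is shifted by one against the order: \<open>diff_op (Suc n)\<close> means order at most \<open>n\<close>.\<close>

primrec diff_op :: "nat \<Rightarrow> ('b \<Rightarrow> 'b) \<Rightarrow> bool" where
  "diff_op 0 D \<longleftrightarrow> (\<forall>b\<in>S. D b = 0)"
| "diff_op (Suc n) D \<longleftrightarrow> linear D \<and> (\<forall>a\<in>S. diff_op n (commutator D a))"

lemma uminus_S: "a \<in> S \<Longrightarrow> - a \<in> S"
  using scale_S[OF minus_one_C] by simp

lemma zero_S: "0 \<in> S"
  using add_S[OF unit_S uminus_S[OF unit_S]] by simp

lemma diff_S: "a \<in> S \<Longrightarrow> b \<in> S \<Longrightarrow> a - b \<in> S"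
  using add_S[OF _ uminus_S] by (metis diff_conv_add_uminus)

lemma sum_S: "(\<And>i. i \<in> I \<Longrightarrow> f i \<in> S) \<Longrightarrow> sum f I \<in> S"
  by (induction I rule: infinite_finite_induct) (auto simp: zero_S add_S)

lemma of_nat_mult_S: "a \<in> S \<Longrightarrow> of_nat n * a \<in> S"
  by (induction n) (auto simp: zero_S add_S distrib_right)

lemma linear_S: "linear D \<Longrightarrow> a \<in> S \<Longrightarrow> D a \<in> S"
  and linear_add: "linear D \<Longrightarrow> a \<in> S \<Longrightarrow> b \<in> S \<Longrightarrow> D (a + b) = D a + D b"
  and linear_scale: "linear D \<Longrightarrow> c \<in> C \<Longrightarrow> a \<in> S \<Longrightarrow> D (c * a) = c * D a"
  by (auto simp: linear_def)

lemma linear_zero: "linear D \<Longrightarrow> D 0 = 0"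
  using linear_add[of D 0 0] zero_S by simp

lemma linear_sum: "linear D \<Longrightarrow> (\<And>i. i \<in> I \<Longrightarrow> f i \<in> S) \<Longrightarrow> D (sum f I) = (\<Sum>i\<in>I. D (f i))"
  by (induction I rule: infinite_finite_induct) (auto simp: linear_zero linear_add sum_S)

lemma linear_cong: "linear D \<Longrightarrow> (\<And>a. a \<in> S \<Longrightarrow> D a = E a) \<Longrightarrow> linear E"
  by (simp add: linear_def add_S scale_S)

lemma linear_compose: "linear D \<Longrightarrow> linear E \<Longrightarrow> linear (\<lambda>b. D (E b))"
  by (simp add: linear_def)

lemma linear_plus: "linear D \<Longrightarrow> linear E \<Longrightarrow> linear (\<lambda>b. D b + E b)"
  by (auto simp: linear_def add_S algebra_simps)

lemma linear_minus: "linear D \<Longrightarrow> linear E \<Longrightarrow> linear (\<lambda>b. D b - E b)"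
  by (auto simp: linear_def diff_S algebra_simps)

lemma linear_mult: "x \<in> S \<Longrightarrow> linear D \<Longrightarrow> linear (\<lambda>b. x * D b)"
  by (auto simp: linear_def mult_S algebra_simps)

lemma linear_ident: "linear (\<lambda>b. b)"
  by (simp add: linear_def)

lemma linear_of_nat: "linear D \<Longrightarrow> linear (\<lambda>b. of_nat n * D b)"
  by (auto simp: linear_def of_nat_mult_S distrib_left mult.left_commute)

lemma linear_Sum: "(\<And>i. i \<in> I \<Longrightarrow> linear (D i)) \<Longrightarrow> linear (\<lambda>b. \<Sum>i\<in>I. D i b)"
proof (induction I rule: infinite_finite_induct)
  case (insert i I)
  then show ?case using linear_plus[of "D i"] by simp
qed (simp_all add: linear_def zero_S)

lemma linear_commutator: "linear D \<Longrightarrow> a \<in> S \<Longrightarrow> linear (commutator D a)"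
  unfolding commutator_def[abs_def]
  by (rule linear_minus linear_mult linear_compose[of D "(*) a"] linear_ident | assumption)+

lemma derivation_linear: "derivation D \<Longrightarrow> linear D"
  and derivation_mult: "derivation D \<Longrightarrow> a \<in> S \<Longrightarrow> b \<in> S \<Longrightarrow> D (a * b) = D a * b + a * D b"
  by (auto simp: derivation_def)

lemma derivation_unit: "derivation D \<Longrightarrow> D e = 0"
proof -
  assume D: "derivation D"
  have "D e \<in> S" using D unit_S by (simp add: derivation_linear linear_S)
  then show "D e = 0"
    using derivation_mult[OF D unit_S unit_S] unit_mult[OF unit_S] unit_mult[of "D e"]
    by (simp add: mult.commute)
qed

lemma derivation_times: "x \<in> S \<Longrightarrow> derivation D \<Longrightarrow> derivation (\<lambda>b. x * D b)"
  by (auto simp: derivation_def linear_mult algebra_simps)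

lemma derivation_scale: "c \<in> C \<Longrightarrow> derivation D \<Longrightarrow> derivation (\<lambda>b. c * D b)"
  by (auto simp: derivation_def linear_def scale_S algebra_simps)

lemma diff_op_linear: "diff_op (Suc n) D \<Longrightarrow> linear D"
  by simp

lemma diff_op_commutator: "diff_op (Suc n) D \<Longrightarrow> a \<in> S \<Longrightarrow> diff_op n (commutator D a)"
  by simp

text \<open>Maps matter only through their values on \<open>S\<close>; identities between brackets
  are likewise verified only there, and this lemma carries them over to
  \<open>diff_op\<close>.\<close>

lemma diff_op_cong: "diff_op n D \<Longrightarrow> (\<And>a. a \<in> S \<Longrightarrow> D a = E a) \<Longrightarrow> diff_op n E"
proof (induction n arbitrary: D E)
  case (Suc n)
  have "diff_op n (commutator E a)" if a: "a \<in> S" for a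
  proof (rule Suc.IH)
    show "diff_op n (commutator D a)" using Suc.prems a by simp
  qed (use Suc.prems a in \<open>simp add: commutator_def mult_S\<close>)
  then show ?case using Suc.prems linear_cong by auto
qed simp

lemma diff_op_plus: "diff_op n D \<Longrightarrow> diff_op n E \<Longrightarrow> diff_op n (\<lambda>b. D b + E b)"
proof (induction n arbitrary: D E)
  case (Suc n)
  have "diff_op n (commutator (\<lambda>b. D b + E b) a)" if a: "a \<in> S" for a
  proof (rule diff_op_cong)
    show "diff_op n (\<lambda>b. commutator D a b + commutator E a b)"
      using Suc.prems a by (intro Suc.IH) simp_all
  qed (simp add: commutator_def algebra_simps)
  then show ?case using Suc.prems linear_plus by auto
qed simp

lemma diff_op_mult: "x \<in> S \<Longrightarrow> diff_op (Suc n) (\<lambda>b. x * b)"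
proof -
  assume x: "x \<in> S"
  have "diff_op n (\<lambda>b. 0)" for n
    by (induction n) (auto simp: linear_def zero_S commutator_def[abs_def])
  then have "diff_op n (commutator ((*) x) a)" if "a \<in> S" for a
    by (rule diff_op_cong) (simp add: commutator_def algebra_simps)
  then show ?thesis using x by (simp add: linear_mult[OF _ linear_ident])
qed

end

text \<open>The fields \<open>\<xi> i\<close> and the functionals \<open>Y \<mapsto> Y (f i)\<close>
  form a dual basis of the module of derivations in the sense of projective modules. The model is
  given by the coordinates and partial derivatives of \<real>^m; linear independence is not part of
  the notion.\<close>

locale finite_dual_basis = subset_algebra S C e
  for S C :: "'b::comm_ring_1 set" and e +
  fixes I :: "'i set" and f :: "'i \<Rightarrow> 'b" and \<xi> :: "'i \<Rightarrow> 'b \<Rightarrow> 'b"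
  assumes finite_I: "finite I"
    and f_S: "i \<in> I \<Longrightarrow> f i \<in> S"
    and dual_der: "i \<in> I \<Longrightarrow> derivation (\<xi> i)"
    and dual_basis: "derivation Y \<Longrightarrow> a \<in> S \<Longrightarrow> Y a = (\<Sum>i\<in>I. Y (f i) * \<xi> i a)"
begin

lemma dual_S: "i \<in> I \<Longrightarrow> a \<in> S \<Longrightarrow> \<xi> i a \<in> S"
  using dual_der derivation_linear linear_S by blast

text \<open>Passing to symbols, \<open>a \<mapsto> [D, a]\<close> becomes a derivation, so the dual basis makes the symbol of
  \<open>symbol_defect D a\<close> vanish; \<open>euler D\<close> acts on symbols of degree \<open>k\<close> as multiplication by \<open>k\<close>,
  as in Euler's identity for homogeneous polynomials.\<close>

definition symbol_defect :: "('b \<Rightarrow> 'b) \<Rightarrow> 'b \<Rightarrow> 'b \<Rightarrow> 'b" where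
  "symbol_defect D a b = commutator D a b - (\<Sum>i\<in>I. commutator D (f i) (\<xi> i a * b))"

definition euler :: "('b \<Rightarrow> 'b) \<Rightarrow> 'b \<Rightarrow> 'b" where
  "euler D b = (\<Sum>i\<in>I. commutator D (f i) (\<xi> i b))"

lemma linear_symbol_defect: "linear D \<Longrightarrow> a \<in> S \<Longrightarrow> linear (symbol_defect D a)"
  unfolding symbol_defect_def[abs_def]
  by (rule linear_minus linear_commutator linear_Sum dual_S f_S linear_mult linear_ident
      linear_compose[of "commutator D (f i)" "(*) (\<xi> i a)" for i] | assumption)+

lemma linear_euler: "linear D \<Longrightarrow> linear (euler D)"
  unfolding euler_def[abs_def]
  by (rule linear_Sum linear_compose[of "commutator D (f i)" "\<xi> i" for i] linear_commutator f_S
      derivation_linear[OF dual_der] | assumption)+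

text \<open>For \<open>D\<close> of order at most 1, [D, a] commutes with multiplications, so it is
  multiplication by its value at \<open>e\<close>, which is \<open>\<delta> a\<close>. The Leibniz
  rule is this identity with the bracket written out.\<close>

lemma derivation_of_diff_op:
  assumes D: "diff_op (Suc (Suc 0)) D"
  defines "\<delta> \<equiv> \<lambda>a. D a - a * D e"
  shows "derivation \<delta>" and "a \<in> S \<Longrightarrow> b \<in> S \<Longrightarrow> commutator D a b = b * \<delta> a"
proof -
  have lin: "linear D" using D by simp
  have DS: "D a \<in> S" if "a \<in> S" for a using lin that linear_S by blast
  have comm: "commutator D a b = b * \<delta> a" if a: "a \<in> S" and b: "b \<in> S" for a b
  proof -
    have 0: "commutator (commutator D a) b e = 0"
      using D a b unit_S by simp
    have "b * e = b" "a * (b * e) = a * b" "a * e = a"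
      using unit_mult a b by (simp_all add: mult.commute)
    then show ?thesis using 0 by (simp add: commutator_def \<delta>_def)
  qed
  show "a \<in> S \<Longrightarrow> b \<in> S \<Longrightarrow> commutator D a b = b * \<delta> a" by (rule comm)
  have "linear \<delta>"
  proof -
    have "linear (\<lambda>a. D a - D e * a)"
      by (intro linear_minus lin linear_mult[OF _ linear_ident] DS unit_S)
    then show ?thesis by (simp add: \<delta>_def mult.commute)
  qed
  moreover have "\<delta> (a * b) = \<delta> a * b + a * \<delta> b" if "a \<in> S" "b \<in> S" for a b
    using comm[OF that] unfolding commutator_def \<delta>_def by (simp add: algebra_simps)
  ultimately show "derivation \<delta>" by (auto simp: derivation_def)
qed

text \<open>\<open>D\<close> has order at most k+1, so [D, a] has order at most k; the defect gains
  one more order. The gain starts with the dual basis applied to the derivation part of an operator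
  of order 1, and climbs because forming the defect commutes with bracketing by a function.\<close>

lemma diff_op_symbol_defect:
  "diff_op (Suc (Suc k)) D \<Longrightarrow> a \<in> S \<Longrightarrow> diff_op k (symbol_defect D a)"
proof (induction k arbitrary: D)
  case 0
  define \<delta> where "\<delta> a = D a - a * D e" for a
  note \<delta> = derivation_of_diff_op[OF 0(1), folded \<delta>_def]
  have "symbol_defect D a b = 0" if b: "b \<in> S" for b
  proof -
    have "(\<Sum>i\<in>I. commutator D (f i) (\<xi> i a * b)) = (\<Sum>i\<in>I. b * (\<delta> (f i) * \<xi> i a))"
      by (intro sum.cong refl) (simp add: \<delta>(2) f_S dual_S 0(2) b mult_S algebra_simps)
    also have "\<dots> = b * \<delta> a"
      using dual_basis[OF \<delta>(1) 0(2)] by (simp add: sum_distrib_left)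
    finally show ?thesis
      by (simp add: symbol_defect_def \<delta>(2) 0(2) b)
  qed
  then show ?case by simp
next
  case (Suc k)
  have "diff_op k (commutator (symbol_defect D a) b)" if b: "b \<in> S" for b
  proof (rule diff_op_cong)
    \<comment> \<open>The defect is assembled from brackets with functions and multiplications by
      functions, all of which commute with [ . , b].\<close>
    show "diff_op k (symbol_defect (commutator D b) a)"
      using Suc.prems b by (intro Suc.IH) simp_all
    show "symbol_defect (commutator D b) a c = commutator (symbol_defect D a) b c" if "c \<in> S" for c
      by (simp add: symbol_defect_def commutator_def algebra_simps sum_distrib_left
          sum_subtractf sum.distrib)
  qed
  then show ?case using Suc.prems linear_symbol_defect by simp
qed

text \<open>Bracketing \<open>euler D\<close> with \<open>a\<close> gives \<open>euler\<close> of
  [D, a] plus the terms where \<open>\<xi> i\<close> hits \<open>a\<close>. By the definition of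
  \<open>symbol_defect\<close> these terms sum to [D, a] minus the defect: that extra [D, a] raises
  the factor from k to k+1.\<close>

lemma diff_op_euler: "diff_op (Suc k) D \<Longrightarrow> diff_op k (\<lambda>b. of_nat k * D b - euler D b)"
proof (induction k arbitrary: D)
  case 0
  then show ?case by (auto simp: euler_def f_S dual_S)
next
  case (Suc k)
  have lin: "linear D" using Suc.prems by simp
  have "diff_op k (commutator (\<lambda>b. of_nat (Suc k) * D b - euler D b) a)" if a: "a \<in> S" for a
  proof (rule diff_op_cong)
    show "diff_op k (\<lambda>b. (of_nat k * commutator D a b - euler (commutator D a) b) + symbol_defect D a b)"
      using Suc.prems a diff_op_symbol_defect
      by (intro diff_op_plus Suc.IH) simp_all
    show "(of_nat k * commutator D a c - euler (commutator D a) c) + symbol_defect D a c =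
      commutator (\<lambda>b. of_nat (Suc k) * D b - euler D b) a c" if c: "c \<in> S" for c
    proof -
      have "commutator D (f i) (\<xi> i (a * c)) - a * commutator D (f i) (\<xi> i c)
          = commutator (commutator D a) (f i) (\<xi> i c) + commutator D (f i) (\<xi> i a * c)"
        if i: "i \<in> I" for i
      proof -
        have "commutator D (f i) (\<xi> i (a * c)) =
            commutator D (f i) (\<xi> i a * c) + commutator D (f i) (a * \<xi> i c)"
          using linear_add[OF linear_commutator[OF lin f_S[OF i]], of "\<xi> i a * c" "a * \<xi> i c"]
          by (simp add: derivation_mult[OF dual_der[OF i] a c] mult_S dual_S a c i)
        then show ?thesis
          by (simp add: commutator_def algebra_simps)
      qed
      then have "euler D (a * c) - a * euler D c =
          euler (commutator D a) c + (\<Sum>i\<in>I. commutator D (f i) (\<xi> i a * c))"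
        by (simp add: euler_def sum_distrib_left flip: sum_subtractf sum.distrib)
      then show ?thesis
        by (simp add: symbol_defect_def commutator_def[of "\<lambda>b. _ b - _ b"] commutator_def[of D a]
            algebra_simps)
    qed
  qed
  then show ?case
    using linear_minus[OF linear_of_nat[OF lin, of "Suc k"] linear_euler[OF lin]] by simp
qed

text \<open>No coefficients occur: a scalar is absorbed by the outermost derivation of a word. For
  \<open>r = 0\<close> no word is admissible, so only the zero map on \<open>S\<close>
  remains.\<close>

definition composite_sum :: "nat \<Rightarrow> ('b \<Rightarrow> 'b) \<Rightarrow> bool" where
  "composite_sum r D \<longleftrightarrow> (\<exists>ws. (\<forall>w\<in>set ws. (\<forall>Y\<in>set w. derivation Y) \<and> 1 \<le> length w \<and> length w \<le> r) \<and>
     (\<forall>a\<in>S. D a = (\<Sum>w\<leftarrow>ws. foldr (\<circ>) w id a)))"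

section \<open>Closure properties of finite sums of words in derivations\<close>

lemma composite_sum_cong: "composite_sum r D \<Longrightarrow> (\<And>a. a \<in> S \<Longrightarrow> D a = E a) \<Longrightarrow> composite_sum r E"
  by (fastforce simp: composite_sum_def)

lemma composite_sum_mono: "composite_sum r D \<Longrightarrow> r \<le> r' \<Longrightarrow> composite_sum r' D"
  unfolding composite_sum_def using order_trans by blast

lemma composite_sum_zero: "composite_sum r (\<lambda>a. 0)"
  unfolding composite_sum_def by (intro exI[of _ "[]"]) simp

lemma composite_sum_plus:
  assumes "composite_sum r D" "composite_sum r E"
  shows "composite_sum r (\<lambda>a. D a + E a)"
proof -
  obtain ws vs where
    "\<forall>w\<in>set ws. (\<forall>Y\<in>set w. derivation Y) \<and> 1 \<le> length w \<and> length w \<le> r"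
    "\<forall>a\<in>S. D a = (\<Sum>w\<leftarrow>ws. foldr (\<circ>) w id a)"
    "\<forall>w\<in>set vs. (\<forall>Y\<in>set w. derivation Y) \<and> 1 \<le> length w \<and> length w \<le> r"
    "\<forall>a\<in>S. E a = (\<Sum>w\<leftarrow>vs. foldr (\<circ>) w id a)"
    using assms unfolding composite_sum_def by blast
  then show ?thesis
    unfolding composite_sum_def by (intro exI[of _ "ws @ vs"]) auto
qed

lemma composite_sum_Sum:
  "(\<And>i. i \<in> J \<Longrightarrow> composite_sum r (D i)) \<Longrightarrow> composite_sum r (\<lambda>a. \<Sum>i\<in>J. D i a)"
proof (induction J rule: infinite_finite_induct)
  case (insert i J)
  then show ?case using composite_sum_plus[of r "D i"] by simp
qed (simp_all add: composite_sum_zero)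

lemma composite_sum_derivation:
  assumes "derivation Y" shows "composite_sum (Suc r) Y"
  unfolding composite_sum_def using assms by (intro exI[of _ "[[Y]]"]) auto

lemma composite_sum_scale:
  assumes "composite_sum r D" "c \<in> C"
  shows "composite_sum r (\<lambda>a. c * D a)"
proof -
  obtain ws where
    ws: "\<forall>w\<in>set ws. (\<forall>Y\<in>set w. derivation Y) \<and> 1 \<le> length w \<and> length w \<le> r"
    "\<forall>a\<in>S. D a = (\<Sum>w\<leftarrow>ws. foldr (\<circ>) w id a)"
    using assms unfolding composite_sum_def by blast
  \<comment> \<open>Words have length at least 1, so \<open>hd w\<close> is a genuine
    letter.\<close>
  define sc where "sc w = (\<lambda>b. c * hd w b) # tl w" for w :: "('b \<Rightarrow> 'b) list"
  have sc: "(\<forall>Y\<in>set (sc w). derivation Y) \<and> length (sc w) = length w \<and>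
      foldr (\<circ>) (sc w) id a = c * foldr (\<circ>) w id a" if "w \<in> set ws" for w a
    using ws(1)[rule_format, OF that] derivation_scale[OF assms(2)] by (cases w) (auto simp: sc_def)
  have "c * (\<Sum>w\<leftarrow>ws. foldr (\<circ>) w id a) = (\<Sum>w\<leftarrow>map sc ws. foldr (\<circ>) w id a)" for a
    using sc by (simp add: sum_list_const_mult[symmetric] cong: map_cong)
  then show ?thesis
    unfolding composite_sum_def using ws sc by (intro exI[of _ "map sc ws"]) auto
qed

lemma composite_sum_compose:
  assumes "composite_sum r D" "derivation Y"
  shows "composite_sum (Suc r) (\<lambda>a. D (Y a))"
proof -
  obtain ws where
    ws: "\<forall>w\<in>set ws. (\<forall>Y\<in>set w. derivation Y) \<and> 1 \<le> length w \<and> length w \<le> r"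
    "\<forall>a\<in>S. D a = (\<Sum>w\<leftarrow>ws. foldr (\<circ>) w id a)"
    using assms unfolding composite_sum_def by blast
  have fold: "foldr (\<circ>) (w @ [Y]) id a = foldr (\<circ>) w id (Y a)" for w :: "('b \<Rightarrow> 'b) list" and a
    by (induction w) auto
  show ?thesis
    unfolding composite_sum_def
    using ws assms(2) linear_S[OF derivation_linear]
    by (intro exI[of _ "map (\<lambda>w. w @ [Y]) ws"]) (auto simp: fold o_def simp del: foldr_append)
qed

text \<open>Both summands of (r+1) D = ((r+1) D - \<open>euler D\<close>) + \<open>euler D\<close>
  are accessible to the induction hypothesis: the first has lower order, and the second is a sum of
  operators of lower order composed with the derivations \<open>\<xi> i\<close>.\<close>

theorem diff_op_composite_sum:
  "diff_op (Suc r) D \<Longrightarrow> D e = 0 \<Longrightarrow> composite_sum r D"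
proof (induction r arbitrary: D)
  case 0
  \<comment> \<open>An operator of order 0 is multiplication by its value at
    \<open>e\<close>.\<close>
  have "D b = 0" if b: "b \<in> S" for b
  proof -
    have "commutator D b e = 0" using 0 b unit_S by simp
    then show ?thesis using 0(2) unit_mult[OF b] by (simp add: commutator_def mult.commute)
  qed
  then show ?case using composite_sum_cong[OF composite_sum_zero] by simp
next
  case (Suc r)
  have lin: "linear D" using Suc.prems by simp
  have eu: "composite_sum (Suc r) (euler D)"
    unfolding euler_def[abs_def]
  proof (rule composite_sum_Sum)
    fix i assume i: "i \<in> I"
    \<comment> \<open>The bracket need not kill the unit. Subtracting multiplication by its value
      there makes the induction hypothesis applicable; composed with \<open>\<xi> i\<close>, the
      subtracted part is the single derivation \<open>x * \<xi> i\<close>.\<close>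
    define x where "x = commutator D (f i) e"
    have x: "x \<in> S" unfolding x_def
      using linear_S linear_commutator lin f_S i unit_S by blast
    have "diff_op (Suc r) (\<lambda>b. commutator D (f i) b + (- x) * b)"
      using diff_op_commutator[OF Suc.prems(1) f_S[OF i]] diff_op_mult[OF uminus_S[OF x]]
      by (rule diff_op_plus)
    moreover have "commutator D (f i) e + (- x) * e = 0"
      using unit_mult[OF x] by (simp add: x_def mult.commute)
    ultimately have "composite_sum r (\<lambda>b. commutator D (f i) b + (- x) * b)"
      by (rule Suc.IH)
    then have "composite_sum (Suc r) (\<lambda>b. commutator D (f i) (\<xi> i b) + (- x) * \<xi> i b)"
      using composite_sum_compose dual_der[OF i] by blast
    from composite_sum_plus[OF this composite_sum_derivation[OF derivation_times[OF x dual_der[OF i]]]]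
    show "composite_sum (Suc r) (\<lambda>b. commutator D (f i) (\<xi> i b))" by simp
  qed
  have "euler D e = 0"
    unfolding euler_def using linear_zero[OF linear_commutator[OF lin f_S]]
    by (intro sum.neutral) (simp add: derivation_unit dual_der)
  then have "composite_sum r (\<lambda>b. of_nat (Suc r) * D b - euler D b)"
    using diff_op_euler[OF Suc.prems(1)] Suc.prems(2) by (intro Suc.IH) (simp_all del: of_nat_Suc)
  then have "composite_sum (Suc r) (\<lambda>b. of_nat (Suc r) * D b - euler D b)"
    by (rule composite_sum_mono) simp
  from composite_sum_plus[OF this eu]
  have n: "composite_sum (Suc r) (\<lambda>b. of_nat (Suc r) * D b)" by simp
  obtain c where c: "c \<in> C" "c * of_nat (Suc r) = 1" using inverse_C[of "Suc r"] by blast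
  have "c * (of_nat (Suc r) * D a) = D a" for a
    by (metis c(2) mult.assoc mult_1)
  then show ?case using composite_sum_scale[OF n c(1)] by (simp del: of_nat_Suc)
qed

end

section \<open>Calculus on open subsets of \<open>\<real>\<^sup>m\<close>\<close>

text \<open>A canonical total choice of the derivative that \<open>C_k_on\<close> only asserts to
  exist, so that partial derivatives can be named and iterated.\<close>

definition pd :: "nat \<Rightarrow> ((nat \<Rightarrow> real) \<Rightarrow> real) \<Rightarrow> (nat \<Rightarrow> real) \<Rightarrow> real" where
  "pd i f x = deriv (\<lambda>t. f (x(i := t))) (x i)"

lemma pd_eqI: "((\<lambda>t. f (x(i := t))) has_real_derivative D) (at (x i)) \<Longrightarrow> pd i f x = D"
  unfolding pd_def by (rule DERIV_imp_deriv)

abbreviation Rn :: "nat \<Rightarrow> (nat \<Rightarrow> real) set" where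
  "Rn m \<equiv> topspace (Euclidean_space m)"

lemma Rn_iff: "x \<in> Rn m \<longleftrightarrow> (\<forall>i\<ge>m. x i = 0)"
  by (simp add: topspace_Euclidean_space)

lemma openin_Rn_iff: "openin (Euclidean_space m) U \<longleftrightarrow> (\<exists>W. open W \<and> U = W \<inter> Rn m)"
  by (simp add: Euclidean_space_def openin_subtopology euclidean_product_topology)

lemma openin_RnE:
  assumes "openin (Euclidean_space m) U"
  obtains W where "open W" "U = W \<inter> Rn m"
  using iffD1[OF openin_Rn_iff assms] by blast

lemma Euclidean_space_eq: "Euclidean_space m = top_of_set (Rn m)"
  by (simp add: Euclidean_space_def euclidean_product_topology)

lemma continuous_map_Rn_iff:
  assumes "U \<subseteq> Rn m"
  shows "continuous_map (subtopology (Euclidean_space m) U) euclideanreal f \<longleftrightarrow> continuous_on U f"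
proof -
  have "subtopology (Euclidean_space m) U = top_of_set U"
    using assms by (metis Euclidean_space_eq subtopology_subtopology Int_absorb1)
  then show ?thesis by (simp only: continuous_map_iff_continuous)
qed

lemma C_k_on_continuous_on: "C_k_on m k U f \<Longrightarrow> U \<subseteq> Rn m \<Longrightarrow> continuous_on U f"
  using C_k_on_continuous continuous_map_Rn_iff by metis

text \<open>Cubes instead of balls: exchanging single coordinates between two points of a cube does
  not leave it, which fits partial derivatives and paths along the axes.\<close>

definition obox :: "nat \<Rightarrow> (nat \<Rightarrow> real) \<Rightarrow> real \<Rightarrow> (nat \<Rightarrow> real) set" where
  "obox m q \<epsilon> = {x. (\<forall>i<m. \<bar>x i - q i\<bar> < \<epsilon>) \<and> (\<forall>i\<ge>m. x i = 0)}"

definition clbox :: "nat \<Rightarrow> (nat \<Rightarrow> real) \<Rightarrow> real \<Rightarrow> (nat \<Rightarrow> real) set" where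
  "clbox m q \<epsilon> = {x. (\<forall>i<m. \<bar>x i - q i\<bar> \<le> \<epsilon>) \<and> (\<forall>i\<ge>m. x i = 0)}"

lemma continuous_on_coord [continuous_intros]: "continuous_on A (\<lambda>x::nat \<Rightarrow> real. x i)"
  by (rule continuous_on_product_coordinates[THEN continuous_on_subset]) simp

lemma continuous_on_fun_upd: "continuous_on A (\<lambda>t. (x::nat \<Rightarrow> real)(i := t))"
proof (rule continuous_on_coordinatewise_then_product)
  show "continuous_on A (\<lambda>t. (x(i := t)) j)" for j
    by (cases "j = i") (auto intro: continuous_intros)
qed

lemma openin_obox: "openin (Euclidean_space m) (obox m q \<epsilon>)"
proof -
  have "open (\<Inter>i<m. {x::nat \<Rightarrow> real. \<bar>x i - q i\<bar> < \<epsilon>})"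
    by (intro open_INT ballI finite_lessThan open_Collect_less continuous_intros)
  then show ?thesis
    unfolding openin_Rn_iff by (intro exI conjI) (auto simp: obox_def topspace_Euclidean_space)
qed

lemma obox_subset_clbox: "obox m q \<epsilon> \<subseteq> clbox m q \<epsilon>"
  by (auto simp: obox_def clbox_def less_imp_le)

lemma obox_subset_Rn: "obox m q \<epsilon> \<subseteq> Rn m" and clbox_subset_Rn: "clbox m q \<epsilon> \<subseteq> Rn m"
  by (auto simp: obox_def clbox_def Rn_iff)

lemma compact_clbox: "compact (clbox m q \<epsilon>)"
proof -
  define K where "K i = (if i < m then {q i - \<epsilon>..q i + \<epsilon>} else {0})" for i
  have "compactin (product_topology (\<lambda>i. euclidean) UNIV) (PiE UNIV K)"
    unfolding compactin_PiE by (auto simp: K_def)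
  moreover have "PiE UNIV K = clbox m q \<epsilon>"
  proof (rule Set.set_eqI)
    fix x
    have "x i \<in> K i \<longleftrightarrow> (i < m \<longrightarrow> \<bar>x i - q i\<bar> \<le> \<epsilon>) \<and> (i \<ge> m \<longrightarrow> x i = 0)" for i
      by (auto simp: K_def)
    then show "x \<in> PiE UNIV K \<longleftrightarrow> x \<in> clbox m q \<epsilon>"
      unfolding clbox_def PiE_iff by auto
  qed
  ultimately show ?thesis by (simp add: euclidean_product_topology)
qed

lemma openin_Rn_contains_clbox:
  assumes U: "openin (Euclidean_space m) U" and q: "q \<in> U"
  obtains \<epsilon> where "0 < \<epsilon>" "clbox m q \<epsilon> \<subseteq> U"
proof -
  obtain W where W: "open W" "U = W \<inter> Rn m" by (rule openin_RnE[OF U])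
  then have "openin (product_topology (\<lambda>i. euclideanreal) UNIV) W"
    by (simp add: euclidean_product_topology)
  from product_topology_open_contains_basis[OF this, of q] q W obtain Y where
    Y: "q \<in> PiE UNIV Y" "\<And>i. openin euclideanreal (Y i)" "finite {i. Y i \<noteq> topspace euclideanreal}" "PiE UNIV Y \<subseteq> W"
    by auto
  have "\<exists>d>0. \<forall>y. \<bar>y - q i\<bar> \<le> d \<longrightarrow> y \<in> Y i" for i
  proof -
    have "open (Y i)" "q i \<in> Y i" using Y by (auto simp: PiE_def)
    then obtain d where "d > 0" "cball (q i) d \<subseteq> Y i" using open_contains_cball by blast
    then show ?thesis by (intro exI[of _ d]) (auto simp: cball_def dist_real_def abs_minus_commute)
  qed
  then obtain d where d: "\<And>i. d i > 0" "\<And>i y. \<bar>y - q i\<bar> \<le> d i \<Longrightarrow> y \<in> Y i" by metis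
  \<comment> \<open>The extra \<open>1\<close> keeps the set nonempty when
    \<open>m = 0\<close>.\<close>
  define \<epsilon> where "\<epsilon> = Min (insert 1 (d ` {..<m}))"
  have "\<epsilon> > 0" unfolding \<epsilon>_def using d(1) by (subst Min_gr_iff) auto
  moreover have "\<epsilon> \<le> d i" if "i < m" for i unfolding \<epsilon>_def using that by (intro Min_le) auto
  have "x \<in> U" if x: "x \<in> clbox m q \<epsilon>" for x
  proof -
    have "x i \<in> Y i" for i
    proof (cases "i < m")
      case True
      then show ?thesis using x \<open>i < m \<Longrightarrow> \<epsilon> \<le> d i\<close> by (intro d(2)) (force simp: clbox_def)
    next
      case False
      then have "x i = q i" using x q W by (auto simp: clbox_def Rn_iff)
      then show ?thesis using d(2)[of "q i" i] d(1)[of i] by simp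
    qed
    then show ?thesis using Y(4) W x clbox_subset_Rn by fastforce
  qed
  ultimately show ?thesis using that by blast
qed

lemma eventually_fun_upd_in:
  assumes "openin (Euclidean_space m) U" "x \<in> U" "i < m"
  shows "\<forall>\<^sub>F t in nhds (x i). x(i := t) \<in> U"
proof -
  obtain W where W: "open W" "U = W \<inter> Rn m" by (rule openin_RnE[OF assms(1)])
  have "open ((\<lambda>t. x(i := t)) -` W)" using W(1) by (intro open_vimage continuous_on_fun_upd)
  then have "\<forall>\<^sub>F t in nhds (x i). t \<in> (\<lambda>t. x(i := t)) -` W"
    using assms W by (intro eventually_nhds_in_open) auto
  then show ?thesis
    by eventually_elim (use assms W in \<open>auto simp: Rn_iff\<close>)
qed

lemma pd_cong:
  assumes "openin (Euclidean_space m) U" "x \<in> U" "i < m" "\<And>y. y \<in> U \<Longrightarrow> f y = g y"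
  shows "pd i f x = pd i g x"
  unfolding pd_def using eventually_fun_upd_in[OF assms(1-3)]
  by (intro deriv_cong_ev) (auto elim: eventually_mono simp: assms(4))

text \<open>Derivatives are unique, so the existential partial derivative coincides with
  \<open>pd i f\<close> on \<open>U\<close>, and on an open set \<open>C_k_on\<close> sees only the
  values there.\<close>

lemma C_k_on_Suc_iff:
  assumes U: "openin (Euclidean_space m) U"
  shows "C_k_on m (Suc k) U f \<longleftrightarrow> continuous_on U f \<and>
    (\<forall>i<m. (\<forall>x\<in>U. ((\<lambda>t. f (x(i := t))) has_real_derivative pd i f x) (at (x i))) \<and>
       C_k_on m k U (pd i f))" (is "_ \<longleftrightarrow> ?R")
proof
  assume f: "C_k_on m (Suc k) U f"
  have "(\<forall>x\<in>U. ((\<lambda>t. f (x(i := t))) has_real_derivative pd i f x) (at (x i))) \<and> C_k_on m k U (pd i f)"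
    if i: "i < m" for i
  proof -
    obtain f' where f': "\<forall>x\<in>U. ((\<lambda>t. f (x(i := t))) has_real_derivative f' x) (at (x i))" "C_k_on m k U f'"
      using C_k_on_partialE[OF f i] .
    then have eq: "f' x = pd i f x" if "x \<in> U" for x using pd_eqI that by metis
    then show ?thesis using f' C_k_on_cong[OF U eq] by auto
  qed
  then show ?R using C_k_on_continuous_on[OF f openin_subset[OF U]] by blast
next
  assume ?R
  then show "C_k_on m (Suc k) U f" by (auto simp: continuous_map_Rn_iff[OF openin_subset[OF U]])
qed

section \<open>Restriction, locality and algebra of C^k functions\<close>

lemma C_k_on_mono: "C_k_on m k U f \<Longrightarrow> l \<le> k \<Longrightarrow> C_k_on m l U f"
proof (induction k)
  case (Suc k)
  then show ?case using C_k_on_SucD[of m k U f] by (cases "l = Suc k") (auto simp del: C_k_on.simps)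
qed simp

lemma C_k_on_subset: "C_k_on m k U f \<Longrightarrow> V \<subseteq> U \<Longrightarrow> C_k_on m k V f"
proof (induction k arbitrary: f)
  case 0
  then show ?case using continuous_map_from_subtopology_mono[OF _ 0(2)] by simp
next
  case (Suc k)
  have "\<exists>f'. (\<forall>x\<in>V. ((\<lambda>t. f (x(i := t))) has_real_derivative f' x) (at (x i))) \<and> C_k_on m k V f'"
    if "i < m" for i
    using C_k_on_partialE[OF Suc.prems(1) that] Suc.IH Suc.prems(2) by (metis subsetD)
  then show ?case
    using continuous_map_from_subtopology_mono[OF C_k_on_continuous[OF Suc.prems(1)] Suc.prems(2)] by simp
qed

lemma at_within_Rn_open:
  assumes "openin (Euclidean_space m) V" "x \<in> V"
  shows "at x within V = at x within Rn m"
proof -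
  obtain W where "open W" "V = W \<inter> Rn m" by (rule openin_RnE[OF assms(1)])
  then show ?thesis using assms(2) by (intro at_within_nhd[of x W]) auto
qed

lemma C_k_on_local:
  assumes U: "openin (Euclidean_space m) U"
    and loc: "\<And>x. x \<in> U \<Longrightarrow> \<exists>V. openin (Euclidean_space m) V \<and> x \<in> V \<and> C_k_on m k V f"
  shows "C_k_on m k U f"
proof -
  have cont: "continuous_on U f"
    if loc: "\<And>x. x \<in> U \<Longrightarrow> \<exists>V. openin (Euclidean_space m) V \<and> x \<in> V \<and> C_k_on m k V f" for k f
    unfolding continuous_on_eq_continuous_within
  proof
    fix x assume x: "x \<in> U"
    then obtain V where V: "openin (Euclidean_space m) V" "x \<in> V" "C_k_on m k V f" using loc by blast
    then have "continuous (at x within V) f"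
      using C_k_on_continuous_on[OF V(3) openin_subset[OF V(1)]]
      by (simp add: continuous_on_eq_continuous_within)
    then show "continuous (at x within U) f"
      using at_within_Rn_open[OF V(1,2)] at_within_Rn_open[OF U x] by simp
  qed
  show ?thesis using loc
  proof (induction k arbitrary: f)
    case 0
    from cont[OF this] show ?case by (simp add: continuous_map_Rn_iff[OF openin_subset[OF U]])
  next
    case (Suc k)
    have "((\<lambda>t. f (x(i := t))) has_real_derivative pd i f x) (at (x i)) \<and>
        (\<exists>V. openin (Euclidean_space m) V \<and> x \<in> V \<and> C_k_on m k V (pd i f))"
      if "x \<in> U" "i < m" for x i
      using Suc.prems[OF that(1)] C_k_on_Suc_iff that(2) by blast
    then show ?case
      unfolding C_k_on_Suc_iff[OF U] using cont[OF Suc.prems] Suc.IH by blast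
  qed
qed

lemma C_k_on_sum: "(\<And>i. i \<in> I \<Longrightarrow> C_k_on m k U (f i)) \<Longrightarrow> C_k_on m k U (\<lambda>x. \<Sum>i\<in>I. f i x)"
  by (induction I rule: infinite_finite_induct) (simp_all add: C_k_on_const C_k_on_add del: C_k_on.simps)

lemma C_k_on_prod: "(\<And>i. i \<in> I \<Longrightarrow> C_k_on m k U (f i)) \<Longrightarrow> C_k_on m k U (\<lambda>x. \<Prod>i\<in>I. f i x)"
  by (induction I rule: infinite_finite_induct) (simp_all add: C_k_on_const C_k_on_mult del: C_k_on.simps)

lemma C_k_on_coord:
  assumes U: "openin (Euclidean_space m) U"
  shows "C_k_on m k U (\<lambda>x. x i)"
proof (cases k)
  case 0
  then show ?thesis by (simp add: continuous_map_Rn_iff[OF openin_subset[OF U]] continuous_on_coord)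
next
  case (Suc l)
  have "((\<lambda>t. (x(j := t)) i) has_real_derivative (if j = i then 1 else 0)) (at (x j))" for x :: "nat \<Rightarrow> real" and j
    by (auto intro!: derivative_eq_intros)
  then show ?thesis unfolding Suc
    by (auto simp: continuous_map_Rn_iff[OF openin_subset[OF U]] continuous_on_coord
        intro!: exI[of _ "\<lambda>x. if j = i then 1 else 0" for j] C_k_on_const)
qed

subsection \<open>Hadamard's lemma and the chain rule\<close>

text \<open>Joining \<open>q\<close> to \<open>x\<close> along the edges of a box instead of a segment keeps the
  calculus one-dimensional; the chain rule is then a consequence of Hadamard's lemma.\<close>

definition edge :: "(nat \<Rightarrow> real) \<Rightarrow> nat \<Rightarrow> real \<Rightarrow> (nat \<Rightarrow> real) \<Rightarrow> nat \<Rightarrow> real" where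
  "edge q i t x = (\<lambda>j. if j < i then x j else if j = i then q j + t * (x j - q j) else q j)"

lemma edge_in_obox:
  assumes "x \<in> obox m q \<epsilon>" "q \<in> Rn m" "0 < \<epsilon>" "0 \<le> t" "t \<le> 1"
  shows "edge q i t x \<in> obox m q \<epsilon>"
proof -
  have "\<bar>edge q i t x j - q j\<bar> < \<epsilon>" if "j < m" for j
  proof -
    have x: "\<bar>x j - q j\<bar> < \<epsilon>" using assms that by (simp add: obox_def)
    have "\<bar>t * (x j - q j)\<bar> \<le> 1 * \<bar>x j - q j\<bar>"
      unfolding abs_mult using assms by (intro mult_right_mono) auto
    then show ?thesis using x assms(3) by (auto simp: edge_def)
  qed
  then show ?thesis using assms by (auto simp: obox_def edge_def Rn_iff)
qed

lemma edge_at_base: "edge q i t q = q"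
  by (auto simp: edge_def)

lemma edge_0_Suc: "edge q (Suc i) 0 x = edge q i 1 x"
  by (auto simp: edge_def fun_eq_iff less_Suc_eq)

lemma edge_upd: "edge q i t x = (edge q i 0 x)(i := q i + t * (x i - q i))"
  by (auto simp: edge_def fun_eq_iff)

lemma edge_fun_upd:
  "edge q i t (x(l := s)) = (edge q i t x)(l := if l < i then s else if l = i then q i + t * (s - q i) else q l)"
  by (auto simp: edge_def fun_eq_iff)

lemma continuous_on_edge: "continuous_on A (\<lambda>(x, t). edge q i t x)"
proof (rule continuous_on_coordinatewise_then_product)
  fix j
  have "continuous_on A (\<lambda>z. fst z j)" for j :: nat
    by (rule continuous_on_product_then_coordinatewise) (rule continuous_on_fst[OF continuous_on_id])
  then show "continuous_on A (\<lambda>z. (case z of (x, t) \<Rightarrow> edge q i t x) j)"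
    by (cases "j < i"; cases "j = i")
       (auto simp: edge_def split_beta intro!: continuous_intros)
qed

text \<open>These are the coefficients in Hadamard's lemma for \<open>j = 0\<close>. The weight
  \<open>t ^ j\<close> closes the family under partial derivatives, since differentiating along the
  edge direction produces a factor \<open>t\<close>.\<close>

definition edge_integral :: "(nat \<Rightarrow> real) \<Rightarrow> nat \<Rightarrow> nat \<Rightarrow> ((nat \<Rightarrow> real) \<Rightarrow> real) \<Rightarrow> (nat \<Rightarrow> real) \<Rightarrow> real" where
  "edge_integral q i j b x = integral (cbox 0 1) (\<lambda>t. t ^ j * b (edge q i t x))"

context
  fixes m :: nat and q :: "nat \<Rightarrow> real" and \<epsilon> :: real
  assumes q: "q \<in> Rn m" and \<epsilon>: "0 < \<epsilon>"
begin

lemma continuous_on_edge_compose: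
  assumes "continuous_on (obox m q \<epsilon>) b"
  shows "continuous_on (obox m q \<epsilon> \<times> cbox 0 1) (\<lambda>(x, t). t ^ j * b (edge q i t x))"
proof -
  have "continuous_on (obox m q \<epsilon> \<times> cbox 0 1) (\<lambda>z. b (case z of (x, t) \<Rightarrow> edge q i t x))"
    by (rule continuous_on_compose2[OF assms continuous_on_edge]) (auto intro: edge_in_obox q \<epsilon>)
  then show ?thesis by (auto simp: split_beta intro!: continuous_intros)
qed

lemma edge_integrand_integrable:
  assumes "continuous_on (obox m q \<epsilon>) b" "x \<in> obox m q \<epsilon>"
  shows "(\<lambda>t. t ^ j * b (edge q i t x)) integrable_on cbox 0 1"
proof -
  have "continuous_on (cbox 0 1) (\<lambda>t. case (x, t) of (x, t) \<Rightarrow> t ^ j * b (edge q i t x))"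
    by (rule continuous_on_compose2[OF continuous_on_edge_compose[OF assms(1)], where f = "Pair x"])
      (use assms(2) in \<open>auto intro!: continuous_intros\<close>)
  then show ?thesis by (intro integrable_continuous) simp
qed

lemma continuous_on_edge_integral:
  "continuous_on (obox m q \<epsilon>) b \<Longrightarrow> continuous_on (obox m q \<epsilon>) (edge_integral q i j b)"
  unfolding edge_integral_def[abs_def]
  by (rule integral_continuous_on_param) (rule continuous_on_edge_compose)

text \<open>Differentiation under the integral sign: the partial derivative in direction
  \<open>l\<close> is the edge integral of \<open>pd l b\<close> with weight exponent
  \<open>j\<close> for l < i and \<open>j + 1\<close> for l = i, and it is 0 for l > i, where the
  edge does not depend on \<open>x l\<close>.\<close>

lemma C_k_on_edge_integral:
  assumes i: "i < m"
  shows "C_k_on m k (obox m q \<epsilon>) b \<Longrightarrow> C_k_on m k (obox m q \<epsilon>) (edge_integral q i j b)"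
proof (induction k arbitrary: b j)
  case 0
  then show ?case
    using continuous_on_edge_integral by (simp add: continuous_map_Rn_iff[OF obox_subset_Rn])
next
  case (Suc k)
  let ?B = "obox m q \<epsilon>"
  have cb: "continuous_on ?B b" using C_k_on_continuous_on[OF Suc.prems obox_subset_Rn] .
  have b: "\<And>l x. l < m \<Longrightarrow> x \<in> ?B \<Longrightarrow> ((\<lambda>t. b (x(l := t))) has_real_derivative pd l b x) (at (x l))"
    "\<And>l. l < m \<Longrightarrow> C_k_on m k ?B (pd l b)"
    using Suc.prems unfolding C_k_on_Suc_iff[OF openin_obox] by auto
  have "\<exists>g. (\<forall>x\<in>?B. ((\<lambda>s. edge_integral q i j b (x(l := s))) has_real_derivative g x) (at (x l))) \<and>
      C_k_on m k ?B g" if l: "l < m" for l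
  proof -
    have cpd: "continuous_on ?B (pd l b)" using C_k_on_continuous_on[OF b(2)[OF l] obox_subset_Rn] .
    \<comment> \<open>The derivative of the \<open>l\<close>-th coordinate of
      \<open>edge q i t x\<close> with respect to \<open>x l\<close>.\<close>
    define c where "c t = (if l < i then 1 else if l = i then t else 0)" for t :: real
    define g where "g x = integral (cbox 0 1) (\<lambda>t. t ^ j * (c t * pd l b (edge q i t x)))" for x
    have "((\<lambda>s. edge_integral q i j b (x(l := s))) has_real_derivative g x) (at (x l))" if x: "x \<in> ?B" for x
    proof -
      \<comment> \<open>The open interval open to the \<open>l\<close>-th coordinate inside the box;
        the Leibniz rule asks for a convex parameter set.\<close>
      define U where "U = {s. \<bar>s - q l\<bar> < \<epsilon>}"
      have U: "U = ball (q l) \<epsilon>" by (auto simp: U_def dist_real_def abs_minus_commute)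
      have xU: "x(l := s) \<in> ?B" if "s \<in> U" for s
        using x l that by (auto simp: obox_def U_def)
      have cont: "continuous_on (U \<times> cbox 0 1) (\<lambda>(s, t). t ^ j * (c t * pd l b (edge q i t (x(l := s)))))"
      proof -
        have "continuous_on (U \<times> cbox 0 1) (\<lambda>z. (x(l := fst z), snd z))"
          by (intro continuous_on_Pair continuous_on_compose2[OF continuous_on_fun_upd[of UNIV]]
              continuous_intros) auto
        then have "continuous_on (U \<times> cbox 0 1)
            (\<lambda>z. case (x(l := fst z), snd z) of (x, t) \<Rightarrow> t ^ 0 * pd l b (edge q i t x))"
          by (rule continuous_on_compose2[OF continuous_on_edge_compose[OF cpd]]) (auto intro: xU)
        moreover have "continuous_on (U \<times> cbox 0 1) (\<lambda>z. c (snd z))"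
          by (cases "l < i"; cases "l = i") (auto simp: c_def intro!: continuous_intros)
        ultimately show ?thesis by (auto simp: split_beta intro!: continuous_intros)
      qed
      have der: "((\<lambda>s. t ^ j * b (edge q i t (x(l := s)))) has_field_derivative
          t ^ j * (c t * pd l b (edge q i t (x(l := s))))) (at s within U)"
        if s: "s \<in> U" and t: "t \<in> cbox 0 1" for s t
      proof -
        let ?y = "edge q i t (x(l := s))"
        define \<alpha> where "\<alpha> s = (if l < i then s else if l = i then q i + t * (s - q i) else q l)" for s
        have y: "?y \<in> ?B" using xU[OF s] t q \<epsilon> by (intro edge_in_obox) auto
        have yl: "?y l = \<alpha> s" by (simp add: edge_fun_upd \<alpha>_def)
        have "(\<alpha> has_real_derivative c t) (at s)"
          by (cases "l < i"; cases "l = i")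
            (auto simp: \<alpha>_def[abs_def] c_def intro!: derivative_eq_intros)
        from DERIV_chain2[OF b(1)[OF l y, unfolded yl] this]
        have "((\<lambda>s. b (?y(l := \<alpha> s))) has_real_derivative pd l b ?y * c t) (at s)" .
        moreover have "?y(l := \<alpha> s') = edge q i t (x(l := s'))" for s'
          by (simp add: edge_fun_upd \<alpha>_def)
        ultimately have "((\<lambda>s. b (edge q i t (x(l := s)))) has_real_derivative c t * pd l b ?y) (at s)"
          by (simp add: mult.commute)
        from DERIV_cmult[OF this, of "t ^ j"] show ?thesis
          by (rule has_field_derivative_at_within)
      qed
      have "((\<lambda>s. integral (cbox 0 1) (\<lambda>t. t ^ j * b (edge q i t (x(l := s))))) has_field_derivative
          integral (cbox 0 1) (\<lambda>t. t ^ j * (c t * pd l b (edge q i t (x(l := x l)))))) (at (x l) within U)"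
      proof (rule leibniz_rule_field_derivative[OF der _ cont])
        show "(\<lambda>t. t ^ j * b (edge q i t (x(l := s)))) integrable_on cbox 0 1" if "s \<in> U" for s
          using edge_integrand_integrable[OF cb xU[OF that]] .
        show "x l \<in> U" using x l by (auto simp: U_def obox_def)
        show "convex U" unfolding U by (rule convex_ball)
      qed
      moreover have "at (x l) within U = at (x l)"
        using x l by (intro at_within_open) (auto simp: U obox_def dist_real_def abs_minus_commute)
      ultimately show ?thesis by (simp add: g_def edge_integral_def)
    qed
    moreover have "C_k_on m k ?B g"
    proof -
      consider "l < i" | "l = i" | "l > i" by linarith
      then show ?thesis
      proof cases
        case 1
        then have "g = edge_integral q i j (pd l b)" by (auto simp: g_def c_def edge_integral_def)
        then show ?thesis using Suc.IH b(2)[OF l] by simp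
      next
        case 2
        then have "g = edge_integral q i (Suc j) (pd l b)"
          by (auto simp: g_def c_def edge_integral_def mult_ac)
        then show ?thesis using Suc.IH b(2)[OF l] by simp
      next
        case 3
        then have "g = (\<lambda>x. 0)" by (auto simp: g_def c_def)
        then show ?thesis by (simp add: C_k_on_const del: C_k_on.simps)
      qed
    qed
    ultimately show ?thesis by blast
  qed
  then show ?case
    using continuous_on_edge_integral[OF cb] by (simp add: continuous_map_Rn_iff[OF obox_subset_Rn])
qed

text \<open>The fundamental theorem of calculus along the \<open>i\<close>-th edge, traversed with
  velocity \<open>x i - q i\<close>.\<close>

lemma edge_telescope:
  assumes f: "C_k_on m (Suc 0) (obox m q \<epsilon>) f" and x: "x \<in> obox m q \<epsilon>" and i: "i < m"
  shows "f (edge q i 1 x) - f (edge q i 0 x) = (x i - q i) * edge_integral q i 0 (pd i f) x"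
proof -
  have f': "((\<lambda>t. f (y(i := t))) has_real_derivative pd i f y) (at (y i))" if "y \<in> obox m q \<epsilon>" for y
    using f i that unfolding C_k_on_Suc_iff[OF openin_obox] by blast
  have "((\<lambda>t. f (edge q i t x)) has_vector_derivative pd i f (edge q i t x) * (x i - q i)) (at t within {0..1})"
    if t: "t \<in> {0..1}" for t
  proof -
    have "edge q i t x \<in> obox m q \<epsilon>" using t x q \<epsilon> by (intro edge_in_obox) auto
    from f'[OF this] have
      "((\<lambda>s. f ((edge q i 0 x)(i := s))) has_real_derivative pd i f (edge q i t x)) (at (q i + t * (x i - q i)))"
      by (simp add: edge_upd[of q i t])
    moreover have "((\<lambda>t. q i + t * (x i - q i)) has_real_derivative (x i - q i)) (at t)"
      by (auto intro!: derivative_eq_intros)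
    ultimately have "((\<lambda>t. f ((edge q i 0 x)(i := q i + t * (x i - q i)))) has_real_derivative
        pd i f (edge q i t x) * (x i - q i)) (at t)"
      by (rule DERIV_chain2)
    then show ?thesis
      unfolding edge_upd[of q i _ x, symmetric] has_real_derivative_iff_has_vector_derivative
      by (rule has_vector_derivative_at_within)
  qed
  from fundamental_theorem_of_calculus[OF _ this]
  have "((\<lambda>t. pd i f (edge q i t x) * (x i - q i)) has_integral f (edge q i 1 x) - f (edge q i 0 x)) {0..1}"
    by simp
  from integral_unique[OF this] show ?thesis
    by (simp add: edge_integral_def mult.commute)
qed

text \<open>Each edge starts where the previous one ends, so the increments telescope from
  \<open>q\<close> to \<open>x\<close>. What matters for the applications is that the coefficients
  take the values \<open>pd i f q\<close> at \<open>q\<close>.\<close>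

lemma hadamard:
  assumes f: "C_k_on m (Suc 0) (obox m q \<epsilon>) f" and x: "x \<in> obox m q \<epsilon>"
  shows "f x = f q + (\<Sum>i<m. (x i - q i) * edge_integral q i 0 (pd i f) x)"
proof -
  have "(\<Sum>i<n. (x i - q i) * edge_integral q i 0 (pd i f) x) = f (edge q n 0 x) - f (edge q 0 0 x)"
    if "n \<le> m" for n
    using that
  proof (induction n)
    case (Suc n)
    then show ?case using edge_telescope[OF f x, of n] by (simp add: edge_0_Suc)
  qed simp
  moreover have "edge q m 0 x = x" using x q by (auto simp: edge_def obox_def Rn_iff fun_eq_iff)
  moreover have "edge q 0 0 x = q" by (auto simp: edge_def)
  ultimately show ?thesis by simp
qed

lemma edge_integral_base: "edge_integral q i 0 b q = b q"
  by (simp add: edge_integral_def edge_at_base)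

end

lemma C_k_on_SucI:
  assumes "openin (Euclidean_space m) U" "continuous_on U f"
    and "\<And>i. i < m \<Longrightarrow> (\<forall>x\<in>U. ((\<lambda>t. f (x(i := t))) has_real_derivative f' i x) (at (x i))) \<and> C_k_on m k U (f' i)"
  shows "C_k_on m (Suc k) U f"
  using assms by (auto simp: continuous_map_Rn_iff[OF openin_subset[OF assms(1)]])

text \<open>As \<open>u t = 0\<close>, the difference quotient of the product is that of
  \<open>u\<close> times \<open>v\<close>, so continuity of \<open>v\<close> is enough. The Hadamard
  coefficients of a C^1 function are only known to be continuous.\<close>

lemma DERIV_mult_vanishing:
  assumes "(u has_real_derivative D) (at t)" "u t = 0" "isCont v t"
  shows "((\<lambda>s. u s * v s) has_real_derivative D * v t) (at t)"
proof -
  have "(\<lambda>s. (u s - u t) / (s - t) * v s) \<midarrow>t\<rightarrow> D * v t"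
    using assms(1,3) by (intro tendsto_mult) (auto simp: has_field_derivative_iff isCont_def)
  then show ?thesis by (simp add: has_field_derivative_iff assms(2))
qed

text \<open>Hadamard's lemma with base point \<open>\<gamma> t\<close>, evaluated at
  \<open>\<gamma> s\<close>, writes the increment of \<open>F\<close> as a sum of products whose
  first factor vanishes at \<open>s = t\<close>.\<close>

lemma chain_rule:
  assumes V: "openin (Euclidean_space m) V" and F: "C_k_on m (Suc 0) V F"
    and ev: "\<forall>\<^sub>F s in nhds t. \<gamma> s \<in> V"
    and \<gamma>: "\<And>l. l < m \<Longrightarrow> ((\<lambda>s. \<gamma> s l) has_real_derivative \<gamma>' l) (at t)"
  shows "((\<lambda>s. F (\<gamma> s)) has_real_derivative (\<Sum>l<m. pd l F (\<gamma> t) * \<gamma>' l)) (at t)"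
proof -
  let ?q = "\<gamma> t"
  have qV: "?q \<in> V" using ev eventually_nhds_x_imp_x by blast
  obtain \<epsilon> where \<epsilon>: "0 < \<epsilon>" "clbox m ?q \<epsilon> \<subseteq> V" using openin_Rn_contains_clbox[OF V qV] .
  have q: "?q \<in> Rn m" using qV openin_subset[OF V] by blast
  let ?B = "obox m ?q \<epsilon>"
  have FB: "C_k_on m (Suc 0) ?B F"
    using C_k_on_subset[OF F] obox_subset_clbox \<epsilon>(2) by (meson order_trans)
  have evB: "\<forall>\<^sub>F s in nhds t. \<gamma> s \<in> ?B"
  proof -
    have "\<forall>\<^sub>F s in nhds t. \<bar>\<gamma> s l - \<gamma> t l\<bar> < \<epsilon>" if "l < m" for l
    proof -
      have "isCont (\<lambda>s. \<gamma> s l) t" using DERIV_isCont[OF \<gamma>[OF that]] .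
      then have "((\<lambda>s. \<gamma> s l) \<longlongrightarrow> \<gamma> t l) (nhds t)" by (simp add: isCont_def tendsto_at_iff_tendsto_nhds[of "\<lambda>s. \<gamma> s l" t])
      from tendstoD[OF this \<epsilon>(1)] show ?thesis by (simp add: dist_real_def)
    qed
    then have "\<forall>\<^sub>F s in nhds t. \<forall>l\<in>{..<m}. \<bar>\<gamma> s l - \<gamma> t l\<bar> < \<epsilon>"
      by (intro eventually_ball_finite) auto
    with ev show ?thesis
      by eventually_elim (use openin_subset[OF V] in \<open>auto simp: obox_def Rn_iff subset_iff\<close>)
  qed
  define g where "g i = edge_integral ?q i 0 (pd i F)" for i
  have cont: "isCont (\<lambda>s. g i (\<gamma> s)) t" if i: "i < m" for i
  proof -
    have "C_k_on m 0 ?B (pd i F)" using FB i unfolding C_k_on_Suc_iff[OF openin_obox] by blast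
    then have cg: "continuous_on ?B (g i)"
      unfolding g_def using continuous_on_edge_integral[OF q \<epsilon>(1)] C_k_on_continuous_on[OF _ obox_subset_Rn] by blast
    from evB obtain T where T: "open T" "t \<in> T" "\<And>s. s \<in> T \<Longrightarrow> \<gamma> s \<in> ?B"
      unfolding eventually_nhds by blast
    have lim: "((\<lambda>s. g i (\<gamma> s)) \<longlongrightarrow> g i (\<gamma> t)) (at t)"
    proof (rule continuous_on_tendsto_compose[OF cg])
      show "(\<gamma> \<longlongrightarrow> \<gamma> t) (at t)"
      proof -
        have "((\<lambda>s. \<gamma> s l) \<longlongrightarrow> \<gamma> t l) (at t)" for l
        proof (cases "l < m")
          case True
          then show ?thesis using DERIV_isCont[OF \<gamma>] by (simp add: isCont_def)
        next
          case False
          have "\<forall>\<^sub>F s in at t. \<gamma> t l = \<gamma> s l"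
            using evB q False by (auto simp: eventually_at_filter obox_def Rn_iff elim: eventually_mono)
          then show ?thesis by (rule Lim_transform_eventually[OF tendsto_const])
        qed
        then have "limitin (product_topology (\<lambda>i. euclideanreal) UNIV) \<gamma> (\<gamma> t) (at t)"
          by (simp add: limitin_componentwise)
        then show ?thesis by (simp add: euclidean_product_topology)
      qed
      show "\<gamma> t \<in> ?B" using T by blast
      show "\<forall>\<^sub>F s in at t. \<gamma> s \<in> ?B" using evB by (simp add: eventually_at_filter eventually_mono)
    qed
    then show ?thesis by (simp add: isCont_def)
  qed
  have "((\<lambda>s. F ?q + (\<Sum>i<m. (\<gamma> s i - ?q i) * g i (\<gamma> s))) has_real_derivative
      0 + (\<Sum>i<m. \<gamma>' i * g i (\<gamma> t))) (at t)"
    by (intro DERIV_add DERIV_const DERIV_sum DERIV_mult_vanishing cont)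
      (auto intro!: derivative_eq_intros \<gamma>)
  then have "((\<lambda>s. F ?q + (\<Sum>i<m. (\<gamma> s i - ?q i) * g i (\<gamma> s))) has_real_derivative
      (\<Sum>l<m. pd l F (\<gamma> t) * \<gamma>' l)) (at t)"
    by (simp add: g_def edge_integral_base[OF q \<epsilon>(1)] mult.commute)
  moreover have "\<forall>\<^sub>F s in nhds t. F ?q + (\<Sum>i<m. (\<gamma> s i - ?q i) * g i (\<gamma> s)) = F (\<gamma> s)"
    using evB by eventually_elim (simp add: g_def hadamard[OF q \<epsilon>(1) FB])
  ultimately show ?thesis by (subst (asm) DERIV_cong_ev[OF refl _ refl]) auto
qed


lemma C_k_on_compose:
  assumes U: "openin (Euclidean_space m) U" and V: "openin (Euclidean_space m) V"
    and \<Phi>: "\<And>x. x \<in> U \<Longrightarrow> \<Phi> x \<in> V"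
  shows "C_k_on m k V F \<Longrightarrow> (\<And>l. l < m \<Longrightarrow> C_k_on m k U (\<lambda>x. \<Phi> x l)) \<Longrightarrow> C_k_on m k U (\<lambda>x. F (\<Phi> x))"
proof (induction k arbitrary: F)
  have cont: "continuous_on U (\<lambda>x. F (\<Phi> x))"
    if F: "C_k_on m k V F" and \<Phi>k: "\<And>l. l < m \<Longrightarrow> C_k_on m k U (\<lambda>x. \<Phi> x l)" for k F
  proof (rule continuous_on_compose2[OF C_k_on_continuous_on[OF F openin_subset[OF V]]])
    show "continuous_on U \<Phi>"
    proof (rule continuous_on_coordinatewise_then_product)
      fix l show "continuous_on U (\<lambda>x. \<Phi> x l)"
      proof (cases "l < m")
        case True
        show ?thesis using C_k_on_continuous_on[OF \<Phi>k[OF True] openin_subset[OF U]] .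
      next
        case False
        then have "\<Phi> x l = 0" if "x \<in> U" for x
          using openin_subset[OF V] \<Phi>[OF that] by (auto simp: Rn_iff subset_iff)
        then show ?thesis by (simp cong: continuous_on_cong)
      qed
    qed
  qed (use \<Phi> in blast)
  {
    case 0
    show ?case using cont[OF 0] by (simp add: continuous_map_Rn_iff[OF openin_subset[OF U]])
  next
    case (Suc k)
    have "(\<forall>x\<in>U. ((\<lambda>t. F (\<Phi> (x(i := t)))) has_real_derivative
          (\<Sum>l<m. pd l F (\<Phi> x) * pd i (\<lambda>x. \<Phi> x l) x)) (at (x i))) \<and>
        C_k_on m k U (\<lambda>x. \<Sum>l<m. pd l F (\<Phi> x) * pd i (\<lambda>x. \<Phi> x l) x)" if i: "i < m" for i
    proof (intro conjI ballI C_k_on_sum C_k_on_mult)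
      fix x assume x: "x \<in> U"
      have "((\<lambda>t. F (\<Phi> (x(i := t)))) has_real_derivative
          (\<Sum>l<m. pd l F (\<Phi> (x(i := x i))) * pd i (\<lambda>x. \<Phi> x l) x)) (at (x i))"
      proof (rule chain_rule[OF V])
        show "C_k_on m (Suc 0) V F" by (rule C_k_on_mono[OF Suc.prems(1)]) simp
        show "\<forall>\<^sub>F s in nhds (x i). \<Phi> (x(i := s)) \<in> V"
          using eventually_fun_upd_in[OF U x i] by eventually_elim (rule \<Phi>)
        show "((\<lambda>s. \<Phi> (x(i := s)) l) has_real_derivative pd i (\<lambda>x. \<Phi> x l) x) (at (x i))" if "l < m" for l
          using Suc.prems(2)[OF that] i x unfolding C_k_on_Suc_iff[OF U] by blast
      qed
      then show "((\<lambda>t. F (\<Phi> (x(i := t)))) has_real_derivative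
          (\<Sum>l<m. pd l F (\<Phi> x) * pd i (\<lambda>x. \<Phi> x l) x)) (at (x i))" by simp
    next
      fix l assume l: "l \<in> {..<m}"
      have "C_k_on m k V (pd l F)" using Suc.prems(1) l unfolding C_k_on_Suc_iff[OF V] by blast
      then show "C_k_on m k U (\<lambda>x. pd l F (\<Phi> x))"
        by (rule Suc.IH) (rule C_k_on_SucD[OF Suc.prems(2)])
      show "C_k_on m k U (pd i (\<lambda>x. \<Phi> x l))"
        using Suc.prems(2)[of l] l i unfolding C_k_on_Suc_iff[OF U] by blast
    qed
    then show ?case
      using cont[OF Suc.prems] by (intro C_k_on_SucI[OF U]) blast+
  }
qed

text \<open>The outer function comes with the whole tower \<open>d\<close> of its derivatives, and
  each use of the induction hypothesis moves one step up the tower.\<close>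

lemma C_k_on_compose_real:
  assumes U: "openin (Euclidean_space m) U"
    and d: "\<And>n y. y \<in> T \<Longrightarrow> (d n has_real_derivative d (Suc n) y) (at y)"
    and f: "\<And>x. x \<in> U \<Longrightarrow> f x \<in> T"
  shows "C_k_on m k U f \<Longrightarrow> C_k_on m k U (\<lambda>x. d n (f x))"
proof (induction k arbitrary: n)
  have cont: "continuous_on U (\<lambda>x. d n (f x))" if "C_k_on m k U f" for n k
  proof (rule continuous_on_compose2[OF _ C_k_on_continuous_on[OF that openin_subset[OF U]]])
    show "continuous_on T (d n)"
      using d DERIV_isCont by (intro continuous_at_imp_continuous_on) blast
  qed (use f in blast)
  {
    case 0
    show ?case using cont[OF 0] by (simp add: continuous_map_Rn_iff[OF openin_subset[OF U]])
  next
    case (Suc k)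
    have "(\<forall>x\<in>U. ((\<lambda>t. d n (f (x(i := t)))) has_real_derivative d (Suc n) (f x) * pd i f x) (at (x i))) \<and>
        C_k_on m k U (\<lambda>x. d (Suc n) (f x) * pd i f x)" if i: "i < m" for i
    proof (intro conjI ballI C_k_on_mult)
      fix x assume x: "x \<in> U"
      have "((\<lambda>t. f (x(i := t))) has_real_derivative pd i f x) (at (x i))"
        using Suc.prems i x unfolding C_k_on_Suc_iff[OF U] by blast
      from DERIV_chain2[OF _ this, of "d n" "d (Suc n) (f x)"] d[OF f[OF x]]
      show "((\<lambda>t. d n (f (x(i := t)))) has_real_derivative d (Suc n) (f x) * pd i f x) (at (x i))"
        by simp
    next
      show "C_k_on m k U (\<lambda>x. d (Suc n) (f x))" using Suc.IH C_k_on_SucD[OF Suc.prems] .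
      show "C_k_on m k U (pd i f)" using Suc.prems i unfolding C_k_on_Suc_iff[OF U] by blast
    qed
    then show ?case
      using cont[OF Suc.prems] by (intro C_k_on_SucI[OF U]) blast+
  }
qed

lemma C_k_on_inverse:
  assumes U: "openin (Euclidean_space m) U" and f: "\<And>x. x \<in> U \<Longrightarrow> f x \<noteq> 0" "C_k_on m k U f"
  shows "C_k_on m k U (\<lambda>x. inverse (f x))"
proof -
  define d :: "nat \<Rightarrow> real \<Rightarrow> real" where "d n y = (-1) ^ n * fact n * inverse y ^ Suc n" for n y
  have d: "(d n has_real_derivative d (Suc n) y) (at y)" if "y \<noteq> 0" for n y
    using DERIV_cmult[OF DERIV_power[OF DERIV_inverse[OF that], of "Suc n"], of "(-1) ^ n * fact n"]
    by (simp add: d_def[abs_def] algebra_simps)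
  have "C_k_on m k U (\<lambda>x. d 0 (f x))"
  proof (rule C_k_on_compose_real[OF U, where T = "- {0}" and d = d])
    show "(d n has_real_derivative d (Suc n) y) (at y)" if "y \<in> - {0}" for n y
      using d that by simp
  qed (use f in auto)
  then show ?thesis by (simp add: d_def)
qed

subsection \<open>A smooth cutoff\<close>

text \<open>With y = 1/x, the derivative of P(y) exp(-y) with respect to x is y^2 (P(y) - P'(y))
  exp(-y).\<close>

fun cutoff_poly :: "nat \<Rightarrow> real poly" where
  "cutoff_poly 0 = 1"
| "cutoff_poly (Suc n) = [:0, 0, 1:] * (cutoff_poly n - pderiv (cutoff_poly n))"

text \<open>The \<open>n\<close>-th derivative of \<open>exp (- 1 / x)\<close>, extended by 0 to the left half-line.\<close>

definition cutoff :: "nat \<Rightarrow> real \<Rightarrow> real" where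
  "cutoff n x = (if x > 0 then poly (cutoff_poly n) (1 / x) * exp (- (1 / x)) else 0)"

lemma poly_exp_tendsto_0: "((\<lambda>y::real. poly p y * exp (- y)) \<longlongrightarrow> 0) at_top"
proof -
  have "((\<lambda>y. \<Sum>i\<le>Polynomial.degree p. Polynomial.coeff p i * (y ^ i / exp y)) \<longlongrightarrow> (\<Sum>i\<le>Polynomial.degree p. Polynomial.coeff p i * 0)) at_top"
    by (intro tendsto_sum tendsto_mult tendsto_const tendsto_power_div_exp_0)
  moreover have "(\<Sum>i\<le>Polynomial.degree p. Polynomial.coeff p i * (y ^ i / exp y)) = poly p y * exp (- y)" for y :: real
    by (simp add: poly_altdef sum_distrib_left exp_minus divide_inverse mult_ac)
  ultimately show ?thesis by simp
qed

lemma cutoff_DERIV: "(cutoff n has_real_derivative cutoff (Suc n) x) (at x)"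
proof -
  consider "x > 0" | "x < 0" | "x = 0" by linarith
  then show ?thesis
  proof cases
    case 1
    let ?p = "cutoff_poly n"
    have "((\<lambda>x. poly ?p (1 / x) * exp (- (1 / x))) has_real_derivative cutoff (Suc n) x) (at x)"
      using 1
      by (auto intro!: derivative_eq_intros DERIV_chain2[OF poly_DERIV] simp: cutoff_def field_simps power2_eq_square)
    then show ?thesis
      by (rule has_field_derivative_transform_within_open[of _ _ _ "{0<..}"]) (use 1 in \<open>auto simp: cutoff_def\<close>)
  next
    case 2
    then have "((\<lambda>x. 0) has_real_derivative cutoff (Suc n) x) (at x)" by (simp add: cutoff_def)
    then show ?thesis
      by (rule has_field_derivative_transform_within_open[of _ _ _ "{..<0}"]) (use 2 in \<open>auto simp: cutoff_def\<close>)
  next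
    case 3
    have "((\<lambda>y. (cutoff n y - cutoff n 0) / (y - 0)) \<longlongrightarrow> 0) (at_right 0)"
    proof -
      \<comment> \<open>The factor \<open>[:0, 1:]\<close> is the 1/x of the difference quotient at
        0.\<close>
      have "((\<lambda>x. poly ([:0, 1:] * cutoff_poly n) (inverse x) * exp (- inverse x)) \<longlongrightarrow> 0) (at_right (0::real))"
        by (rule filterlim_compose[OF poly_exp_tendsto_0 filterlim_inverse_at_top_right])
      then show ?thesis
        by (rule Lim_transform_eventually)
          (auto simp: eventually_at_filter cutoff_def field_simps)
    qed
    moreover have "((\<lambda>y. (cutoff n y - cutoff n 0) / (y - 0)) \<longlongrightarrow> 0) (at_left 0)"
      by (rule Lim_transform_eventually[OF tendsto_const])
        (auto simp: eventually_at_filter cutoff_def)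
    ultimately show ?thesis
      using 3 by (simp add: has_field_derivative_iff filterlim_split_at cutoff_def[of "Suc n"])
  qed
qed

definition bump :: "real \<Rightarrow> real" where "bump = cutoff 0"

lemma bump_nonneg: "bump x \<ge> 0" and bump_pos_iff: "bump x > 0 \<longleftrightarrow> x > 0" and bump_eq_0_iff: "bump x = 0 \<longleftrightarrow> x \<le> 0"
  by (auto simp: bump_def cutoff_def)

lemma C_k_on_bump:
  "openin (Euclidean_space m) U \<Longrightarrow> C_k_on m k U f \<Longrightarrow> C_k_on m k U (\<lambda>x. bump (f x))"
  unfolding bump_def by (rule C_k_on_compose_real[of _ _ UNIV cutoff]) (auto simp: cutoff_DERIV)

subsection \<open>Lipschitz estimate on boxes\<close>

text \<open>The partial derivatives are bounded on the compact box. Passing from \<open>y\<close> to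
  \<open>x\<close> one coordinate at a time stays in the box, so the mean value estimate in one
  variable applies to each change.\<close>

lemma C_k_on_Lipschitz:
  assumes U: "openin (Euclidean_space m) U" and f: "C_k_on m (Suc 0) U f" and sub: "clbox m q \<epsilon> \<subseteq> U"
  obtains L where "L \<ge> 0"
    "\<And>x y. x \<in> clbox m q \<epsilon> \<Longrightarrow> y \<in> clbox m q \<epsilon> \<Longrightarrow> \<bar>f x - f y\<bar> \<le> L * (\<Sum>i<m. \<bar>x i - y i\<bar>)"
proof -
  let ?K = "clbox m q \<epsilon>"
  have f': "\<And>i x. i < m \<Longrightarrow> x \<in> U \<Longrightarrow> ((\<lambda>t. f (x(i := t))) has_real_derivative pd i f x) (at (x i))"
    "\<And>i. i < m \<Longrightarrow> C_k_on m 0 U (pd i f)"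
    using f unfolding C_k_on_Suc_iff[OF U] by blast+
  have "\<exists>B. \<forall>x\<in>?K. \<bar>pd i f x\<bar> \<le> B" if "i < m" for i
  proof -
    have "continuous_on ?K (pd i f)"
      using C_k_on_continuous_on[OF f'(2)[OF that] openin_subset[OF U]] continuous_on_subset sub by blast
    then have "bounded (pd i f ` ?K)"
      using compact_clbox compact_continuous_image compact_imp_bounded by blast
    then show ?thesis by (auto simp: bounded_iff)
  qed
  then obtain B where B: "\<And>i x. i < m \<Longrightarrow> x \<in> ?K \<Longrightarrow> \<bar>pd i f x\<bar> \<le> B i" by metis
  define L where "L = (\<Sum>i<m. \<bar>B i\<bar>)"
  have BL: "\<bar>B i\<bar> \<le> L" if "i < m" for i
    unfolding L_def using that by (intro member_le_sum) auto
  have "\<bar>f x - f y\<bar> \<le> L * (\<Sum>i<m. \<bar>x i - y i\<bar>)" if x: "x \<in> ?K" and y: "y \<in> ?K" for x y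
  proof -
    define z where "z n = (\<lambda>j. if j < n then x j else y j)" for n
    have step: "\<bar>f (z (Suc n)) - f (z n)\<bar> \<le> L * \<bar>x n - y n\<bar>" if n: "n < m" for n
    proof -
      have mem: "(z n)(n := s) \<in> ?K" if "s \<in> closed_segment (y n) (x n)" for s
      proof -
        have "\<bar>s - q n\<bar> \<le> \<epsilon>"
          using that x y n by (fastforce simp: closed_segment_eq_real_ivl clbox_def abs_le_iff split: if_splits)
        then show ?thesis using x y n by (auto simp: clbox_def z_def)
      qed
      have "norm (f ((z n)(n := x n)) - f ((z n)(n := y n))) \<le> L * norm (x n - y n)"
      proof (rule field_differentiable_bound[of "closed_segment (y n) (x n)"])
        fix s assume s: "s \<in> closed_segment (y n) (x n)"
        have m: "(z n)(n := s) \<in> ?K" by (rule mem[OF s])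
        have "((\<lambda>t. f (((z n)(n := s))(n := t))) has_real_derivative pd n f ((z n)(n := s))) (at (((z n)(n := s)) n))"
          using f'(1)[OF n] sub m by blast
        then show "((\<lambda>t. f ((z n)(n := t))) has_field_derivative pd n f ((z n)(n := s)))
            (at s within closed_segment (y n) (x n))"
          by (simp add: has_field_derivative_at_within)
        show "norm (pd n f ((z n)(n := s))) \<le> L"
          using B[OF n m] BL[OF n] by simp
      qed auto
      moreover have "(z n)(n := x n) = z (Suc n)" "(z n)(n := y n) = z n"
        by (auto simp: z_def fun_eq_iff less_Suc_eq)
      ultimately show ?thesis by simp
    qed
    have "\<bar>f (z n) - f (z 0)\<bar> \<le> L * (\<Sum>i<n. \<bar>x i - y i\<bar>)" if "n \<le> m" for n
      using that
    proof (induction n)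
      case (Suc n)
      then show ?case using step[of n] by (simp add: distrib_left)
    qed simp
    moreover have "z m = x" "z 0 = y" using x y by (auto simp: z_def clbox_def fun_eq_iff)
    ultimately show ?thesis by auto
  qed
  moreover have "L \<ge> 0" by (simp add: L_def sum_nonneg)
  ultimately show ?thesis using that by blast
qed

section \<open>Generic levels\<close>

text \<open>With \<open>N ^ m\<close> pieces of size \<open>1 / N\<close>, the image of \<open>K n\<close> under any \<open>m + 1\<close> of the functions is
  a null set in \<open>\<real>\<^bsup>m+1\<^esup>\<close>; independent uniform levels avoid the countably many such images.\<close>

lemma exists_generic_levels:
  fixes h :: "nat \<Rightarrow> 'p \<Rightarrow> real" and K :: "nat \<Rightarrow> 'p set" and m :: nat
  assumes pieces: "\<And>n ks. \<exists>L\<ge>0. \<forall>N>0. \<exists>P. finite P \<and> card P \<le> N ^ m \<and> K n \<subseteq> \<Union>P \<and>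
      (\<forall>Q\<in>P. \<forall>p\<in>Q. \<forall>q\<in>Q. \<forall>s\<le>m. \<bar>h (ks ! s) p - h (ks ! s) q\<bar> \<le> L / real N)"
  obtains t :: "nat \<times> nat \<Rightarrow> real" where "\<And>s k. t (s, k) \<in> {0..1}"
    and "\<And>n p. p \<in> K n \<Longrightarrow> \<exists>s\<le>m. \<forall>k. h k p \<noteq> t (s, k)"
proof -
  define \<mu> where "\<mu> = uniform_measure lborel {0..1::real}"
  have prob_\<mu>: "prob_space \<mu>"
    unfolding \<mu>_def by (rule prob_space_uniform_measure) auto
  interpret M: product_prob_space "\<lambda>_::nat \<times> nat. \<mu>" UNIV
    by (simp add: product_prob_space_def product_prob_space_axioms_def product_sigma_finite_def
        prob_\<mu> prob_space_imp_sigma_finite)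
  let ?\<Pi> = "PiM UNIV (\<lambda>_::nat \<times> nat. \<mu>)"
  have sets_\<mu>: "sets \<mu> = sets borel" by (simp add: \<mu>_def)
  have measure_\<mu>: "measure \<mu> {a..b} \<le> b - a" if "a \<le> b" for a b
  proof -
    have "emeasure \<mu> {a..b} = emeasure lborel ({0..1} \<inter> {a..b})" by (simp add: \<mu>_def divide_ennreal_def)
    also have "\<dots> \<le> emeasure lborel {a..b}" by (intro emeasure_mono) auto
    also have "\<dots> = ennreal (b - a)" using that by simp
    finally show ?thesis
      using that by (simp add: measure_def enn2real_leI)
  qed
  have space: "space \<mu> = UNIV" by (simp add: \<mu>_def)
  \<comment> \<open>All colours fail at one point, colour \<open>s\<close> at the index
    \<open>ks ! s\<close>. Lists are countable, so the bad sets for all \<open>n\<close> and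
    \<open>ks\<close> form a countable family.\<close>
  define bad where "bad n ks = {t. \<exists>p\<in>K n. \<forall>s\<le>m. t (s, ks ! s) = h (ks ! s) p}" for n ks
  have bad: "AE t in ?\<Pi>. t \<notin> bad n ks" for n ks
  proof -
    obtain L where L: "L \<ge> 0" "\<And>N. N > 0 \<Longrightarrow> \<exists>P. finite P \<and> card P \<le> N ^ m \<and> K n \<subseteq> \<Union>P \<and>
      (\<forall>Q\<in>P. \<forall>p\<in>Q. \<forall>q\<in>Q. \<forall>s\<le>m. \<bar>h (ks ! s) p - h (ks ! s) q\<bar> \<le> L / real N)"
      using pieces by metis
    \<comment> \<open>The pairs are distinct by their first components even if \<open>ks\<close> has
      repetitions: \<open>m + 1\<close> independent levels are involved.\<close>
    define J where "J = (\<lambda>s. (s, ks ! s)) ` {..m}"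
    have J: "finite J" "card J = Suc m"
      unfolding J_def by (auto simp: card_image inj_on_def)
    \<comment> \<open>There are at most N^m pieces, each forcing \<open>m + 1\<close> levels into
      intervals of length 2L/N. The total measure is at most N^m (2L/N)^(m+1), and the surplus
      exponent leaves the factor 1/N.\<close>
    have "\<exists>A\<in>sets ?\<Pi>. bad n ks \<subseteq> A \<and> measure ?\<Pi> A \<le> (2 * L) ^ Suc m / real N" if N: "N > 0" for N
    proof -
      from L(2)[OF N] obtain P where P0: "finite P \<and> card P \<le> N ^ m \<and> K n \<subseteq> \<Union>P \<and>
        (\<forall>Q\<in>P. \<forall>p\<in>Q. \<forall>q\<in>Q. \<forall>s\<le>m. \<bar>h (ks ! s) p - h (ks ! s) q\<bar> \<le> L / real N)" by (rule exE)
      then have P: "finite P" "card P \<le> N ^ m" "K n \<subseteq> \<Union>P" by simp_all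
      have PL: "\<bar>h (ks ! s) p - h (ks ! s) q\<bar> \<le> L / real N"
        if "Q \<in> P" "p \<in> Q" "q \<in> Q" "s \<le> m" for Q p q s
        using P0 that by simp
      define c where "c Q = (SOME p. p \<in> Q)" for Q :: "'p set"
      define I where "I Q j = {h (snd j) (c Q) - L / N .. h (snd j) (c Q) + L / N}" for Q and j :: "nat \<times> nat"
      define B where "B Q = {t \<in> space ?\<Pi>. \<forall>j\<in>J. t j \<in> I Q j}" for Q
      have B_emb: "B Q = prod_emb UNIV (\<lambda>_. \<mu>) J (PiE J (I Q))" for Q
        unfolding B_def prod_emb_def space_PiM using restrict_PiE_iff[of _ J "I Q"] by blast
      have B_sets: "B Q \<in> sets ?\<Pi>" for Q
        unfolding B_emb using J(1) by (intro sets_PiM_I) (auto simp: sets_\<mu> I_def)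
      have B_measure: "measure ?\<Pi> (B Q) \<le> (2 * L / N) ^ Suc m" for Q
      proof -
        have "measure ?\<Pi> (B Q) = (\<Prod>j\<in>J. measure \<mu> (I Q j))"
          unfolding B_emb using J(1) by (intro M.measure_PiM_emb) (auto simp: sets_\<mu> I_def)
        also have "\<dots> \<le> (\<Prod>j\<in>J. 2 * L / N)"
        proof (rule prod_mono)
          fix j
          have "L / N \<ge> 0" using L(1) by simp
          then show "0 \<le> measure \<mu> (I Q j) \<and> measure \<mu> (I Q j) \<le> 2 * L / N"
            using measure_\<mu>[of "h (snd j) (c Q) - L / N" "h (snd j) (c Q) + L / N"]
            by (simp add: I_def)
        qed
        finally show ?thesis using J(2) by simp
      qed
      have "bad n ks \<subseteq> (\<Union>Q\<in>P. B Q)"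
      proof
        fix t assume "t \<in> bad n ks"
        then obtain p where p: "p \<in> K n" "\<And>s. s \<le> m \<Longrightarrow> t (s, ks ! s) = h (ks ! s) p"
          by (auto simp: bad_def)
        then obtain Q where Q: "Q \<in> P" "p \<in> Q" using P(3) by blast
        then have "c Q \<in> Q" unfolding c_def by (metis someI)
        then have "t \<in> B Q"
          using PL[OF Q(1,2)] p(2)
          by (auto simp: B_def space space_PiM J_def I_def abs_le_iff algebra_simps)
        then show "t \<in> (\<Union>Q\<in>P. B Q)" using Q by blast
      qed
      moreover have "measure ?\<Pi> (\<Union>Q\<in>P. B Q) \<le> (2 * L) ^ Suc m / real N"
      proof -
        have "measure ?\<Pi> (\<Union>Q\<in>P. B Q) \<le> (\<Sum>Q\<in>P. measure ?\<Pi> (B Q))"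
          using P(1) B_sets by (intro M.finite_measure_subadditive_finite) auto
        also have "\<dots> \<le> (\<Sum>Q\<in>P. (2 * L / N) ^ Suc m)" by (intro sum_mono B_measure)
        also have "\<dots> = real (card P) * (2 * L / N) ^ Suc m" by simp
        also have "\<dots> \<le> real (N ^ m) * (2 * L / N) ^ Suc m"
          using P(2) L(1) by (intro mult_right_mono of_nat_mono) auto
        also have "\<dots> = (2 * L) ^ Suc m / real N"
          using N by (simp add: power_divide)
        finally show ?thesis .
      qed
      ultimately show ?thesis using B_sets P(1) by (intro bexI[of _ "\<Union>Q\<in>P. B Q"]) auto
    qed
    then obtain A where A: "\<And>N. N > 0 \<Longrightarrow> A N \<in> sets ?\<Pi>" "\<And>N. N > 0 \<Longrightarrow> bad n ks \<subseteq> A N"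
      "\<And>N::nat. N > 0 \<Longrightarrow> measure ?\<Pi> (A N) \<le> (2 * L) ^ Suc m / real N" by metis
    \<comment> \<open>Measurability of \<open>bad n ks\<close> itself is not established; it is
      enclosed in a measurable null set.\<close>
    define A' where "A' = (\<Inter>N. A (Suc N))"
    have A'_sets: "A' \<in> sets ?\<Pi>" unfolding A'_def using A(1) by (intro sets.countable_INT) auto
    have "measure ?\<Pi> A' \<le> (2 * L) ^ Suc m / real (Suc N)" for N
      using M.finite_measure_mono[of A' "A (Suc N)"] A(1)[of "Suc N"] A(3)[of "Suc N"]
      by (auto simp: A'_def intro: order_trans)
    moreover have "(\<lambda>N. (2 * L) ^ Suc m / real (Suc N)) \<longlonglongrightarrow> 0"
      by (rule LIMSEQ_Suc) (rule lim_const_over_n)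
    ultimately have "measure ?\<Pi> A' \<le> 0" by (intro LIMSEQ_le_const) auto
    then have "A' \<in> null_sets ?\<Pi>"
      using A'_sets by (simp add: null_sets_def M.emeasure_eq_measure measure_le_0_iff)
    moreover have "bad n ks \<subseteq> A'" using A(2) by (auto simp: A'_def)
    ultimately show ?thesis by (intro AE_I'[of A']) auto
  qed
  have range: "AE t in ?\<Pi>. t j \<in> {0..1}" for j
  proof -
    have "AE x in \<mu>. x \<in> {0..1}" unfolding \<mu>_def by (rule AE_uniform_measureI) auto
    then show ?thesis by (intro AE_PiM_component) (auto simp: prob_\<mu>)
  qed
  have "AE t in ?\<Pi>. (\<forall>n ks. t \<notin> bad n ks) \<and> (\<forall>j. t j \<in> {0..1})"
    using bad range by (simp add: AE_all_countable AE_conj_iff)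
  then obtain t where t: "\<And>n ks. t \<notin> bad n ks" "\<And>j. t j \<in> {0..1}"
    using eventually_happens'[OF M.ae_filter_bot] by blast
  have "\<exists>s\<le>m. \<forall>k. h k p \<noteq> t (s, k)" if p: "p \<in> K n" for n p
  proof (rule ccontr)
    assume "\<not> ?thesis"
    then obtain \<kappa> where \<kappa>: "\<And>s. s \<le> m \<Longrightarrow> h (\<kappa> s) p = t (s, \<kappa> s)" by metis
    have "map \<kappa> [0..<Suc m] ! s = \<kappa> s" if "s \<le> m" for s
      using that by (subst nth_map) (auto simp del: upt_Suc)
    then have "t \<in> bad n (map \<kappa> [0..<Suc m])"
      using p \<kappa> by (auto simp: bad_def simp del: upt_Suc intro!: bexI[of _ p])
    then show False using t by blast
  qed
  then show ?thesis using t(2) that by blast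
qed

section \<open>Smooth functions on a manifold\<close>

lemma smooth_on_C_k_on: "smooth_on m U f \<Longrightarrow> C_k_on m k U f"
  by (simp add: smooth_on_def)

lemma smooth_on_const: "smooth_on m U (\<lambda>x. c)"
  by (simp add: smooth_on_def C_k_on_const del: C_k_on.simps)

lemma smooth_on_add: "smooth_on m U f \<Longrightarrow> smooth_on m U g \<Longrightarrow> smooth_on m U (\<lambda>x. f x + g x)"
  by (simp add: smooth_on_def C_k_on_add del: C_k_on.simps)

lemma smooth_on_mult: "smooth_on m U f \<Longrightarrow> smooth_on m U g \<Longrightarrow> smooth_on m U (\<lambda>x. f x * g x)"
  by (simp add: smooth_on_def C_k_on_mult del: C_k_on.simps)

lemma smooth_on_diff: "smooth_on m U f \<Longrightarrow> smooth_on m U g \<Longrightarrow> smooth_on m U (\<lambda>x. f x - g x)"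
  using smooth_on_add[of m U f "\<lambda>x. -1 * g x"] smooth_on_mult[OF smooth_on_const, of m U g "-1"] by simp

lemma smooth_on_sum: "(\<And>i. i \<in> I \<Longrightarrow> smooth_on m U (f i)) \<Longrightarrow> smooth_on m U (\<lambda>x. \<Sum>i\<in>I. f i x)"
  by (simp add: smooth_on_def C_k_on_sum del: C_k_on.simps)

lemma smooth_on_prod: "(\<And>i. i \<in> I \<Longrightarrow> smooth_on m U (f i)) \<Longrightarrow> smooth_on m U (\<lambda>x. \<Prod>i\<in>I. f i x)"
  by (simp add: smooth_on_def C_k_on_prod del: C_k_on.simps)

lemma smooth_on_coord: "openin (Euclidean_space m) U \<Longrightarrow> smooth_on m U (\<lambda>x. x i)"
  by (simp add: smooth_on_def C_k_on_coord del: C_k_on.simps)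

lemma smooth_on_bump: "openin (Euclidean_space m) U \<Longrightarrow> smooth_on m U f \<Longrightarrow> smooth_on m U (\<lambda>x. bump (f x))"
  by (simp add: smooth_on_def C_k_on_bump del: C_k_on.simps)

lemma smooth_on_subset: "smooth_on m U f \<Longrightarrow> V \<subseteq> U \<Longrightarrow> smooth_on m V f"
  unfolding smooth_on_def using C_k_on_subset by blast

lemma smooth_on_cong:
  "openin (Euclidean_space m) U \<Longrightarrow> smooth_on m U f \<Longrightarrow> (\<And>x. x \<in> U \<Longrightarrow> f x = g x) \<Longrightarrow> smooth_on m U g"
  unfolding smooth_on_def using C_k_on_cong by blast

lemma smooth_on_DERIV:
  "openin (Euclidean_space m) U \<Longrightarrow> smooth_on m U f \<Longrightarrow> i < m \<Longrightarrow> x \<in> U \<Longrightarrow>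
    ((\<lambda>t. f (x(i := t))) has_real_derivative pd i f x) (at (x i))"
  unfolding smooth_on_def using C_k_on_Suc_iff by blast

lemma smooth_on_pd:
  "openin (Euclidean_space m) U \<Longrightarrow> smooth_on m U f \<Longrightarrow> i < m \<Longrightarrow> smooth_on m U (pd i f)"
  unfolding smooth_on_def using C_k_on_Suc_iff by blast

lemma pd_add:
  assumes "openin (Euclidean_space m) U" "smooth_on m U f" "smooth_on m U g" "i < m" "x \<in> U"
  shows "pd i (\<lambda>x. f x + g x) x = pd i f x + pd i g x"
  using assms by (intro pd_eqI DERIV_add smooth_on_DERIV[of m U])

lemma pd_mult:
  assumes "openin (Euclidean_space m) U" "smooth_on m U f" "smooth_on m U g" "i < m" "x \<in> U"
  shows "pd i (\<lambda>x. f x * g x) x = pd i f x * g x + f x * pd i g x"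
  using DERIV_mult[OF smooth_on_DERIV[OF assms(1,2,4,5)] smooth_on_DERIV[OF assms(1,3,4,5)]]
  by (intro pd_eqI) (simp add: algebra_simps)

lemma pd_const: "pd i (\<lambda>x. c) x = 0"
  by (intro pd_eqI) simp

lemma pd_coord: "pd l (\<lambda>x. x i) x = (if l = i then 1 else 0)"
  by (intro pd_eqI) (auto intro!: derivative_eq_intros)

section \<open>Bump functions on boxes\<close>

definition box_bump :: "nat \<Rightarrow> (nat \<Rightarrow> real) \<Rightarrow> real \<Rightarrow> (nat \<Rightarrow> real) \<Rightarrow> real" where
  "box_bump m q \<epsilon> x = (\<Prod>i<m. bump (\<epsilon> - (x i - q i)) * bump (\<epsilon> + (x i - q i)))"

lemma smooth_on_box_bump: "openin (Euclidean_space m) U \<Longrightarrow> smooth_on m U (box_bump m q \<epsilon>)"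
  unfolding box_bump_def[abs_def]
  by (intro smooth_on_prod smooth_on_mult smooth_on_bump smooth_on_add smooth_on_diff smooth_on_const smooth_on_coord)

lemma box_bump_center: "\<epsilon> > 0 \<Longrightarrow> box_bump m q \<epsilon> q > 0"
  by (simp add: box_bump_def prod_pos bump_pos_iff)

lemma box_bump_outside: "x \<in> Rn m \<Longrightarrow> x \<notin> clbox m q \<epsilon> \<Longrightarrow> box_bump m q \<epsilon> x = 0"
proof -
  assume "x \<in> Rn m" "x \<notin> clbox m q \<epsilon>"
  then obtain i where "i < m" "\<not> \<bar>x i - q i\<bar> \<le> \<epsilon>" by (auto simp: clbox_def Rn_iff)
  then have "\<exists>i\<in>{..<m}. bump (\<epsilon> - (x i - q i)) * bump (\<epsilon> + (x i - q i)) = 0"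
    by (intro bexI[of _ i]) (auto simp: bump_eq_0_iff)
  then show "box_bump m q \<epsilon> x = 0" by (simp add: box_bump_def)
qed

context smooth_manifold
begin

text \<open>No normalisation outside \<open>topspace M\<close>, so that nonzero constants are always
  smooth.\<close>

definition smooth :: "('p \<Rightarrow> real) \<Rightarrow> bool" where
  "smooth f \<longleftrightarrow> (\<forall>U \<phi>. (U, \<phi>) \<in> \<A> \<longrightarrow> smooth_on m (\<phi> ` U) (\<lambda>x. f (inv_into U \<phi> x)))"

lemma smooth_functions_iff: "f \<in> smooth_functions m M \<A> \<longleftrightarrow> smooth f \<and> (\<forall>p. p \<notin> topspace M \<longrightarrow> f p = 0)"
  by (auto simp: smooth_functions_def smooth_def)

lemma smoothD: "smooth f \<Longrightarrow> (U, \<phi>) \<in> \<A> \<Longrightarrow> smooth_on m (\<phi> ` U) (\<lambda>x. f (inv_into U \<phi> x))"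
  by (auto simp: smooth_def)

section \<open>Charts\<close>

lemma chart_open: "(U, \<phi>) \<in> \<A> \<Longrightarrow> openin M U"
  and chart_image_open: "(U, \<phi>) \<in> \<A> \<Longrightarrow> openin (Euclidean_space m) (\<phi> ` U)"
  and chart_homeo: "(U, \<phi>) \<in> \<A> \<Longrightarrow>
    homeomorphic_map (subtopology M U) (subtopology (Euclidean_space m) (\<phi> ` U)) \<phi>"
  using chart by blast+

lemma chart_subset: "(U, \<phi>) \<in> \<A> \<Longrightarrow> U \<subseteq> topspace M"
  using chart_open openin_subset by blast

lemma chart_topspace: "(U, \<phi>) \<in> \<A> \<Longrightarrow> topspace (subtopology M U) = U"
  using chart_subset by auto

lemma chart_inj: "(U, \<phi>) \<in> \<A> \<Longrightarrow> inj_on \<phi> U"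
  using homeomorphic_imp_injective_map[OF chart_homeo] chart_topspace by metis

lemma chart_inv: "(U, \<phi>) \<in> \<A> \<Longrightarrow> p \<in> U \<Longrightarrow> inv_into U \<phi> (\<phi> p) = p"
  by (simp add: chart_inj)

lemma chart_image_Rn: "(U, \<phi>) \<in> \<A> \<Longrightarrow> p \<in> U \<Longrightarrow> \<phi> p \<in> Rn m"
  using openin_subset[OF chart_image_open] by blast

lemma chart_exists: "p \<in> topspace M \<Longrightarrow> \<exists>U \<phi>. (U, \<phi>) \<in> \<A> \<and> p \<in> U"
  unfolding covers[symmetric] by auto

lemma chart_image_openin:
  assumes "(U, \<phi>) \<in> \<A>" "openin M W" "W \<subseteq> U"
  shows "openin (Euclidean_space m) (\<phi> ` W)"
proof -
  have "openin (subtopology M U) W" using assms(2,3) by (simp add: openin_subset_topspace_eq openin_subtopology) blast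
  then have "openin (subtopology (Euclidean_space m) (\<phi> ` U)) (\<phi> ` W)"
    using homeomorphic_imp_open_map[OF chart_homeo[OF assms(1)]] by (simp add: open_map_def)
  then show ?thesis
    using openin_trans_full chart_image_open[OF assms(1)] by blast
qed

lemma chart_preimage_openin:
  assumes "(U, \<phi>) \<in> \<A>" "openin (Euclidean_space m) B"
  shows "openin M {p \<in> U. \<phi> p \<in> B}"
proof -
  have "continuous_map (subtopology M U) (Euclidean_space m) \<phi>"
    using homeomorphic_imp_continuous_map[OF chart_homeo[OF assms(1)]]
    by (simp add: continuous_map_in_subtopology)
  from openin_continuous_map_preimage[OF this assms(2)]
  have "openin (subtopology M U) {p \<in> U. \<phi> p \<in> B}" 
    unfolding chart_topspace[OF assms(1)] .
  then show ?thesis using openin_trans_full chart_open[OF assms(1)] by blast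
qed

text \<open>The Hausdorff property enters here: the inverse chart maps \<open>K\<close> to a
  compact, hence closed, subset of the whole of \<open>M\<close>. This is what makes extension by 0
  smooth.\<close>

lemma chart_preimage_closedin:
  assumes "(U, \<phi>) \<in> \<A>" "compact K" "K \<subseteq> \<phi> ` U"
  shows "closedin M {p \<in> U. \<phi> p \<in> K}"
proof -
  let ?E = "subtopology (Euclidean_space m) (\<phi> ` U)"
  obtain \<psi> where \<psi>: "homeomorphic_maps (subtopology M U) ?E \<phi> \<psi>"
    using chart_homeo[OF assms(1)] homeomorphic_map_maps by blast
  have "K \<subseteq> Rn m"
    using assms(3) openin_subset[OF chart_image_open[OF assms(1)]] by (rule order_trans)
  then have "compactin (Euclidean_space m) K"
    using assms(2) by (subst Euclidean_space_eq) (simp add: compactin_subtopology)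
  then have "compactin ?E K" using assms(3) by (simp add: compactin_subtopology)
  then have "compactin (subtopology M U) (\<psi> ` K)"
    using \<psi> image_compactin by (auto simp: homeomorphic_maps_def)
  then have "compactin M (\<psi> ` K)" by (simp add: compactin_subtopology)
  moreover have "\<psi> ` K = {p \<in> U. \<phi> p \<in> K}"
  proof -
    have "\<psi> (\<phi> p) = p" if "p \<in> U" for p
      using \<psi> that chart_topspace[OF assms(1)] unfolding homeomorphic_maps_def by blast
    then show ?thesis using assms(3) by force
  qed
  ultimately show ?thesis using compactin_imp_closedin[OF Hausdorff] by simp
qed

text \<open>One chart around each point suffices: any other chart differs by a smooth transition
  map, so smoothness is transferred by composition.\<close>

lemma smooth_chart_local:
  assumes loc: "\<And>p. p \<in> topspace M \<Longrightarrow> \<exists>W U \<phi>. openin M W \<and> p \<in> W \<and> (U, \<phi>) \<in> \<A> \<and> W \<subseteq> U \<and>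
      smooth_on m (\<phi> ` W) (\<lambda>x. f (inv_into U \<phi> x))"
  shows "smooth f"
proof -
  have "C_k_on m k (\<psi> ` V) (\<lambda>x. f (inv_into V \<psi> x))" if V: "(V, \<psi>) \<in> \<A>" for V \<psi> k
  proof (rule C_k_on_local[OF chart_image_open[OF V]])
    fix x assume "x \<in> \<psi> ` V"
    then obtain p where p: "p \<in> V" "x = \<psi> p" by blast
    then obtain W U \<phi> where W: "openin M W" "p \<in> W" "(U, \<phi>) \<in> \<A>" "W \<subseteq> U"
      "smooth_on m (\<phi> ` W) (\<lambda>x. f (inv_into U \<phi> x))"
      using loc[of p] chart_subset[OF V] by blast
    define N where "N = \<psi> ` (W \<inter> V)"
    have N: "openin (Euclidean_space m) N"
      unfolding N_def using W(1) chart_open[OF V] by (intro chart_image_openin[OF V] openin_Int) auto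
    have inv: "inv_into V \<psi> y \<in> W \<inter> V" if "y \<in> N" for y
      using that chart_inv[OF V] by (auto simp: N_def)
    have "C_k_on m k N (\<lambda>y. f (inv_into U \<phi> (\<phi> (inv_into V \<psi> y))))"
    proof (rule C_k_on_compose[OF N chart_image_openin[OF W(3,1,4)],
        where F = "\<lambda>x. f (inv_into U \<phi> x)" and \<Phi> = "\<lambda>y. \<phi> (inv_into V \<psi> y)"])
      show "\<phi> (inv_into V \<psi> y) \<in> \<phi> ` W" if "y \<in> N" for y using inv[OF that] by blast
      show "C_k_on m k (\<phi> ` W) (\<lambda>x. f (inv_into U \<phi> x))" using W(5) by (rule smooth_on_C_k_on)
      show "C_k_on m k N (\<lambda>y. \<phi> (inv_into V \<psi> y) l)" if "l < m" for l
        using compatible[OF V W(3) that] W(4)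
        by (intro C_k_on_subset[OF smooth_on_C_k_on]) (auto simp: N_def)
    qed
    then have "C_k_on m k N (\<lambda>x. f (inv_into V \<psi> x))"
      by (rule C_k_on_cong[OF N, rotated]) (use inv W(4) chart_inv[OF W(3)] in \<open>simp add: subset_iff\<close>)
    then show "\<exists>N. openin (Euclidean_space m) N \<and> x \<in> N \<and> C_k_on m k N (\<lambda>x. f (inv_into V \<psi> x))"
      using N p W(2) by (auto simp: N_def)
  qed
  then show ?thesis by (auto simp: smooth_def smooth_on_def)
qed

lemma smooth_local:
  assumes loc: "\<And>p. p \<in> topspace M \<Longrightarrow> \<exists>W g. openin M W \<and> p \<in> W \<and> smooth g \<and> (\<forall>q\<in>W. f q = g q)"
  shows "smooth f"
proof (rule smooth_chart_local)
  fix p assume p: "p \<in> topspace M"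
  then obtain W g where W: "openin M W" "p \<in> W" "smooth g" "\<forall>q\<in>W. f q = g q" using loc by blast
  obtain U \<phi> where U: "(U, \<phi>) \<in> \<A>" "p \<in> U" using chart_exists[OF p] by blast
  have WU: "openin M (W \<inter> U)" using W(1) chart_open[OF U(1)] by blast
  have "smooth_on m (\<phi> ` (W \<inter> U)) (\<lambda>x. g (inv_into U \<phi> x))"
    by (rule smooth_on_subset[OF smoothD[OF W(3) U(1)]]) auto
  then have "smooth_on m (\<phi> ` (W \<inter> U)) (\<lambda>x. f (inv_into U \<phi> x))"
    by (rule smooth_on_cong[OF chart_image_openin[OF U(1) WU], rotated])
      (use W(4) chart_inv[OF U(1)] in auto)
  then show "\<exists>W U \<phi>. openin M W \<and> p \<in> W \<and> (U, \<phi>) \<in> \<A> \<and> W \<subseteq> U \<and>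
      smooth_on m (\<phi> ` W) (\<lambda>x. f (inv_into U \<phi> x))"
    using WU W(2) U by (intro exI[of _ "W \<inter> U"] exI[of _ U] exI[of _ \<phi>]) simp
qed

section \<open>Algebra, continuity and extension of smooth functions on the manifold\<close>

lemma smooth_const: "smooth (\<lambda>p. c)"
  by (auto simp: smooth_def smooth_on_const)

lemma smooth_add: "smooth f \<Longrightarrow> smooth g \<Longrightarrow> smooth (\<lambda>p. f p + g p)"
  by (auto simp: smooth_def smooth_on_add)

lemma smooth_mult: "smooth f \<Longrightarrow> smooth g \<Longrightarrow> smooth (\<lambda>p. f p * g p)"
  by (auto simp: smooth_def smooth_on_mult)

lemma smooth_diff: "smooth f \<Longrightarrow> smooth g \<Longrightarrow> smooth (\<lambda>p. f p - g p)"
  using smooth_add[of f "\<lambda>p. -1 * g p"] smooth_mult[OF smooth_const, of g "-1"] by simp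

lemma smooth_sum: "(\<And>i. i \<in> I \<Longrightarrow> smooth (f i)) \<Longrightarrow> smooth (\<lambda>p. \<Sum>i\<in>I. f i p)"
  by (induction I rule: infinite_finite_induct) (auto simp: smooth_const smooth_add)

lemma smooth_prod: "(\<And>i. i \<in> I \<Longrightarrow> smooth (f i)) \<Longrightarrow> smooth (\<lambda>p. \<Prod>i\<in>I. f i p)"
  by (induction I rule: infinite_finite_induct) (auto simp: smooth_const smooth_mult)

lemma smooth_bump: "smooth f \<Longrightarrow> smooth (\<lambda>p. bump (f p))"
  unfolding smooth_def using smooth_on_bump chart_image_open by fastforce

lemma smooth_inverse:
  assumes "smooth f" "\<And>p. p \<in> topspace M \<Longrightarrow> f p \<noteq> 0"
  shows "smooth (\<lambda>p. inverse (f p))"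
proof -
  have "smooth_on m (\<phi> ` U) (\<lambda>x. inverse (f (inv_into U \<phi> x)))" if U: "(U, \<phi>) \<in> \<A>" for U \<phi>
    unfolding smooth_on_def
  proof
    fix k
    show "C_k_on m k (\<phi> ` U) (\<lambda>x. inverse (f (inv_into U \<phi> x)))"
    proof (rule C_k_on_inverse[OF chart_image_open[OF U] _ smooth_on_C_k_on[OF smoothD[OF assms(1) U]]])
      show "f (inv_into U \<phi> x) \<noteq> 0" if "x \<in> \<phi> ` U" for x
        using assms(2) chart_subset[OF U] inv_into_into[OF that] by blast
    qed
  qed
  then show ?thesis by (auto simp: smooth_def)
qed

lemma smooth_continuous_map: "smooth f \<Longrightarrow> continuous_map M euclideanreal f"
proof -
  assume f: "smooth f"
  have "openin M {p \<in> topspace M. f p \<in> T}" if T: "open T" for T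
  proof (subst openin_subopen, clarsimp)
    fix p assume p: "p \<in> topspace M" "f p \<in> T"
    obtain U \<phi> where U: "(U, \<phi>) \<in> \<A>" "p \<in> U" using chart_exists[OF p(1)] by blast
    have "continuous_map (subtopology (Euclidean_space m) (\<phi> ` U)) euclideanreal (\<lambda>x. f (inv_into U \<phi> x))"
      using C_k_on_continuous[OF smooth_on_C_k_on[OF smoothD[OF f U(1)], of 0]] .
    then have "continuous_map (subtopology M U) euclideanreal ((\<lambda>x. f (inv_into U \<phi> x)) \<circ> \<phi>)"
      using continuous_map_compose homeomorphic_imp_continuous_map[OF chart_homeo[OF U(1)]] by blast
    from openin_continuous_map_preimage[OF this, of T] T
    have "openin (subtopology M U) {q \<in> U. f (inv_into U \<phi> (\<phi> q)) \<in> T}"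
      unfolding chart_topspace[OF U(1)] by simp
    then have "openin M {q \<in> U. f (inv_into U \<phi> (\<phi> q)) \<in> T}"
      using openin_trans_full chart_open[OF U(1)] by blast
    moreover have "{q \<in> U. f (inv_into U \<phi> (\<phi> q)) \<in> T} = {q \<in> U. f q \<in> T}"
      using chart_inv[OF U(1)] by auto
    ultimately show "\<exists>W. openin M W \<and> p \<in> W \<and> W \<subseteq> {p \<in> topspace M. f p \<in> T}"
      using U p chart_subset[OF U(1)] by (intro exI[of _ "{q \<in> U. f q \<in> T}"]) auto
  qed
  then show ?thesis by (simp add: continuous_map_def)
qed

lemma smooth_openin: "smooth f \<Longrightarrow> open T \<Longrightarrow> openin M {p \<in> topspace M. f p \<in> T}"
  using openin_continuous_map_preimage[OF smooth_continuous_map] by force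

text \<open>The points of \<open>U\<close> over \<open>B\<close> and the complement of the closed
  preimage of \<open>K\<close> form an open cover; \<open>f\<close> is \<open>g\<close> in the chart
  on the former and 0 on the latter. A separate \<open>B\<close> serves functions defined only on a
  box inside the chart image.\<close>

lemma smooth_extend:
  assumes U: "(U, \<phi>) \<in> \<A>" and B: "openin (Euclidean_space m) B" "B \<subseteq> \<phi> ` U"
    and K: "compact K" "K \<subseteq> B" and g: "smooth_on m B g" "\<And>x. x \<in> B \<Longrightarrow> x \<notin> K \<Longrightarrow> g x = 0"
    and f: "\<And>p. p \<in> U \<Longrightarrow> \<phi> p \<in> B \<Longrightarrow> f p = g (\<phi> p)" "\<And>p. \<not> (p \<in> U \<and> \<phi> p \<in> K) \<Longrightarrow> f p = 0"
  shows "smooth f"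
proof (rule smooth_chart_local)
  fix p assume p: "p \<in> topspace M"
  show "\<exists>W U \<phi>. openin M W \<and> p \<in> W \<and> (U, \<phi>) \<in> \<A> \<and> W \<subseteq> U \<and>
      smooth_on m (\<phi> ` W) (\<lambda>x. f (inv_into U \<phi> x))"
  proof (cases "p \<in> U \<and> \<phi> p \<in> B")
    case True
    let ?W = "{p \<in> U. \<phi> p \<in> B}"
    have W: "openin M ?W" using chart_preimage_openin[OF U B(1)] .
    have "\<phi> ` ?W \<subseteq> B" by blast
    with g(1) have "smooth_on m (\<phi> ` ?W) g" by (rule smooth_on_subset)
    then have "smooth_on m (\<phi> ` ?W) (\<lambda>x. f (inv_into U \<phi> x))"
      by (rule smooth_on_cong[OF chart_image_openin[OF U W], rotated])
        (use f(1) chart_inv[OF U] in auto)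
    then show ?thesis using W True U by (intro exI[of _ ?W] exI[of _ U] exI[of _ \<phi>]) auto
  next
    case False
    obtain V \<psi> where V: "(V, \<psi>) \<in> \<A>" "p \<in> V" using chart_exists[OF p] by blast
    let ?W = "V - {p \<in> U. \<phi> p \<in> K}"
    have W: "openin M ?W"
      using chart_open[OF V(1)] chart_preimage_closedin[OF U K(1)] K(2) B(2)
      by (intro openin_diff) auto
    have f0: "f q = 0" if "q \<in> ?W" for q by (rule f(2)) (use that in blast)
    have f0inv: "f (inv_into V \<psi> x) = 0" if x: "x \<in> \<psi> ` ?W" for x
    proof -
      obtain q where q: "q \<in> ?W" "x = \<psi> q" using x by blast
      then have "inv_into V \<psi> x = q" using chart_inv[OF V(1), of q] by simp
      then show ?thesis using f0[OF q(1)] by simp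
    qed
    have "smooth_on m (\<psi> ` ?W) (\<lambda>x. f (inv_into V \<psi> x))"
      by (rule smooth_on_cong[OF chart_image_openin[OF V(1) W] smooth_on_const[of _ _ 0]])
        (blast, rule f0inv[symmetric])
    then show ?thesis using W V False K(2) by (intro exI[of _ ?W] exI[of _ V] exI[of _ \<psi>]) auto
  qed
qed

lemma smooth_suminf:
  assumes "\<And>k. smooth (F k)"
    and "\<And>p. p \<in> topspace M \<Longrightarrow> \<exists>W n. openin M W \<and> p \<in> W \<and> (\<forall>q\<in>W. \<forall>k\<ge>n. F k q = (0::real))"
  shows "smooth (\<lambda>p. \<Sum>k. F k p)"
proof (rule smooth_local)
  fix p assume p: "p \<in> topspace M"
  obtain W n where W: "openin M W" "p \<in> W" "\<forall>q\<in>W. \<forall>k\<ge>n. F k q = 0"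
    using assms(2)[OF p] by (elim exE conjE)
  have "(\<Sum>k. F k q) = (\<Sum>k<n. F k q)" if "q \<in> W" for q
    using W(3) that by (intro suminf_finite) auto
  then show "\<exists>W g. openin M W \<and> p \<in> W \<and> smooth g \<and> (\<forall>q\<in>W. (\<Sum>k. F k q) = g q)"
    using W smooth_sum[of "{..<n}" F] assms(1) by (intro exI[of _ W] exI[of _ "\<lambda>q. \<Sum>k<n. F k q"]) simp
qed

subsection \<open>A colouring by finitely many colours\<close>

text \<open>Second countability enters here: by the Lindelof property countably many of the sets
  where a bump exceeds 2 already cover.\<close>

lemma exists_chart_bumps:
  assumes "topspace M \<noteq> {}"
  obtains U :: "nat \<Rightarrow> 'p set" and \<phi> q \<epsilon> and g :: "nat \<Rightarrow> 'p \<Rightarrow> real"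
  where "\<And>k. (U k, \<phi> k) \<in> \<A>" "\<And>k. clbox m (q k) (\<epsilon> k) \<subseteq> \<phi> k ` U k" "\<And>k. 0 < (\<epsilon> k :: real)"
    "\<And>k. smooth (g k)" "\<And>k p. g k p \<noteq> 0 \<Longrightarrow> p \<in> U k \<and> \<phi> k p \<in> clbox m (q k) (\<epsilon> k)"
    "\<And>p. p \<in> topspace M \<Longrightarrow> \<exists>k. g k p > 2"
proof -
  have "\<exists>U \<phi> \<epsilon> g. (U, \<phi>) \<in> \<A> \<and> clbox m (\<phi> p) \<epsilon> \<subseteq> \<phi> ` U \<and> 0 < (\<epsilon> :: real) \<and> smooth g \<and>
      (\<forall>r. g r \<noteq> 0 \<longrightarrow> r \<in> U \<and> \<phi> r \<in> clbox m (\<phi> p) \<epsilon>) \<and> g p > 2" if p: "p \<in> topspace M" for p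
  proof -
    obtain U \<phi> where U: "(U, \<phi>) \<in> \<A>" "p \<in> U" using chart_exists[OF p] by blast
    obtain \<epsilon> where \<epsilon>: "0 < \<epsilon>" "clbox m (\<phi> p) \<epsilon> \<subseteq> \<phi> ` U"
      using openin_Rn_contains_clbox[OF chart_image_open[OF U(1)]] U(2) by blast
    define v where "v = box_bump m (\<phi> p) \<epsilon> (\<phi> p)"
    have v: "v > 0" unfolding v_def by (rule box_bump_center[OF \<epsilon>(1)])
    \<comment> \<open>Normalised to the value 3 at \<open>p\<close>, above the thresholds 1 and 2
      between which \<open>step\<close> falls from 1 to 0.\<close>
    define g where "g r = (if r \<in> U then 3 / v * box_bump m (\<phi> p) \<epsilon> (\<phi> r) else 0)" for r
    have supp: "g r = 0" if "\<not> (r \<in> U \<and> \<phi> r \<in> clbox m (\<phi> p) \<epsilon>)" for r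
      using that box_bump_outside[OF chart_image_Rn[OF U(1)]] by (auto simp: g_def)
    have "smooth g"
    proof (rule smooth_extend[OF U(1) chart_image_open[OF U(1)] order_refl compact_clbox \<epsilon>(2)])
      show "smooth_on m (\<phi> ` U) (\<lambda>x. 3 / v * box_bump m (\<phi> p) \<epsilon> x)"
        by (intro smooth_on_mult smooth_on_const smooth_on_box_bump chart_image_open[OF U(1)])
      show "3 / v * box_bump m (\<phi> p) \<epsilon> x = 0" if "x \<in> \<phi> ` U" "x \<notin> clbox m (\<phi> p) \<epsilon>" for x
        using that chart_image_Rn[OF U(1)] by (auto simp: box_bump_outside)
      show "g r = 3 / v * box_bump m (\<phi> p) \<epsilon> (\<phi> r)" if "r \<in> U" for r using that by (simp add: g_def)
      show "g r = 0" if "\<not> (r \<in> U \<and> \<phi> r \<in> clbox m (\<phi> p) \<epsilon>)" for r using supp[OF that] .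
    qed
    moreover have "g p > 2" using U(2) v by (simp add: g_def v_def)
    ultimately show ?thesis using U(1) \<epsilon> supp by metis
  qed
  then obtain U \<phi> \<epsilon> g where c: "\<And>p. p \<in> topspace M \<Longrightarrow> (U p, \<phi> p) \<in> \<A> \<and>
      clbox m (\<phi> p p) (\<epsilon> p) \<subseteq> \<phi> p ` U p \<and> 0 < (\<epsilon> p :: real) \<and> smooth (g p) \<and>
      (\<forall>r. g p r \<noteq> 0 \<longrightarrow> r \<in> U p \<and> \<phi> p r \<in> clbox m (\<phi> p p) (\<epsilon> p)) \<and> g p p > 2"
    by metis
  define T where "T p = {r \<in> topspace M. g p r \<in> {2<..}}" for p
  have T: "openin M (T p)" if "p \<in> topspace M" for p
    unfolding T_def using c[OF that] by (intro smooth_openin) auto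
  have "Lindelof_space M" by (rule second_countable_imp_Lindelof_space[OF second_countable])
  moreover have "\<forall>V\<in>T ` topspace M. openin M V" using T by blast
  moreover have "\<Union>(T ` topspace M) = topspace M" using c by (auto simp: T_def)
  ultimately obtain \<V> where V: "countable \<V>" "\<V> \<subseteq> T ` topspace M" "\<Union>\<V> = topspace M"
    unfolding Lindelof_space_def by meson
  obtain Z where Z: "Z \<subseteq> topspace M" "countable Z" "\<V> = T ` Z"
    using V(1,2) countable_subset_image[of \<V> T "topspace M"] by blast
  have ne: "Z \<noteq> {}" using Z(3) V(3) assms by (metis Union_empty image_empty)
  \<comment> \<open>The enumeration repeats points when \<open>Z\<close> is finite; a chart may
    recur in the sequence.\<close>
  define z where "z = from_nat_into Z"
  have z: "z k \<in> topspace M" for k using from_nat_into[OF ne] Z(1) by (auto simp: z_def)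
  have cover: "\<exists>k. g (z k) p > 2" if "p \<in> topspace M" for p
  proof -
    have "p \<in> \<Union>(T ` Z)" using that V(3) Z(3) by simp
    then obtain y where y: "y \<in> Z" "p \<in> T y" by (rule UN_E)
    then obtain k where "z k = y" using from_nat_into_surj[OF Z(2)] by (metis z_def)
    then show ?thesis using y(2) by (auto simp: T_def)
  qed
  show ?thesis
    by (rule that[of "\<lambda>k. U (z k)" "\<lambda>k. \<phi> (z k)" "\<lambda>k. \<phi> (z k) (z k)" "\<lambda>k. \<epsilon> (z k)" "\<lambda>k. g (z k)"])
      (use c[OF z] cover in simp_all)
qed

definition step :: "real \<Rightarrow> real" where
  "step x = bump (2 - x) * inverse (bump (2 - x) + bump (x - 1))"

lemma step_low: "x \<le> 1 \<Longrightarrow> step x = 1"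
  using bump_pos_iff[of "2 - x"] bump_eq_0_iff[of "x - 1"] by (simp add: step_def)

lemma step_high: "x \<ge> 2 \<Longrightarrow> step x = 0"
  using bump_eq_0_iff[of "2 - x"] by (simp add: step_def)

lemma smooth_step: "smooth f \<Longrightarrow> smooth (\<lambda>p. step (f p))"
proof -
  assume f: "smooth f"
  have "bump (2 - x) + bump (x - 1) \<noteq> 0" for x :: real
    using bump_nonneg[of "2 - x"] bump_nonneg[of "x - 1"] bump_pos_iff[of "2 - x"] bump_pos_iff[of "x - 1"]
    by (cases "x < 2") linarith+
  then show ?thesis
    unfolding step_def
    by (intro smooth_mult smooth_inverse smooth_add smooth_bump smooth_diff smooth_const f) auto
qed

lemma grid_cell:
  fixes x :: real
  assumes "0 \<le> x" "x \<le> 1" "0 < (N::nat)"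
  shows "\<exists>j<N. real j / N \<le> x \<and> x \<le> (real j + 1) / N"
proof (cases "x = 1")
  case True
  \<comment> \<open>Rounding down would give the nonexistent cell \<open>N\<close>; the right
    endpoint belongs to the last one.\<close>
  then show ?thesis using assms(3) by (intro exI[of _ "N - 1"]) (auto simp: of_nat_diff)
next
  case False
  define j where "j = nat \<lfloor>x * N\<rfloor>"
  have "0 \<le> x * N" "x * N < N" using assms False by (auto simp: mult_less_cancel_right1)
  then have "real j \<le> x * N" "x * N < real j + 1" "j < N"
    unfolding j_def by (auto simp: nat_less_iff floor_less_iff)
  then show ?thesis using assms(3) by (intro exI[of _ j]) (auto simp: field_simps)
qed

text \<open>The box is cut into N^m boxes of side 2\<epsilon>/N, on which the Lipschitz bound limits
  every oscillation by a constant over N. This is the hypothesis of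
  \<open>exists_generic_levels\<close>.\<close>

lemma box_pieces:
  fixes h :: "nat \<Rightarrow> 'p \<Rightarrow> real"
  assumes U: "(U, \<phi>) \<in> \<A>" and K: "clbox m q \<epsilon> \<subseteq> \<phi> ` U" and \<epsilon>: "0 < \<epsilon>" and h: "\<And>s. smooth (h s)"
  shows "\<exists>L\<ge>0. \<forall>N>0. \<exists>P. finite P \<and> card P \<le> N ^ m \<and> {p \<in> U. \<phi> p \<in> clbox m q \<epsilon>} \<subseteq> \<Union>P \<and>
    (\<forall>Q\<in>P. \<forall>p\<in>Q. \<forall>r\<in>Q. \<forall>s\<le>n. \<bar>h s p - h s r\<bar> \<le> L / real N)"
proof -
  let ?K = "clbox m q \<epsilon>"
  have "\<exists>L\<ge>0. \<forall>x\<in>?K. \<forall>y\<in>?K. \<bar>h s (inv_into U \<phi> x) - h s (inv_into U \<phi> y)\<bar> \<le> L * (\<Sum>i<m. \<bar>x i - y i\<bar>)" for s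
    by (rule C_k_on_Lipschitz[OF chart_image_open[OF U] smooth_on_C_k_on[OF smoothD[OF h U, of s]] K]) blast
  then obtain L where L: "\<And>s. L s \<ge> 0" "\<And>s x y. x \<in> ?K \<Longrightarrow> y \<in> ?K \<Longrightarrow>
      \<bar>h s (inv_into U \<phi> x) - h s (inv_into U \<phi> y)\<bar> \<le> L s * (\<Sum>i<m. \<bar>x i - y i\<bar>)" by metis
  define L' where "L' = (\<Sum>s\<le>n. L s)"
  have L': "L s \<le> L'" if "s \<le> n" for s unfolding L'_def using that L(1) by (intro member_le_sum) auto
  have L'0: "L' \<ge> 0" unfolding L'_def using L(1) by (simp add: sum_nonneg)
  define C where "C = L' * (real m * (2 * \<epsilon>))"
  have "\<exists>P. finite P \<and> card P \<le> N ^ m \<and> {p \<in> U. \<phi> p \<in> ?K} \<subseteq> \<Union>P \<and>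
    (\<forall>Q\<in>P. \<forall>p\<in>Q. \<forall>r\<in>Q. \<forall>s\<le>n. \<bar>h s p - h s r\<bar> \<le> C / real N)" if N: "N > 0" for N :: nat
  proof -
    let ?J = "PiE {..<m} (\<lambda>_. {..<N})"
    define lo where "lo i j = q i - \<epsilon> + 2 * \<epsilon> * (real j / N)" for i j
    define Q where "Q j = {p \<in> U. \<phi> p \<in> ?K \<and> (\<forall>i<m. lo i (j i) \<le> \<phi> p i \<and> \<phi> p i \<le> lo i (j i) + 2 * \<epsilon> / N)}" for j
    have "finite ?J" "card ?J = N ^ m" by (auto simp: finite_PiE card_PiE)
    then have "finite (Q ` ?J)" "card (Q ` ?J) \<le> N ^ m"
      using card_image_le[of ?J Q] by auto
    moreover have "{p \<in> U. \<phi> p \<in> ?K} \<subseteq> \<Union>(Q ` ?J)"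
    proof
      fix p assume p: "p \<in> {p \<in> U. \<phi> p \<in> ?K}"
      have "\<exists>j<N. lo i j \<le> \<phi> p i \<and> \<phi> p i \<le> lo i j + 2 * \<epsilon> / N" if i: "i < m" for i
      proof -
        define x where "x = (\<phi> p i - (q i - \<epsilon>)) / (2 * \<epsilon>)"
        have "\<bar>\<phi> p i - q i\<bar> \<le> \<epsilon>" using p i by (simp add: clbox_def)
        then have "0 \<le> x" "x \<le> 1" using \<epsilon> by (auto simp: x_def abs_le_iff)
        then obtain j where j: "j < N" "real j / N \<le> x" "x \<le> (real j + 1) / N"
          using grid_cell N by blast
        have eq: "\<phi> p i = q i - \<epsilon> + 2 * \<epsilon> * x" using \<epsilon> by (simp add: x_def)
        have "2 * \<epsilon> * (real j / N) \<le> 2 * \<epsilon> * x" "2 * \<epsilon> * x \<le> 2 * \<epsilon> * ((real j + 1) / N)"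
          using j \<epsilon> by (intro mult_left_mono; simp)+
        moreover have "2 * \<epsilon> * ((real j + 1) / N) = 2 * \<epsilon> * (real j / N) + 2 * \<epsilon> / N"
          by (simp add: add_divide_distrib distrib_left)
        ultimately show ?thesis using j(1) unfolding eq lo_def by (intro exI[of _ j]) linarith
      qed
      then obtain j where j: "\<And>i. i < m \<Longrightarrow> j i < N \<and> lo i (j i) \<le> \<phi> p i \<and> \<phi> p i \<le> lo i (j i) + 2 * \<epsilon> / N"
        by metis
      have "restrict j {..<m} \<in> ?J" using j by auto
      moreover have "p \<in> Q (restrict j {..<m})" using p j by (auto simp: Q_def)
      ultimately show "p \<in> \<Union>(Q ` ?J)" by blast
    qed
    moreover have "\<bar>h s p - h s r\<bar> \<le> C / N" if "p \<in> Q j" "r \<in> Q j" "s \<le> n" for j p r s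
    proof -
      have pr: "p \<in> U" "r \<in> U" "\<phi> p \<in> ?K" "\<phi> r \<in> ?K" using that by (auto simp: Q_def)
      have "\<bar>\<phi> p i - \<phi> r i\<bar> \<le> 2 * \<epsilon> / N" if "i < m" for i
        using \<open>p \<in> Q j\<close> \<open>r \<in> Q j\<close> that unfolding Q_def by (simp add: abs_le_iff) (smt (verit))
      then have "(\<Sum>i<m. \<bar>\<phi> p i - \<phi> r i\<bar>) \<le> real m * (2 * \<epsilon> / N)"
        using sum_bounded_above[of "{..<m}" "\<lambda>i. \<bar>\<phi> p i - \<phi> r i\<bar>" "2 * \<epsilon> / N"] by simp
      then have "L s * (\<Sum>i<m. \<bar>\<phi> p i - \<phi> r i\<bar>) \<le> L' * (real m * (2 * \<epsilon> / N))"
        using L'[OF that(3)] L(1) L'0 by (intro mult_mono) (auto simp: sum_nonneg)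
      then show ?thesis
        using L(2)[OF pr(3,4), of s] by (simp add: chart_inv[OF U] pr C_def)
    qed
    ultimately show ?thesis by (intro exI[of _ "Q ` ?J"]) blast
  qed
  moreover have "C \<ge> 0" using L'0 \<epsilon> by (simp add: C_def)
  ultimately show ?thesis by blast
qed

text \<open>Disjointness within a colour lets the charts of that colour be treated as one, local
  finiteness makes sums over \<open>k\<close> smooth, and compactness of \<open>K k\<close> allows
  functions given in the chart to be multiplied by \<open>u s k\<close> and extended by 0.\<close>

lemma exists_colouring:
  assumes "topspace M \<noteq> {}"
  obtains U :: "nat \<Rightarrow> 'p set" and \<phi> K and u :: "nat \<Rightarrow> nat \<Rightarrow> 'p \<Rightarrow> real"
  where "\<And>k. (U k, \<phi> k) \<in> \<A>" "\<And>k. compact (K k)" "\<And>k. K k \<subseteq> \<phi> k ` U k"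
    "\<And>s k. smooth (u s k)" "\<And>s k p. u s k p \<noteq> 0 \<Longrightarrow> p \<in> U k \<and> \<phi> k p \<in> K k"
    "\<And>s j k p. u s j p \<noteq> 0 \<Longrightarrow> u s k p \<noteq> 0 \<Longrightarrow> j = k"
    "\<And>p. p \<in> topspace M \<Longrightarrow> \<exists>s\<le>m. \<exists>k. u s k p \<noteq> 0"
    "\<And>p. p \<in> topspace M \<Longrightarrow> \<exists>W n. openin M W \<and> p \<in> W \<and> (\<forall>q\<in>W. \<forall>k\<ge>n. \<forall>s. u s k q = 0)"
proof -
  obtain U :: "nat \<Rightarrow> 'p set" and \<phi> q \<epsilon> and g :: "nat \<Rightarrow> 'p \<Rightarrow> real"
    where U: "\<And>k. (U k, \<phi> k) \<in> \<A>" and K: "\<And>k. clbox m (q k) (\<epsilon> k) \<subseteq> \<phi> k ` U k"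
    and \<epsilon>: "\<And>k. 0 < \<epsilon> k" and g: "\<And>k. smooth (g k)"
    and supp: "\<And>k p. g k p \<noteq> 0 \<Longrightarrow> p \<in> U k \<and> \<phi> k p \<in> clbox m (q k) (\<epsilon> k)"
    and cover: "\<And>p. p \<in> topspace M \<Longrightarrow> \<exists>k. g k p > 2"
    by (rule exists_chart_bumps[OF assms]) (rule that)
  \<comment> \<open>The factors \<open>step (g j p)\<close> make the family locally finite.\<close>
  define h where "h k p = g k p * (\<Prod>j<k. step (g j p))" for k p
  have h: "smooth (h k)" for k
    unfolding h_def[abs_def] by (intro smooth_mult smooth_prod smooth_step g)
  have h_cover: "\<exists>k. h k p > 1" if p: "p \<in> topspace M" for p
  proof -
    obtain k0 where k0: "g k0 p > 2" using cover[OF p] by (rule exE)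
    \<comment> \<open>For earlier indices \<open>g j p \<le> 1\<close>, so all their step factors
      are 1 and \<open>h k p = g k p\<close>.\<close>
    define k where "k = (LEAST k. g k p > 1)"
    have k: "g k p > 1" unfolding k_def by (rule LeastI[where k = k0]) (use k0 in simp)
    have "g j p \<le> 1" if "j < k" for j using not_less_Least[of j "\<lambda>k. g k p > 1"] that by (simp add: k_def)
    then have "(\<Prod>j<k. step (g j p)) = 1" by (intro prod.neutral) (simp add: step_low)
    then show ?thesis using k by (intro exI[of _ k]) (simp add: h_def)
  qed
  have h_finite: "\<exists>W n. openin M W \<and> p \<in> W \<and> (\<forall>q\<in>W. \<forall>k\<ge>n. h k q = 0)" if p: "p \<in> topspace M" for p
  proof -
    \<comment> \<open>The factor \<open>step (g j q)\<close> vanishes wherever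
      \<open>g j q > 2\<close>, which kills all later members near \<open>p\<close>.\<close>
    obtain j where j: "g j p > 2" using cover[OF p] by blast
    let ?W = "{q \<in> topspace M. g j q \<in> {2<..}}"
    have "openin M ?W" by (rule smooth_openin[OF g]) simp
    moreover have "h k q = 0" if q: "q \<in> ?W" and k: "k \<ge> Suc j" for q k
    proof -
      have "step (g j q) = 0" using q by (intro step_high) simp
      then have "(\<Prod>j<k. step (g j q)) = 0" using k by (intro prod_zero) auto
      then show ?thesis by (simp add: h_def)
    qed
    ultimately show ?thesis using j p by (intro exI[of _ ?W] exI[of _ "Suc j"]) blast
  qed
  have h_supp: "p \<in> U k \<and> \<phi> k p \<in> clbox m (q k) (\<epsilon> k)" if "h k p \<noteq> 0" for k p
    using that by (intro supp) (auto simp: h_def)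
  obtain t :: "nat \<times> nat \<Rightarrow> real" where t: "\<And>s k. t (s, k) \<in> {0..1}"
    and generic: "\<And>n p. p \<in> {p \<in> U n. \<phi> n p \<in> clbox m (q n) (\<epsilon> n)} \<Longrightarrow> \<exists>s\<le>m. \<forall>k. h k p \<noteq> t (s, k)"
  proof (rule exists_generic_levels[where h = h and m = m and K = "\<lambda>n. {p \<in> U n. \<phi> n p \<in> clbox m (q n) (\<epsilon> n)}"])
  qed (rule box_pieces[OF U K \<epsilon> h], rule that)
  \<comment> \<open>Positive exactly where \<open>k\<close> is the first index with \<open>h k p > t (s, k)\<close>, unless \<open>p\<close> lies on an earlier
    level set.\<close>
  define u where "u s k p = bump (h k p - t (s, k)) * (\<Prod>j<k. bump (t (s, j) - h j p))" for s k p
  have u_pos: "h k p > t (s, k)" "j < k \<Longrightarrow> h j p < t (s, j)" if u: "u s k p \<noteq> 0" for s j k p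
  proof -
    have "bump (h k p - t (s, k)) \<noteq> 0" "(\<Prod>j<k. bump (t (s, j) - h j p)) \<noteq> 0" using u by (auto simp: u_def)
    then show "h k p > t (s, k)" "j < k \<Longrightarrow> h j p < t (s, j)" by (auto simp: bump_eq_0_iff not_le)
  qed
  \<comment> \<open>The levels are nonnegative, so exceeding one forces \<open>h k p\<close> to be
    nonzero.\<close>
  have u_supp: "h k p \<noteq> 0" if "u s k p \<noteq> 0" for s k p
    using u_pos(1)[OF that] t[of s k] by auto
  show ?thesis
  proof (rule that[of U \<phi> "\<lambda>k. clbox m (q k) (\<epsilon> k)" u])
    show "smooth (u s k)" for s k
      unfolding u_def[abs_def] by (intro smooth_mult smooth_prod smooth_bump smooth_diff smooth_const h)
    show "j = k" if "u s j p \<noteq> 0" "u s k p \<noteq> 0" for s j k p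
      using u_pos[OF that(1)] u_pos[OF that(2)] by (meson less_asym linorder_neqE_nat)
    show "\<exists>s\<le>m. \<exists>k. u s k p \<noteq> 0" if p: "p \<in> topspace M" for p
    proof -
      \<comment> \<open>A value above 1 puts \<open>p\<close> into the support of
        \<open>h k0\<close>, where the levels are generic, and beats every level in [0, 1], so that
        a first index above its level exists.\<close>
      obtain k0 where k0: "h k0 p > 1" using h_cover[OF p] by blast
      then obtain s where s: "s \<le> m" "\<And>k. h k p \<noteq> t (s, k)" using generic[of p k0] h_supp[of k0 p] by auto
      define k where "k = (LEAST k. h k p > t (s, k))"
      have k: "h k p > t (s, k)" unfolding k_def by (rule LeastI[where k = k0]) (use k0 t[of s k0] in simp)
      have "h j p < t (s, j)" if "j < k" for j
        using not_less_Least[of j "\<lambda>k. h k p > t (s, k)"] that s(2)[of j] by (simp add: k_def)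
      then have "(\<Prod>j<k. bump (t (s, j) - h j p)) > 0" by (intro prod_pos) (simp add: bump_pos_iff)
      moreover have "bump (h k p - t (s, k)) > 0" using k by (simp add: bump_pos_iff)
      ultimately have "u s k p > 0" unfolding u_def by (intro mult_pos_pos)
      then have "u s k p \<noteq> 0" by simp
      then show ?thesis using s(1) by blast
    qed
    show "\<exists>W n. openin M W \<and> p \<in> W \<and> (\<forall>q\<in>W. \<forall>k\<ge>n. \<forall>s. u s k q = 0)" if p: "p \<in> topspace M" for p
      using h_finite[OF p] u_supp by metis
  qed (use U K h_supp u_supp compact_clbox in blast)+
qed

end

lemma sum_fun_apply: "(\<Sum>i\<in>I. f i) x = (\<Sum>i\<in>I. f i x :: real)"
  by (induction I rule: infinite_finite_induct) auto

context smooth_manifold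
begin

subsection \<open>Derivations in a chart\<close>

abbreviation "CInf \<equiv> smooth_functions m M \<A>"

lemma smooth_functions_D: "f \<in> CInf \<Longrightarrow> smooth f" "f \<in> CInf \<Longrightarrow> p \<notin> topspace M \<Longrightarrow> f p = 0"
  by (auto simp: smooth_functions_iff)

lemma smooth_functions_I: "smooth f \<Longrightarrow> (\<And>p. p \<notin> topspace M \<Longrightarrow> f p = 0) \<Longrightarrow> f \<in> CInf"
  by (auto simp: smooth_functions_iff)

text \<open>The scalars are constant functions on the whole type. In general they do not vanish
  outside \<open>topspace M\<close>, which is why \<open>C\<close> is kept apart from
  \<open>S\<close>.\<close>

sublocale alg: subset_algebra CInf "range (\<lambda>(c::real) _. c)" "indicator (topspace M)"
proof
  show "a + b \<in> CInf" if "a \<in> CInf" "b \<in> CInf" for a b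
    using smooth_add that by (simp add: smooth_functions_iff plus_fun_def)
  show "a * b \<in> CInf" if "a \<in> CInf" "b \<in> CInf" for a b
    using smooth_mult that by (simp add: smooth_functions_iff times_fun_def)
  show "c * a \<in> CInf" if "c \<in> range (\<lambda>c _. c)" "a \<in> CInf" for c a
    using that smooth_mult[OF smooth_const] by (auto simp: smooth_functions_iff times_fun_def)
  show "indicator (topspace M) \<in> CInf" by (rule one_smooth)
  show "indicator (topspace M) * a = a" if "a \<in> CInf" for a
    using that by (intro ext) (auto simp: smooth_functions_iff indicator_def)
  show "- 1 \<in> range (\<lambda>(c::real) _. c)"
    by (rule range_eqI[of _ _ "-1"]) (simp add: fun_eq_iff)
  show "\<exists>c\<in>range (\<lambda>(c::real) _. c). c * of_nat n = 1" if "n > 0" for n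
    using that by (intro bexI[of _ "\<lambda>_. 1 / real n"] rangeI) (simp add: fun_eq_iff of_nat_fun)
qed

definition mpd :: "'p set \<Rightarrow> ('p \<Rightarrow> nat \<Rightarrow> real) \<Rightarrow> nat \<Rightarrow> ('p \<Rightarrow> real) \<Rightarrow> 'p \<Rightarrow> real" where
  "mpd U \<phi> i a p = pd i (\<lambda>x. a (inv_into U \<phi> x)) (\<phi> p)"

lemma mpd_plus:
  assumes "(U, \<phi>) \<in> \<A>" "a \<in> CInf" "b \<in> CInf" "i < m" "p \<in> U"
  shows "mpd U \<phi> i (a + b) p = mpd U \<phi> i a p + mpd U \<phi> i b p"
  using assms smooth_functions_D smoothD chart_image_open unfolding mpd_def plus_fun_def
  by (intro pd_add[of m "\<phi> ` U"]) auto

lemma mpd_times: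
  assumes "(U, \<phi>) \<in> \<A>" "smooth a" "smooth b" "i < m" "p \<in> U"
  shows "mpd U \<phi> i (a * b) p = mpd U \<phi> i a p * b p + a p * mpd U \<phi> i b p"
  using pd_mult[OF chart_image_open[OF assms(1)] smoothD[OF assms(2,1)] smoothD[OF assms(3,1)] assms(4), of "\<phi> p"]
  by (simp add: mpd_def chart_inv[OF assms(1)] assms(5))

lemma mpd_const: "mpd U \<phi> i (\<lambda>_. c) p = 0"
  by (simp add: mpd_def pd_const)

text \<open>Hadamard's lemma holds only in a box, while \<open>Y\<close> acts on global functions.
  Multiplying by the square of a cutoff provides one factor for each coordinate difference and one
  for its coefficient, and all of them extend by 0. The coefficients \<open>c i\<close> come from
  \<open>Y\<close> on the cut-off coordinate differences, so they do not depend on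
  \<open>a\<close>.\<close>

lemma derivation_chart:
  assumes Y: "alg.derivation Y" and U: "(U, \<phi>) \<in> \<A>" and p: "p \<in> U"
  obtains c where "\<And>a. a \<in> CInf \<Longrightarrow> Y a p = (\<Sum>i<m. c i * mpd U \<phi> i a p)"
proof -
  define q where "q = \<phi> p"
  have qU: "q \<in> \<phi> ` U" and q: "q \<in> Rn m" using p chart_image_Rn[OF U] by (auto simp: q_def)
  obtain \<epsilon> where \<epsilon>: "0 < \<epsilon>" "clbox m q \<epsilon> \<subseteq> \<phi> ` U"
    using openin_Rn_contains_clbox[OF chart_image_open[OF U] qU] .
  let ?B = "obox m q \<epsilon>" and ?K = "clbox m q (\<epsilon> / 2)"
  have KB: "?K \<subseteq> ?B"
  proof
    fix x assume x: "x \<in> ?K"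
    have "\<bar>x i - q i\<bar> < \<epsilon>" if "i < m" for i
    proof -
      have "\<bar>x i - q i\<bar> \<le> \<epsilon> / 2" using x that by (simp add: clbox_def)
      then show ?thesis using \<epsilon>(1) by simp
    qed
    then show "x \<in> ?B" using x by (simp add: clbox_def obox_def)
  qed
  have BU: "?B \<subseteq> \<phi> ` U" using obox_subset_clbox \<epsilon>(2) by (rule order_trans)
  define \<beta> where "\<beta> = box_bump m q (\<epsilon> / 2)"
  have \<beta>0: "\<beta> x = 0" if "x \<in> ?B" "x \<notin> ?K" for x
    unfolding \<beta>_def using box_bump_outside that obox_subset_Rn by blast
  have v: "\<beta> q > 0" unfolding \<beta>_def using \<epsilon>(1) by (simp add: box_bump_center)
  define E where "E g r = (if r \<in> U \<and> \<phi> r \<in> ?K then \<beta> (\<phi> r) * g (\<phi> r) else 0)" for g r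
  have E: "E g \<in> CInf" if g: "smooth_on m ?B g" for g
  proof (rule smooth_functions_I)
    show "smooth (E g)"
    proof (rule smooth_extend[OF U openin_obox BU compact_clbox KB])
      show "smooth_on m ?B (\<lambda>x. \<beta> x * g x)"
        unfolding \<beta>_def by (intro smooth_on_mult smooth_on_box_bump openin_obox g)
    qed (auto simp: E_def \<beta>0)
    show "E g r = 0" if "r \<notin> topspace M" for r
      using that chart_subset[OF U] by (auto simp: E_def)
  qed
  define x where "x i = E (\<lambda>y. y i - q i)" for i
  have x: "x i \<in> CInf" for i
    unfolding x_def by (intro E smooth_on_diff smooth_on_coord smooth_on_const openin_obox)
  define \<zeta> where "\<zeta> = E (\<lambda>y. 1)"
  have \<zeta>: "\<zeta> \<in> CInf" unfolding \<zeta>_def by (intro E smooth_on_const)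
  have pK: "p \<in> U" "\<phi> p \<in> ?K" using p q \<epsilon>(1) by (auto simp: clbox_def Rn_iff q_def)
  have \<zeta>p: "\<zeta> p = \<beta> q" using pK by (simp add: \<zeta>_def E_def q_def)
  have xp: "x i p = 0" for i by (simp add: x_def E_def q_def)
  have "Y a p = (\<Sum>i<m. Y (x i) p / \<beta> q * mpd U \<phi> i a p)" if a: "a \<in> CInf" for a
  proof -
    define F where "F y = a (inv_into U \<phi> y)" for y
    have F: "smooth_on m ?B F"
      unfolding F_def using smooth_on_subset[OF smoothD[OF smooth_functions_D(1)[OF a] U] BU] .
    define G where "G i = edge_integral q i 0 (pd i F)" for i
    have "smooth_on m ?B (G i)" if "i < m" for i
      unfolding G_def smooth_on_def
      using C_k_on_edge_integral[OF q \<epsilon>(1) that] smooth_on_C_k_on[OF smooth_on_pd[OF openin_obox F that]] by blast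
    then have EG: "E (G i) \<in> CInf" if "i < m" for i using E that by blast
    have had: "F y = F q + (\<Sum>i<m. (y i - q i) * G i y)" if "y \<in> ?B" for y
      unfolding G_def using hadamard[OF q \<epsilon>(1) smooth_on_C_k_on[OF F] that] .
    \<comment> \<open>Hadamard's formula times the squared cutoff; both sides are 0 off the small
      box.\<close>
    have eq: "\<zeta> * \<zeta> * a = (\<lambda>_. a p) * (\<zeta> * \<zeta>) + (\<Sum>i<m. x i * E (G i))"
    proof
      fix r
      show "(\<zeta> * \<zeta> * a) r = ((\<lambda>_. a p) * (\<zeta> * \<zeta>) + (\<Sum>i<m. x i * E (G i))) r"
      proof (cases "r \<in> U \<and> \<phi> r \<in> ?K")
        case True
        then have "\<phi> r \<in> ?B" using KB by blast
        from had[OF this] True have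
          "a r = a p + (\<Sum>i<m. (\<phi> r i - q i) * G i (\<phi> r))"
          using p by (simp add: F_def q_def chart_inv[OF U])
        then show ?thesis using True
          by (simp add: \<zeta>_def x_def E_def sum_fun_apply sum_distrib_left distrib_left mult_ac)
      qed (auto simp: \<zeta>_def x_def E_def sum_fun_apply)
    qed
    have lin: "alg.linear Y" using Y by (rule alg.derivation_linear)
    have \<zeta>\<zeta>: "\<zeta> * \<zeta> \<in> CInf" using \<zeta> by (intro alg.mult_S)
    have xE: "x i * E (G i) \<in> CInf" if "i < m" for i using x EG[OF that] by (rule alg.mult_S)
    have sc: "(\<lambda>_. a p) \<in> range (\<lambda>(c::real) _. c)" by blast
    have "Y (\<zeta> * \<zeta> * a) = (\<lambda>_. a p) * Y (\<zeta> * \<zeta>) + (\<Sum>i<m. Y (x i) * E (G i) + x i * Y (E (G i)))"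
      unfolding eq
      using alg.linear_add[OF lin alg.scale_S[OF sc \<zeta>\<zeta>] alg.sum_S[of "{..<m}"]]
        alg.linear_scale[OF lin sc \<zeta>\<zeta>] alg.linear_sum[OF lin, of "{..<m}"] xE
        alg.derivation_mult[OF Y x EG]
      by simp
    moreover have "Y (\<zeta> * \<zeta> * a) = Y (\<zeta> * \<zeta>) * a + \<zeta> * \<zeta> * Y a"
      by (rule alg.derivation_mult[OF Y \<zeta>\<zeta> a])
    ultimately have "(Y (\<zeta> * \<zeta>) * a + \<zeta> * \<zeta> * Y a) p =
        ((\<lambda>_. a p) * Y (\<zeta> * \<zeta>) + (\<Sum>i<m. Y (x i) * E (G i) + x i * Y (E (G i)))) p" by simp
    \<comment> \<open>At \<open>p\<close> the functions \<open>x i\<close> vanish and the two terms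
      containing \<open>Y (\<zeta> * \<zeta>)\<close> cancel.\<close>
    then have "\<beta> q * \<beta> q * Y a p = (\<Sum>i<m. Y (x i) p * E (G i) p)"
      by (simp add: \<zeta>p xp sum_fun_apply)
    also have "\<dots> = (\<Sum>i<m. \<beta> q * (Y (x i) p * mpd U \<phi> i a p))"
    proof (intro sum.cong refl)
      fix i assume "i \<in> {..<m}"
      have "G i q = mpd U \<phi> i a p"
        unfolding G_def edge_integral_base[OF q \<epsilon>(1)] by (simp add: mpd_def q_def F_def[abs_def])
      then show "Y (x i) p * E (G i) p = \<beta> q * (Y (x i) p * mpd U \<phi> i a p)"
        using pK by (simp add: E_def q_def)
    qed
    also have "\<dots> = \<beta> q * (\<Sum>i<m. Y (x i) p * mpd U \<phi> i a p)" by (simp add: sum_distrib_left)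
    finally have "\<beta> q * Y a p = (\<Sum>i<m. Y (x i) p * mpd U \<phi> i a p)" using v by simp
    then show ?thesis using v by (simp add: sum_divide_distrib[symmetric] field_simps)
  qed
  then show ?thesis by (rule that)
qed

subsection \<open>A finite dual basis for the derivations\<close>

text \<open>Index \<open>i < m\<close> of a colour stands for the \<open>i\<close>-th coordinate, multiplied by the colour's cutoff
  functions; index \<open>m\<close> is the cutoff alone, whose field corrects for the derivative of the cutoff.\<close>

definition coordinate :: "('p \<Rightarrow> nat \<Rightarrow> real) \<Rightarrow> nat \<Rightarrow> 'p \<Rightarrow> real" where
  "coordinate \<phi> i p = (if i < m then \<phi> p i else 1)"

definition coordinate_field :: "'p set \<Rightarrow> ('p \<Rightarrow> nat \<Rightarrow> real) \<Rightarrow> nat \<Rightarrow> ('p \<Rightarrow> real) \<Rightarrow> 'p \<Rightarrow> real" where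
  "coordinate_field U \<phi> i a p = (if i < m then mpd U \<phi> i a p else - (\<Sum>l<m. \<phi> p l * mpd U \<phi> l a p))"

lemma coordinate_field_plus:
  assumes "(U, \<phi>) \<in> \<A>" "a \<in> CInf" "b \<in> CInf" "p \<in> U"
  shows "coordinate_field U \<phi> i (a + b) p = coordinate_field U \<phi> i a p + coordinate_field U \<phi> i b p"
  using assms by (simp add: coordinate_field_def mpd_plus distrib_left sum.distrib)

lemma coordinate_field_times:
  assumes "(U, \<phi>) \<in> \<A>" "smooth a" "smooth b" "p \<in> U"
  shows "coordinate_field U \<phi> i (a * b) p = coordinate_field U \<phi> i a p * b p + a p * coordinate_field U \<phi> i b p"
  using assms
  by (simp add: coordinate_field_def mpd_times distrib_left sum.distrib sum_distrib_left sum_distrib_right mult_ac)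

lemma coordinate_field_const: "coordinate_field U \<phi> i (\<lambda>_. c) p = 0"
  by (simp add: coordinate_field_def mpd_const)

lemma smooth_cutoff_coordinate:
  assumes U: "(U, \<phi>) \<in> \<A>" and K: "compact K" "K \<subseteq> \<phi> ` U"
    and u: "smooth u" "\<And>p. u p \<noteq> 0 \<Longrightarrow> p \<in> U \<and> \<phi> p \<in> K"
  shows "smooth (\<lambda>p. u p * coordinate \<phi> i p)"
    and "a \<in> CInf \<Longrightarrow> smooth (\<lambda>p. u p * coordinate_field U \<phi> i a p)"
proof -
  let ?V = "\<phi> ` U"
  have V: "openin (Euclidean_space m) ?V" by (rule chart_image_open[OF U])
  have u': "smooth_on m ?V (\<lambda>x. u (inv_into U \<phi> x))" by (rule smoothD[OF u(1) U])
  have u0: "u (inv_into U \<phi> x) = 0" if "x \<in> ?V" "x \<notin> K" for x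
    using u(2)[of "inv_into U \<phi> x"] f_inv_into_f[OF that(1)] that(2) by auto
  have u1: "u p = 0" if "\<not> (p \<in> U \<and> \<phi> p \<in> K)" for p using u(2) that by blast
  note ext = smooth_extend[OF U V order_refl K]
  show "smooth (\<lambda>p. u p * coordinate \<phi> i p)"
  proof (rule ext)
    show "smooth_on m ?V (\<lambda>x. u (inv_into U \<phi> x) * (if i < m then x i else 1))"
      using smooth_on_mult[OF u' smooth_on_coord[OF V, of i]] u' by (cases "i < m") simp_all
  qed (simp_all add: u0 u1 coordinate_def chart_inv[OF U])
  show "smooth (\<lambda>p. u p * coordinate_field U \<phi> i a p)" if a: "a \<in> CInf"
  proof (rule ext)
    let ?F = "\<lambda>x. a (inv_into U \<phi> x)"
    have F: "smooth_on m ?V (pd l ?F)" if "l < m" for l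
      by (rule smooth_on_pd[OF V smoothD[OF smooth_functions_D(1)[OF a] U] that])
    show "smooth_on m ?V (\<lambda>x. u (inv_into U \<phi> x) *
        (if i < m then pd i ?F x else - 1 * (\<Sum>l<m. x l * pd l ?F x)))"
    proof (intro smooth_on_mult u')
      show "smooth_on m ?V (\<lambda>x. if i < m then pd i ?F x else - 1 * (\<Sum>l<m. x l * pd l ?F x))"
      proof (cases "i < m")
        case True
        then show ?thesis using F by simp
      next
        case False
        have "smooth_on m ?V (\<lambda>x. - 1 * (\<Sum>l<m. x l * pd l ?F x))"
          by (intro smooth_on_mult smooth_on_const smooth_on_sum smooth_on_coord V F) simp
        then show ?thesis using False by simp
      qed
    qed
  qed (simp_all add: u0 u1 coordinate_field_def mpd_def chart_inv[OF U])
qed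

text \<open>Each colour reproduces \<open>Y\<close> up to the square of its glued cutoff
  \<open>f (s, m)\<close>. Summing over the colours gives \<open>w\<close> times \<open>Y\<close>,
  and \<open>w\<close> is positive on \<open>M\<close> because the colours cover.\<close>

theorem exists_finite_dual_basis:
  "\<exists>f \<xi>. finite_dual_basis CInf (range (\<lambda>(c::real) _. c)) (indicator (topspace M))
    ({..m} \<times> {..m}) f (\<xi> :: nat \<times> nat \<Rightarrow> ('p \<Rightarrow> real) \<Rightarrow> 'p \<Rightarrow> real)"
proof (cases "topspace M = {}")
  case True
  have zero: "a = 0" if "a \<in> CInf" for a
    using that True by (auto simp: smooth_functions_iff fun_eq_iff)
  show ?thesis
  proof (intro exI)
    show "finite_dual_basis CInf (range (\<lambda>(c::real) _. c)) (indicator (topspace M))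
      ({..m} \<times> {..m}) (\<lambda>_. 0) (\<lambda>_ a. 0)"
    proof
      show "Y a = (\<Sum>i\<in>{..m} \<times> {..m}. Y 0 * 0)" if "alg.derivation Y" "a \<in> CInf" for Y a
        using zero alg.linear_S[OF alg.derivation_linear[OF that(1)] that(2)] by simp
    qed (auto simp: alg.zero_S alg.derivation_def alg.linear_def)
  qed
next
  case False
  obtain U \<phi> K and u :: "nat \<Rightarrow> nat \<Rightarrow> 'p \<Rightarrow> real"
    where U: "\<And>k. (U k, \<phi> k) \<in> \<A>" and K: "\<And>k. compact (K k)" "\<And>k. K k \<subseteq> \<phi> k ` U k"
    and u: "\<And>s k. smooth (u s k)" and supp: "\<And>s k p. u s k p \<noteq> 0 \<Longrightarrow> p \<in> U k \<and> \<phi> k p \<in> K k"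
    and disjoint: "\<And>s j k p. u s j p \<noteq> 0 \<Longrightarrow> u s k p \<noteq> 0 \<Longrightarrow> j = k"
    and cover: "\<And>p. p \<in> topspace M \<Longrightarrow> \<exists>s\<le>m. \<exists>k. u s k p \<noteq> 0"
    and lf: "\<And>p. p \<in> topspace M \<Longrightarrow> \<exists>W n. openin M W \<and> p \<in> W \<and> (\<forall>q\<in>W. \<forall>k\<ge>n. \<forall>s. u s k q = 0)"
    by (rule exists_colouring[OF False]) (rule that)
  have collapse: "(\<Sum>k. u s k p * v k) = u s k p * v k" if "u s k p \<noteq> 0" for s k p v
  proof -
    have "(\<Sum>k. u s k p * v k) = (\<Sum>k\<in>{k}. u s k p * v k)"
      using disjoint[OF that] by (intro suminf_finite) auto
    then show ?thesis by simp
  qed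
  have smooth_colour_sum: "smooth (\<lambda>p. \<Sum>k. u s k p * v k p)" if "\<And>k. smooth (\<lambda>p. u s k p * v k p)" for s v
  proof (rule smooth_suminf[OF that])
    show "\<exists>W n. openin M W \<and> p \<in> W \<and> (\<forall>q\<in>W. \<forall>k\<ge>n. u s k q * v k q = 0)" if "p \<in> topspace M" for p
      using lf[OF that] by (elim exE conjE) (intro exI conjI, auto)
  qed
  \<comment> \<open>Formally a series, but at each point at most one summand is nonzero.\<close>
  define f where "f = (\<lambda>(s, i) p. \<Sum>k. u s k p * coordinate (\<phi> k) i p)"
  define \<eta> where "\<eta> = (\<lambda>(s, i) a p. \<Sum>k. u s k p * coordinate_field (U k) (\<phi> k) i a p)"
  define w where "w p = (\<Sum>s\<le>m. f (s, m) p * f (s, m) p)" for p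
  define \<xi> where "\<xi> j a p = inverse (w p) * \<eta> j a p" for j a p
  have f_smooth: "smooth (f j)" for j
    unfolding f_def by (cases j) (auto intro!: smooth_colour_sum smooth_cutoff_coordinate[OF U K u supp])
  have outside: "u s k p = 0" if "p \<notin> topspace M" for s k p
    using supp[of s k p] chart_subset[OF U] that by blast
  have f: "f j \<in> CInf" for j
    by (rule smooth_functions_I[OF f_smooth]) (cases j, simp add: f_def outside)
  have w_pos: "w p > 0" if p: "p \<in> topspace M" for p
  proof -
    obtain s k where s: "s \<le> m" "u s k p \<noteq> 0" using cover[OF p] by blast
    have "f (s, m) p = u s k p" using collapse[OF s(2), of "\<lambda>_. 1"] by (simp add: f_def coordinate_def)
    then show ?thesis unfolding w_def using s by (intro sum_pos2[of _ s]) (auto simp: zero_less_mult_iff)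
  qed
  have w_smooth: "smooth (\<lambda>p. inverse (w p))"
  proof (rule smooth_inverse)
    show "smooth w" unfolding w_def[abs_def] by (intro smooth_sum smooth_mult f_smooth)
    show "w p \<noteq> 0" if "p \<in> topspace M" for p using w_pos[OF that] by simp
  qed
  have \<xi>: "\<xi> j a \<in> CInf" if a: "a \<in> CInf" for j a
  proof (rule smooth_functions_I)
    have "smooth (\<eta> j a)"
      unfolding \<eta>_def by (cases j) (auto intro!: smooth_colour_sum smooth_cutoff_coordinate(2)[OF U K u supp] a)
    then show "smooth (\<xi> j a)" unfolding \<xi>_def[abs_def] by (intro smooth_mult w_smooth)
    show "\<xi> j a p = 0" if "p \<notin> topspace M" for p
      using outside[OF that] by (cases j) (simp add: \<xi>_def \<eta>_def)
  qed
  \<comment> \<open>The chart chosen at \<open>p\<close> is independent of \<open>i\<close> and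
    \<open>a\<close>, so identities of coordinate fields pass to \<open>\<eta>\<close>
    pointwise.\<close>
  have \<eta>_cases: "(\<exists>k. p \<in> U k \<and> (\<forall>i a. \<eta> (s, i) a p = u s k p * coordinate_field (U k) (\<phi> k) i a p)) \<or>
      (\<forall>i a. \<eta> (s, i) a p = 0)" for s p
  proof (cases "\<exists>k. u s k p \<noteq> 0")
    case True
    then obtain k where k: "u s k p \<noteq> 0" by blast
    have "\<eta> (s, i) a p = u s k p * coordinate_field (U k) (\<phi> k) i a p" for i a
      by (simp add: \<eta>_def collapse[OF k])
    then show ?thesis using supp[OF k] by blast
  qed (simp add: \<eta>_def)
  have \<eta>_plus: "\<eta> j (a + b) p = \<eta> j a p + \<eta> j b p" if "a \<in> CInf" "b \<in> CInf" for j a b p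
    using \<eta>_cases[of p "fst j"] coordinate_field_plus[OF U that, of p]
    by (cases j) (auto simp: distrib_left)
  have \<eta>_times: "\<eta> j (a * b) p = \<eta> j a p * b p + a p * \<eta> j b p" if "smooth a" "smooth b" for j a b p
    using \<eta>_cases[of p "fst j"] coordinate_field_times[OF U that, of p]
    by (cases j) (auto simp: distrib_left mult_ac)
  have \<eta>_const: "\<eta> j (\<lambda>_. c) p = 0" for j c p
    using \<eta>_cases[of p "fst j"] by (cases j) (auto simp: coordinate_field_const)
  have \<xi>_der: "alg.derivation (\<xi> j)" for j
    unfolding alg.derivation_def alg.linear_def
  proof (intro conjI ballI)
    fix a assume a: "a \<in> CInf"
    show "\<xi> j a \<in> CInf" by (rule \<xi>[OF a])
    fix b assume b: "b \<in> CInf"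
    show "\<xi> j (a + b) = \<xi> j a + \<xi> j b"
      by (intro ext) (simp add: \<xi>_def \<eta>_plus[OF a b] distrib_left)
    show "\<xi> j (a * b) = \<xi> j a * b + a * \<xi> j b"
      by (intro ext) (simp add: \<xi>_def \<eta>_times[OF smooth_functions_D(1)[OF a] smooth_functions_D(1)[OF b]]
          distrib_left mult_ac)
  next
    fix c :: "'p \<Rightarrow> real" and a assume c: "c \<in> range (\<lambda>c _. c)" and a: "a \<in> CInf"
    then obtain c' where c': "c = (\<lambda>_. c')" by blast
    show "\<xi> j (c * a) = c * \<xi> j a"
      using \<eta>_times[OF smooth_const smooth_functions_D(1)[OF a], of j c'] \<eta>_const
      by (intro ext) (simp add: \<xi>_def c')
  qed
  have "finite_dual_basis CInf (range (\<lambda>(c::real) _. c)) (indicator (topspace M)) ({..m} \<times> {..m}) f \<xi>"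
  proof
    fix Y a assume Y: "alg.derivation Y" and a: "a \<in> CInf"
    have Yf: "Y (f j) \<in> CInf" for j using alg.linear_S[OF alg.derivation_linear[OF Y] f] .
    \<comment> \<open>With u the cutoff, Y(u \<phi>_i) = Y(u) \<phi>_i + u Y(\<phi>_i). The first
      \<open>m\<close> terms give u^2 Y(a) plus u Y(u) times the radial derivative of
      \<open>a\<close>; the term of index \<open>m\<close> subtracts the latter.\<close>
    have colour: "(\<Sum>i\<le>m. Y (f (s, i)) p * \<eta> (s, i) a p) = f (s, m) p * f (s, m) p * Y a p"
      if p: "p \<in> topspace M" for s p
    proof (cases "\<exists>k. u s k p \<noteq> 0")
      case False
      then show ?thesis by (simp add: f_def \<eta>_def)
    next
      case True
      then obtain k where k: "u s k p \<noteq> 0" by blast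
      let ?U = "U k" and ?\<phi> = "\<phi> k" and ?u = "u s k"
      have pU: "p \<in> ?U" using supp[OF k] by blast
      obtain c where c: "\<And>a. a \<in> CInf \<Longrightarrow> Y a p = (\<Sum>l<m. c l * mpd ?U ?\<phi> l a p)"
        using derivation_chart[OF Y U pU] by blast
      \<comment> \<open>\<open>f (s, i)\<close> is known to be cutoff times coordinate only where
        \<open>u s k\<close> does not vanish; this set is open, which suffices for partial
        derivatives at \<open>p\<close>.\<close>
      define N where "N = ?\<phi> ` (?U \<inter> {q \<in> topspace M. ?u q \<in> - {0}})"
      have N: "openin (Euclidean_space m) N" unfolding N_def
        using chart_open[OF U] smooth_openin[OF u, of "- {0}"]
        by (intro chart_image_openin[OF U] openin_Int) auto
      have pN: "?\<phi> p \<in> N" unfolding N_def using pU p k by blast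
      have loc: "f (s, i) (inv_into ?U ?\<phi> x) = ?u (inv_into ?U ?\<phi> x) * (if i < m then x i else 1)" if "x \<in> N" for x i
        using that collapse[of s k] collapse[of s k _ "\<lambda>_. 1"] by (auto simp: N_def f_def coordinate_def chart_inv[OF U])
      have df: "mpd ?U ?\<phi> l (f (s, i)) p =
          (if i < m then mpd ?U ?\<phi> l ?u p * ?\<phi> p i + (if l = i then ?u p else 0) else mpd ?U ?\<phi> l ?u p)"
        if l: "l < m" for l i
      proof -
        let ?g = "\<lambda>x. ?u (inv_into ?U ?\<phi> x)"
        have "mpd ?U ?\<phi> l (f (s, i)) p = pd l (\<lambda>x. ?g x * (if i < m then x i else 1)) (?\<phi> p)"
          unfolding mpd_def by (rule pd_cong[OF N pN l loc])
        also have "\<dots> = pd l ?g (?\<phi> p) * (if i < m then ?\<phi> p i else 1) +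
            ?g (?\<phi> p) * pd l (\<lambda>x. if i < m then x i else 1) (?\<phi> p)"
        proof (rule pd_mult[OF chart_image_open[OF U] smoothD[OF u U] _ l])
          show "smooth_on m (?\<phi> ` ?U) (\<lambda>x. if i < m then x i else 1)"
            by (cases "i < m") (simp_all add: smooth_on_coord[OF chart_image_open[OF U]] smooth_on_const)
        qed (use pU in blast)
        also have "pd l (\<lambda>x. if i < m then x i else 1) (?\<phi> p) = (if i < m \<and> l = i then 1 else 0)"
          by (cases "i < m") (auto simp: pd_coord pd_const)
        finally show ?thesis by (simp add: mpd_def chart_inv[OF U pU])
      qed
      define d where "d = (\<Sum>l<m. c l * mpd ?U ?\<phi> l ?u p)"
      have Yfm: "Y (f (s, m)) p = d"
        unfolding d_def c[OF f] by (intro sum.cong refl) (simp add: df)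
      have Yfi: "Y (f (s, i)) p = d * ?\<phi> p i + c i * ?u p" if i: "i < m" for i
      proof -
        have "Y (f (s, i)) p = (\<Sum>l<m. c l * mpd ?U ?\<phi> l ?u p * ?\<phi> p i + (if l = i then c l * ?u p else 0))"
          unfolding c[OF f] by (intro sum.cong refl) (simp add: df i distrib_left)
        then show ?thesis using i by (simp add: sum.distrib d_def sum_distrib_right)
      qed
      have \<eta>: "\<eta> (s, i) a p = ?u p * coordinate_field ?U ?\<phi> i a p" for i
        by (simp add: \<eta>_def collapse[OF k])
      have fm: "f (s, m) p = ?u p" using collapse[OF k, of "\<lambda>_. 1"] by (simp add: f_def coordinate_def)
      have "(\<Sum>i\<le>m. Y (f (s, i)) p * \<eta> (s, i) a p) =
          (\<Sum>i<m. Y (f (s, i)) p * \<eta> (s, i) a p) + Y (f (s, m)) p * \<eta> (s, m) a p"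
        by (simp add: lessThan_Suc_atMost[symmetric])
      also have "(\<Sum>i<m. Y (f (s, i)) p * \<eta> (s, i) a p) =
          (\<Sum>i<m. d * ?u p * (?\<phi> p i * mpd ?U ?\<phi> i a p) + ?u p * ?u p * (c i * mpd ?U ?\<phi> i a p))"
        by (intro sum.cong refl) (simp add: Yfi \<eta> coordinate_field_def algebra_simps)
      also have "\<dots> = d * ?u p * (\<Sum>i<m. ?\<phi> p i * mpd ?U ?\<phi> i a p) + ?u p * ?u p * Y a p"
        by (simp add: sum.distrib sum_distrib_left c[OF a])
      also have "\<dots> + Y (f (s, m)) p * \<eta> (s, m) a p = ?u p * ?u p * Y a p"
        by (simp add: Yfm \<eta> coordinate_field_def)
      finally show ?thesis by (simp add: fm)
    qed
    show "Y a = (\<Sum>j\<in>{..m} \<times> {..m}. Y (f j) * \<xi> j a)"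
    proof
      fix p
      show "Y a p = (\<Sum>j\<in>{..m} \<times> {..m}. Y (f j) * \<xi> j a) p"
      proof (cases "p \<in> topspace M")
        case True
        have "(\<Sum>j\<in>{..m} \<times> {..m}. Y (f j) * \<xi> j a) p = (\<Sum>s\<le>m. \<Sum>i\<le>m. Y (f (s, i)) p * \<xi> (s, i) a p)"
          by (simp add: sum_fun_apply sum.cartesian_product)
        also have "\<dots> = inverse (w p) * (\<Sum>s\<le>m. \<Sum>i\<le>m. Y (f (s, i)) p * \<eta> (s, i) a p)"
          by (simp add: \<xi>_def sum_distrib_left mult_ac)
        also have "\<dots> = inverse (w p) * (w p * Y a p)"
          by (simp add: colour[OF True] w_def sum_distrib_right)
        also have "\<dots> = Y a p" using w_pos[OF True] by simp
        finally show ?thesis by simp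
      next
        case False
        then show ?thesis
          using smooth_functions_D(2)[OF Yf] smooth_functions_D(2)[OF alg.linear_S[OF alg.derivation_linear[OF Y] a]]
          by (simp add: sum_fun_apply)
      qed
    qed
  qed (use f \<xi>_der in auto)
  then show ?thesis by blast
qed

subsection \<open>The algebra of smooth functions\<close>

lemma smooth_algebra_simps:
  "carrier (smooth_algebra m M \<A>) = CInf"
  "f \<otimes>\<^bsub>smooth_algebra m M \<A>\<^esub> g = f * g"
  "f \<oplus>\<^bsub>smooth_algebra m M \<A>\<^esub> g = f + g"
  "c \<odot>\<^bsub>smooth_algebra m M \<A>\<^esub> f = (\<lambda>_. c) * f"
  "\<one>\<^bsub>smooth_algebra m M \<A>\<^esub> = indicator (topspace M)"
  "\<zero>\<^bsub>smooth_algebra m M \<A>\<^esub> = 0"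
  by (simp_all add: smooth_algebra_def plus_fun_def times_fun_def zero_fun_def)

lemma carrier_real_scalars: "carrier real_scalars = (UNIV :: real set)"
  by (simp add: ring_of_type_algebra_def)

lemma smooth_algebra_minus:
  assumes "f \<in> CInf" "g \<in> CInf"
  shows "f \<ominus>\<^bsub>smooth_algebra m M \<A>\<^esub> g = f - g"
proof -
  interpret R: algebra real_scalars "smooth_algebra m M \<A>" by (rule algebra_smooth_algebra)
  have "g + (\<ominus>\<^bsub>smooth_algebra m M \<A>\<^esub> g) = 0"
    using R.r_neg[of g] assms(2) by (simp only: smooth_algebra_simps)
  then have "\<ominus>\<^bsub>smooth_algebra m M \<A>\<^esub> g = - g"
    by (simp add: eq_neg_iff_add_eq_0 add.commute)
  then show ?thesis
    unfolding a_minus_def by (simp only: smooth_algebra_simps diff_conv_add_uminus)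
qed

lemma smooth_algebra_finsum:
  assumes "finite I" "\<And>i. i \<in> I \<Longrightarrow> f i \<in> CInf"
  shows "(\<Oplus>\<^bsub>smooth_algebra m M \<A>\<^esub> i\<in>I. f i) = (\<Sum>i\<in>I. f i)"
proof -
  interpret R: algebra real_scalars "smooth_algebra m M \<A>" by (rule algebra_smooth_algebra)
  show ?thesis using assms
  proof (induction I rule: finite_induct)
    case (insert i I)
    then have "f \<in> I \<rightarrow> carrier (smooth_algebra m M \<A>)" "f i \<in> carrier (smooth_algebra m M \<A>)"
      by (auto simp: smooth_algebra_simps)
    from R.finsum_insert[OF insert.hyps this] insert show ?case
      by (simp add: smooth_algebra_simps)
  qed (simp add: smooth_algebra_simps)
qed

section \<open>Transfer of the algebraic notions to \<open>smooth_algebra\<close>\<close>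

lemma linear_maps_smooth_algebra:
  "L \<in> linear_maps real_scalars (smooth_algebra m M \<A>) \<longleftrightarrow> alg.linear L"
  by (auto simp: linear_maps_def alg.linear_def smooth_algebra_simps carrier_real_scalars)

lemma Der_smooth_algebra: "L \<in> Der real_scalars (smooth_algebra m M \<A>) \<longleftrightarrow> alg.derivation L"
  by (auto simp: Der_def alg.derivation_def linear_maps_smooth_algebra smooth_algebra_simps)

text \<open>The index of \<open>diff_ops\<close> is the order, that of \<open>diff_op\<close> the
  order plus one.\<close>

lemma diff_op_smooth_algebra:
  "D \<in> diff_ops real_scalars (smooth_algebra m M \<A>) r \<Longrightarrow> alg.diff_op (Suc r) D"
proof (induction r arbitrary: D)
  case 0
  then obtain a where "a \<in> CInf" "\<And>b. b \<in> CInf \<Longrightarrow> a * b = D b"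
    by (auto simp: smooth_algebra_simps)
  then show ?case using alg.diff_op_cong[OF alg.diff_op_mult] by blast
next
  case (Suc r)
  then have lin: "alg.linear D" by (simp add: linear_maps_smooth_algebra)
  have "alg.diff_op (Suc r) (alg.commutator D a)" if a: "a \<in> CInf" for a
  proof (rule alg.diff_op_cong[OF Suc.IH])
    let ?C = "\<lambda>b. D (a \<otimes>\<^bsub>smooth_algebra m M \<A>\<^esub> b) \<ominus>\<^bsub>smooth_algebra m M \<A>\<^esub> a \<otimes>\<^bsub>smooth_algebra m M \<A>\<^esub> D b"
    show "?C \<in> diff_ops real_scalars (smooth_algebra m M \<A>) r"
      using Suc.prems a by (simp add: smooth_algebra_simps(1))
    show "?C b = alg.commutator D a b" if b: "b \<in> CInf" for b
      using a b lin
      by (simp add: smooth_algebra_simps(2) alg.commutator_def smooth_algebra_minus alg.mult_S alg.linear_S)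
  qed
  then show ?case using lin by (simp del: alg.diff_op.simps add: alg.diff_op.simps(2)[of "Suc r"])
qed

end

theorem theorem4p2:
  fixes m r :: nat
    and M :: "'p topology"
    and \<A> :: "('p set \<times> ('p \<Rightarrow> nat \<Rightarrow> real)) set"
    and D :: "('p \<Rightarrow> real) \<Rightarrow> ('p \<Rightarrow> real)"
  assumes "smooth_manifold m M \<A>"
    and "r \<ge> 1"
    and "D \<in> derivations_of_order real_scalars (smooth_algebra m M \<A>) r"
  shows "D \<in> SDer real_scalars (smooth_algebra m M \<A>) r"
proof -
  interpret smooth_manifold m M \<A> by (rule assms(1))
  obtain f and \<xi> :: "nat \<times> nat \<Rightarrow> ('p \<Rightarrow> real) \<Rightarrow> 'p \<Rightarrow> real" where
    "finite_dual_basis CInf (range (\<lambda>(c::real) _. c)) (indicator (topspace M)) ({..m} \<times> {..m}) f \<xi>"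
    using exists_finite_dual_basis by blast
  then interpret finite_dual_basis CInf "range (\<lambda>(c::real) _. c)" "indicator (topspace M)" "{..m} \<times> {..m}" f \<xi> .
  have D: "alg.diff_op (Suc r) D"
    using assms(3) by (intro diff_op_smooth_algebra) (simp add: derivations_of_order_def)
  then have lin: "alg.linear D" by (rule alg.diff_op_linear)
  have "D (1 \<odot>\<^bsub>smooth_algebra m M \<A>\<^esub> \<one>\<^bsub>smooth_algebra m M \<A>\<^esub>) = \<zero>\<^bsub>smooth_algebra m M \<A>\<^esub>"
    using assms(3) by (simp add: derivations_of_order_def carrier_real_scalars)
  then have "D (indicator (topspace M)) = 0"
    by (simp add: smooth_algebra_simps times_fun_def)
  from diff_op_composite_sum[OF D this] obtain ws where
    ws: "\<And>w. w \<in> set ws \<Longrightarrow> (\<forall>Y\<in>set w. alg.derivation Y) \<and> 1 \<le> length w \<and> length w \<le> r"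
    and D_eq: "\<And>a. a \<in> CInf \<Longrightarrow> D a = (\<Sum>w\<leftarrow>ws. foldr (\<circ>) w id a)"
    unfolding composite_sum_def by blast
  have wsj: "\<forall>Y\<in>set (ws ! j). alg.derivation Y" "1 \<le> length (ws ! j)" "length (ws ! j) \<le> r"
    if "j < length ws" for j
    using ws[OF nth_mem[OF that]] by simp_all
  have foldr_S: "foldr (\<circ>) w id a \<in> CInf" if "\<forall>Y\<in>set w. alg.derivation Y" "a \<in> CInf" for w a
    using that by (induction w) (auto intro: alg.linear_S alg.derivation_linear)
  \<comment> \<open>All coefficients are 1, as the scalars already sit inside the words.\<close>
  have "D a = (\<Oplus>\<^bsub>smooth_algebra m M \<A>\<^esub> j\<in>{..<length ws}. 1 \<odot>\<^bsub>smooth_algebra m M \<A>\<^esub> foldr (\<circ>) (ws ! j) id a)"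
    if a: "a \<in> CInf" for a
  proof -
    have one: "(1::real) \<odot>\<^bsub>smooth_algebra m M \<A>\<^esub> b = b" for b
      by (simp add: smooth_algebra_simps times_fun_def)
    have "D a = (\<Sum>j<length ws. foldr (\<circ>) (ws ! j) id a)"
      by (simp add: D_eq[OF a] sum_list_sum_nth atLeast0LessThan)
    also have "\<dots> = (\<Oplus>\<^bsub>smooth_algebra m M \<A>\<^esub> j\<in>{..<length ws}. foldr (\<circ>) (ws ! j) id a)"
      using wsj foldr_S[OF _ a] by (intro smooth_algebra_finsum[symmetric]) auto
    finally show ?thesis by (simp only: one)
  qed
  then show ?thesis
    unfolding SDer_def mem_Collect_eq linear_maps_smooth_algebra smooth_algebra_simps(1)
    using lin wsj
    by (intro conjI exI[of _ "length ws"] exI[of _ "\<lambda>_. 1"] exI[of _ "(!) ws"])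
      (auto simp: carrier_real_scalars Der_smooth_algebra)
qed

end
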